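(* Let $\Omega\subseteq\mathbb{R}^d$, $d\ge2$, be a bounded domain, $I:=(0,T)$, $T<\infty$, $Q_T:=I\times\Omega$ and $p\in C^0(\overline{Q_T})$ with $p^->1$. Then for every $\epsilon\in(0,(p^-)_*-1]$ there exists a constant $c_\epsilon=c(\epsilon,d,p,\Omega)>0$ such that every $\boldsymbol{u}\in\mathcal{X}^{2,p}_{\varepsilon}(Q_T)\cap\mathcal{Y}^\infty(Q_T)$ satisfies $\boldsymbol{u}\in L^{p_*(\cdot,\cdot)-\epsilon}(Q_T)^d$ with $$\|\boldsymbol{u}\|_{L^{p_*(\cdot,\cdot)-\epsilon}(Q_T)^d}\le c_\epsilon\big(\|\boldsymbol{\varepsilon}(\boldsymbol{u})\|_{L^{p(\cdot,\cdot)}(Q_T)^{d\times d}}+\|\boldsymbol{u}\|_{\mathcal{Y}^\infty(Q_T)}\big),$$ i.e. the embedding $\mathcal{X}^{2,p}_{\varepsilon}(Q_T)\cap\mathcal{Y}^\infty(Q_T)\hookrightarrow L^{p_*(\cdot,\cdot)-\epsilon}(Q_T)^d$ holds for all $\epsilon\in(0,(p^-)_*-1]$.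
   Context: For $s\in[1,\infty)$ the parabolic interpolation exponent is $s_*:=s\frac{d+2}{d}$ if $s<d$ and $s_*:=s+2$ if $s\ge d$; for an exponent function $p$, $p_*(t,x):=(p(t,x))_*$. For a measurable bounded exponent $p$ on a bounded measurable set $G$ with values in $[1,\infty)$, $p^-$ and $p^+$ denote its essential infimum and supremum; $L^{p(\cdot)}(G)$ is the space of measurable $f$ with finite modular $\rho_{p(\cdot)}(f):=\int_G|f(x)|^{p(x)}dx$, with the Luxemburg norm $\|f\|:=\inf\{\lambda>0:\rho_{p(\cdot)}(f/\lambda)\le1\}$ (likewise for vector- and matrix-valued functions). $\mathbb{M}^{d\times d}_{\mathrm{sym}}$ denotes the symmetric real $d\times d$ matrices and $\boldsymbol{\varepsilon}(\mathbf{u}):=\frac12(\nabla\mathbf{u}+\nabla\mathbf{u}^\top)$ (gradient in the space variable, in the distributional sense). For $t\in I$, $X^{2,p}_{\varepsilon}(t)$ is the closure of $C_0^\infty(\Omega)^d$ in $\{\mathbf{f}\in L^2(\Omega)^d:\boldsymbol{\varepsilon}(\mathbf{f})\in L^{p(t,\cdot)}(\Omega,\mathbb{M}^{d\times d}_{\mathrm{sym}})\}$ with respect to the norm $\|\cdot\|_{L^2(\Omega)^d}+\|\boldsymbol{\varepsilon}(\cdot)\|_{L^{p(t,\cdot)}(\Omega)^{d\times d}}$. $\mathcal{X}^{2,p}_{\varepsilon}(Q_T):=\{\boldsymbol{u}\in L^2(Q_T)^d:\boldsymbol{\varepsilon}(\boldsymbol{u})\in L^{p(\cdot,\cdot)}(Q_T,\mathbb{M}^{d\times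 d}_{\mathrm{sym}}),\ \boldsymbol{u}(t)\in X^{2,p}_{\varepsilon}(t)\text{ for a.e. }t\in I\}$ with norm $\|\cdot\|_{L^2(Q_T)^d}+\|\boldsymbol{\varepsilon}(\cdot)\|_{L^{p(\cdot,\cdot)}(Q_T)^{d\times d}}$. $Y:=L^2(\Omega)^d$ and $\mathcal{Y}^\infty(Q_T):=L^\infty(I,Y)$; the intersection carries the sum of the norms. *)

theory Defs
  imports "HOL-Analysis.Analysis" "HOL-Probability.Essential_Supremum"
begin

text \<open>Elements of the function spaces below are represented by functions on the whole type; only
  their values on the underlying set \<open>G\<close> (up to Lebesgue null sets) matter.\<close>

section \<open>Exponents and variable exponent Lebesgue spaces\<close>

definition parabolic_exponent :: "nat \<Rightarrow> real \<Rightarrow> real" where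
  "parabolic_exponent d s = (if s < real d then s * ((real d + 2) / real d) else s + 2)"

definition ess_inf :: "'a::euclidean_space set \<Rightarrow> ('a \<Rightarrow> real) \<Rightarrow> real" where
  "ess_inf G p = real_of_ereal (- esssup (lebesgue_on G) (\<lambda>x. - ereal (p x)))"

text \<open>The norm on \<open>real^'d^'d\<close> is the Frobenius norm.\<close>

definition modular ::
  "'a::euclidean_space set \<Rightarrow> ('a \<Rightarrow> real) \<Rightarrow> ('a \<Rightarrow> 'b::euclidean_space) \<Rightarrow> ennreal" where
  "modular G p f = (\<integral>\<^sup>+ x. ennreal (norm (f x) powr p x) \<partial>lebesgue_on G)"

definition Lp_var ::
  "'a::euclidean_space set \<Rightarrow> ('a \<Rightarrow> real) \<Rightarrow> ('a \<Rightarrow> 'b::euclidean_space) set" where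
  "Lp_var G p = {f. f \<in> borel_measurable (lebesgue_on G) \<and> modular G p f < \<infinity>}"

definition Lp_var_norm ::
  "'a::euclidean_space set \<Rightarrow> ('a \<Rightarrow> real) \<Rightarrow> ('a \<Rightarrow> 'b::euclidean_space) \<Rightarrow> real" where
  "Lp_var_norm G p f = Inf {l. l > 0 \<and> modular G p (\<lambda>x. (1 / l) *\<^sub>R f x) \<le> 1}"

definition Lp_var_sym ::
  "'a::euclidean_space set \<Rightarrow> ('a \<Rightarrow> real) \<Rightarrow> ('a \<Rightarrow> real^'d^'d) set" where
  "Lp_var_sym G p = {E \<in> Lp_var G p. AE x in lebesgue_on G. transpose (E x) = E x}"

definition L2 :: "'a::euclidean_space set \<Rightarrow> ('a \<Rightarrow> 'b::euclidean_space) set" where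
  "L2 G = {f. f \<in> borel_measurable (lebesgue_on G) \<and>
              integrable (lebesgue_on G) (\<lambda>x. (norm (f x))\<^sup>2)}"

definition L2_norm :: "'a::euclidean_space set \<Rightarrow> ('a \<Rightarrow> 'b::euclidean_space) \<Rightarrow> real" where
  "L2_norm G f = sqrt (LINT x|lebesgue_on G. (norm (f x))\<^sup>2)"

section \<open>Test functions and the distributional symmetric gradient\<close>

primrec Ck :: "nat \<Rightarrow> ('a::euclidean_space \<Rightarrow> 'b::real_normed_vector) \<Rightarrow> bool" where
  "Ck 0 f \<longleftrightarrow> continuous_on UNIV f"
| "Ck (Suc k) f \<longleftrightarrow> (\<forall>x. f differentiable (at x)) \<and>
     (\<forall>v\<in>Basis. Ck k (\<lambda>x. frechet_derivative f (at x) v))"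

text \<open>Functions in \<open>C0inf G\<close> are extended by zero outside \<open>G\<close>.\<close>

definition C0inf :: "'a::euclidean_space set \<Rightarrow> ('a \<Rightarrow> 'b::real_normed_vector) set" where
  "C0inf G = {\<phi>. (\<forall>k. Ck k \<phi>) \<and> compact (closure {x. \<phi> x \<noteq> 0}) \<and> closure {x. \<phi> x \<noteq> 0} \<subseteq> G}"

definition locally_integrable ::
  "'a::euclidean_space set \<Rightarrow> ('a \<Rightarrow> 'b::euclidean_space) \<Rightarrow> bool" where
  "locally_integrable G f \<longleftrightarrow> (\<forall>K. compact K \<longrightarrow> K \<subseteq> G \<longrightarrow> set_integrable lebesgue K f)"

text \<open>The value at the test function \<open>\<phi>\<close> of the distributional derivative of \<open>f\<close> in direction \<open>v\<close>.\<close>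

definition distr_deriv ::
  "'a::euclidean_space set \<Rightarrow> 'a \<Rightarrow> ('a \<Rightarrow> real) \<Rightarrow> ('a \<Rightarrow> real) \<Rightarrow> real" where
  "distr_deriv G v f \<phi> = - (LINT x|lebesgue_on G. f x * frechet_derivative \<phi> (at x) v)"

text \<open>The family \<open>e\<close> embeds the spatial coordinate directions into the domain of \<open>u\<close>, so that one
  definition serves both functions on \<open>\<Omega>\<close> and functions on the space-time cylinder.\<close>

definition is_sym_grad ::
  "('d::finite \<Rightarrow> 'a) \<Rightarrow> 'a::euclidean_space set \<Rightarrow> ('a \<Rightarrow> real^'d) \<Rightarrow> ('a \<Rightarrow> real^'d^'d) \<Rightarrow> bool" where
  "is_sym_grad e G u E \<longleftrightarrow>
     locally_integrable G u \<and> locally_integrable G E \<and>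
     (\<forall>\<phi>\<in>C0inf G. \<forall>i j.
        (LINT x|lebesgue_on G. E x $ i $ j * \<phi> x) =
        1 / 2 * (distr_deriv G (e j) (\<lambda>x. u x $ i) \<phi> + distr_deriv G (e i) (\<lambda>x. u x $ j) \<phi>))"

text \<open>The representative is unique up to null sets, so the choice below does not affect norms.\<close>

definition sym_grad ::
  "('d::finite \<Rightarrow> 'a) \<Rightarrow> 'a::euclidean_space set \<Rightarrow> ('a \<Rightarrow> real^'d) \<Rightarrow> ('a \<Rightarrow> real^'d^'d)" where
  "sym_grad e G u = (SOME E. is_sym_grad e G u E)"

definition space_dir :: "'d::finite \<Rightarrow> real^'d" where
  "space_dir i = axis i 1"

definition cyl_dir :: "'d::finite \<Rightarrow> real \<times> (real^'d)" where
  "cyl_dir i = (0, axis i 1)"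

section \<open>The energy spaces\<close>

definition sym_energy ::
  "('d::finite \<Rightarrow> 'a) \<Rightarrow> 'a::euclidean_space set \<Rightarrow> ('a \<Rightarrow> real) \<Rightarrow> ('a \<Rightarrow> real^'d) set" where
  "sym_energy e G p = {u \<in> L2 G. \<exists>E \<in> Lp_var_sym G p. is_sym_grad e G u E}"

definition sym_energy_norm ::
  "('d::finite \<Rightarrow> 'a) \<Rightarrow> 'a::euclidean_space set \<Rightarrow> ('a \<Rightarrow> real) \<Rightarrow> ('a \<Rightarrow> real^'d) \<Rightarrow> real" where
  "sym_energy_norm e G p u = L2_norm G u + Lp_var_norm G p (sym_grad e G u)"

text \<open>\<open>X_space \<Omega> (\<lambda>x. p (t, x))\<close> is the space written $X^{2,p}_\varepsilon(t)$.\<close>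

definition X_space ::
  "(real^'d::finite) set \<Rightarrow> (real^'d \<Rightarrow> real) \<Rightarrow> (real^'d \<Rightarrow> real^'d) set" where
  "X_space \<Omega> q = {f \<in> sym_energy space_dir \<Omega> q.
     \<forall>\<delta>>0. \<exists>\<phi>\<in>C0inf \<Omega>. sym_energy_norm space_dir \<Omega> q (\<lambda>x. f x - \<phi> x) < \<delta>}"

definition cylinder :: "real \<Rightarrow> (real^'d::finite) set \<Rightarrow> (real \<times> (real^'d)) set" where
  "cylinder T \<Omega> = {0<..<T} \<times> \<Omega>"

definition X_cyl ::
  "real \<Rightarrow> (real^'d::finite) set \<Rightarrow> (real \<times> (real^'d) \<Rightarrow> real) \<Rightarrow> (real \<times> (real^'d) \<Rightarrow> real^'d) set" where
  "X_cyl T \<Omega> p = {u \<in> sym_energy cyl_dir (cylinder T \<Omega>) p.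
     AE t in lebesgue_on {0<..<T}. (\<lambda>x. u (t, x)) \<in> X_space \<Omega> (\<lambda>x. p (t, x))}"

definition X_cyl_norm ::
  "real \<Rightarrow> (real^'d::finite) set \<Rightarrow> (real \<times> (real^'d) \<Rightarrow> real) \<Rightarrow> (real \<times> (real^'d) \<Rightarrow> real^'d) \<Rightarrow> real" where
  "X_cyl_norm T \<Omega> p u = sym_energy_norm cyl_dir (cylinder T \<Omega>) p u"

section \<open>The Bochner space \<open>L\<^sup>\<infinity>(0,T; L\<^sup>2(\<Omega>))\<close>\<close>

text \<open>Bochner measurability with values in \<open>L2 \<Omega>\<close>: almost everywhere limit, in the \<open>L2\<close> norm, of
  simple functions.\<close>

definition bochner_measurable_L2 ::
  "real \<Rightarrow> (real^'d::finite) set \<Rightarrow> (real \<Rightarrow> real^'d \<Rightarrow> real^'d) \<Rightarrow> bool" where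
  "bochner_measurable_L2 T \<Omega> v \<longleftrightarrow>
     (AE t in lebesgue_on {0<..<T}. v t \<in> L2 \<Omega>) \<and>
     (\<exists>s. (\<forall>n. simple_function (lebesgue_on {0<..<T}) (s n) \<and> s n ` {0<..<T} \<subseteq> L2 \<Omega>) \<and>
          (AE t in lebesgue_on {0<..<T}. (\<lambda>n. L2_norm \<Omega> (\<lambda>x. s n t x - v t x)) \<longlonglongrightarrow> 0))"

definition Y_inf_ess_norm ::
  "real \<Rightarrow> (real^'d::finite) set \<Rightarrow> (real \<times> (real^'d) \<Rightarrow> real^'d) \<Rightarrow> ereal" where
  "Y_inf_ess_norm T \<Omega> u =
     esssup (lebesgue_on {0<..<T}) (\<lambda>t. ereal (L2_norm \<Omega> (\<lambda>x. u (t, x))))"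

definition Y_inf ::
  "real \<Rightarrow> (real^'d::finite) set \<Rightarrow> (real \<times> (real^'d) \<Rightarrow> real^'d) set" where
  "Y_inf T \<Omega> = {u. bochner_measurable_L2 T \<Omega> (\<lambda>t x. u (t, x)) \<and> Y_inf_ess_norm T \<Omega> u < \<infinity>}"

definition Y_inf_norm ::
  "real \<Rightarrow> (real^'d::finite) set \<Rightarrow> (real \<times> (real^'d) \<Rightarrow> real^'d) \<Rightarrow> real" where
  "Y_inf_norm T \<Omega> u = real_of_ereal (Y_inf_ess_norm T \<Omega> u)"

definition continuously_embedded ::
  "'f set \<Rightarrow> ('f \<Rightarrow> real) \<Rightarrow> 'f set \<Rightarrow> ('f \<Rightarrow> real) \<Rightarrow> bool" where
  "continuously_embedded V nV W nW \<longleftrightarrow> V \<subseteq> W \<and> (\<exists>C. \<forall>v\<in>V. nW v \<le> C * nV v)"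

end

theory Submission
  imports Defs
begin

text \<open>The loss of \<open>\<epsilon>\<close> in the exponent leaves enough room to work with a pointwise bound of \<open>u\<close> by a potential
of its symmetric gradient.  Along the ray from \<open>x\<close> to \<open>x + w\<close> the function
\<open>s \<mapsto> w \<bullet> \<phi> (x + s w)\<close> has the derivative \<open>w \<bullet> \<epsilon>(\<phi>)(x + s w) w\<close>, which sees only the symmetric
gradient of the vector field \<open>\<phi>\<close>.  Integrating over all \<open>w\<close> in a ball of radius \<open>\<delta>\<close> gives
(\<open>pointwise_bound_sym_deriv\<close>)

  \<open>|\<phi>(x)| \<le> C (\<integral>_{|x-y|<\<delta>} |\<epsilon>(\<phi>)(y)| |x-y|^(1-d) dy + \<integral>_{|x-y|<\<delta>} |\<phi>(y)| dy)\<close>.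

This bound survives the closure that defines the energy space of a time slice
(\<open>slice_pointwise_bound\<close>), with functions extended by zero, which is where the boundary condition
enters.  It is local: near \<open>(t, x)\<close> the continuous exponent \<open>p\<close> is almost constant, so that a
constant exponent \<open>s\<close> slightly below \<open>p\<close> can be used there, while the second integral is controlled
by the norm of \<open>u(t)\<close> in \<open>L\<^sup>2\<close>, uniformly in time.

The interpolation between this bound and \<open>L\<^sup>\<infinity>(L\<^sup>2)\<close> is done in one step on each time slice
(\<open>slice_integral_bound\<close>).  The parabolic exponent is \<open>s\<^sub>* = s + min (2 s / d) 2\<close>, so it suffices to
integrate \<open>|u|^(s+r) = |u|^r |u|^s\<close> for every positive \<open>r < min (2 s / d) 2\<close>.  Insert the pointwise
bound into the factor \<open>|u|^s\<close>, apply Hoelder's inequality to \<open>\<integral> |\<epsilon>(u)| |x-y|^(1-d) dy\<close> with the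
kernel \<open>|x-y|^(-\<beta>)\<close> on the side of \<open>|\<epsilon>(u)|^s\<close>, exchange the integrals, and use Young's
inequality \<open>|u|^r |z|^(-\<beta>) \<le> |u|\<^sup>2 + |z|^(-2\<beta>/(2-r))\<close>.  The two kernels that occur are integrable near
the origin if and only if \<open>d - s < \<beta> < d (1 - r/2)\<close>, and such a \<open>\<beta>\<close> exists exactly because
\<open>r < 2 s / d\<close>.  The cases \<open>s < d\<close> and \<open>s \<ge> d\<close> are covered at once.

Cutting the cylinder into finitely many level sets of \<open>p\<close> and integrating in time bounds the modular
of \<open>u / N\<close> whenever \<open>N\<close> exceeds the norms of \<open>\<epsilon>(u)\<close> and \<open>u\<close> (\<open>cylinder_modular_bound\<close>), and the
estimate of the Luxemburg norm follows by scaling.  Two facts about weak symmetric gradients support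
the argument: they are unique (\<open>sym_grad_unique\<close>), and almost every time slice of the
gradient on the cylinder is the gradient of the slice (\<open>sym_grad_slices\<close>).  Both come from a
fundamental lemma of the calculus of variations that tests only with a countable family of bump
functions (\<open>AE_zero_of_box_bumps\<close>).\<close>

section \<open>Smooth functions and bump functions on boxes\<close>

lemma Ck_continuous:
  assumes "Ck k f"
  shows "continuous_on UNIV f"
proof (cases k)
  case (Suc m)
  then have "f differentiable (at x)" for x using assms by auto
  then show ?thesis
    using differentiable_imp_continuous_within continuous_at_imp_continuous_on by blast
qed (use assms in auto)

lemma Ck_SucD: "Ck (Suc k) f \<Longrightarrow> Ck k f"
proof (induction k arbitrary: f)
  case 0
  from Ck_continuous[OF 0] show ?case by simp
next
  case (Suc k)
  from Suc.prems show ?case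
    unfolding Ck.simps(2)[of "Suc k" f] Ck.simps(2)[of k f] using Suc.IH by blast
qed

lemma Ck_const: "Ck k (\<lambda>x. c)"
  by (induction k arbitrary: c) (auto simp: frechet_derivative_const)

lemma Ck_add:
  "Ck k f \<Longrightarrow> Ck k g \<Longrightarrow> Ck k (\<lambda>x. f x + g x)"
proof (induction k arbitrary: f g)
  case 0
  then show ?case by (auto intro: continuous_on_add)
next
  case (Suc k)
  then have d: "f differentiable (at x)" "g differentiable (at x)" for x by auto
  have "frechet_derivative (\<lambda>x. f x + g x) (at x) v
      = frechet_derivative f (at x) v + frechet_derivative g (at x) v" for x v
    using frechet_derivative_at[OF has_derivative_add[OF d[unfolded frechet_derivative_works]]]
    by metis
  then show ?case using Suc d by auto
qed

lemma frechet_derivative_mult_real: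
  fixes f g :: "'a::euclidean_space \<Rightarrow> real"
  assumes "f differentiable (at x)" "g differentiable (at x)"
  shows "frechet_derivative (\<lambda>x. f x * g x) (at x) v =
    f x * frechet_derivative g (at x) v + frechet_derivative f (at x) v * g x"
proof -
  have "((\<lambda>x. f x * g x) has_derivative
     (\<lambda>h. f x * frechet_derivative g (at x) h + frechet_derivative f (at x) h * g x)) (at x)"
    using assms[unfolded frechet_derivative_works] by (rule has_derivative_mult)
  from frechet_derivative_at[OF this] show ?thesis by metis
qed

lemma Ck_mult:
  fixes f g :: "'a::euclidean_space \<Rightarrow> real"
  shows "Ck k f \<Longrightarrow> Ck k g \<Longrightarrow> Ck k (\<lambda>x. f x * g x)"
proof (induction k arbitrary: f g)
  case 0
  then show ?case by (auto intro: continuous_on_mult)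
next
  case (Suc k)
  then have d: "f differentiable (at x)" "g differentiable (at x)" for x by auto
  have "Ck k (\<lambda>x. frechet_derivative (\<lambda>x. f x * g x) (at x) v)" if "v \<in> Basis" for v
    unfolding frechet_derivative_mult_real[OF d]
    using Suc that Ck_SucD by (intro Ck_add Suc.IH) auto
  then show ?case using d by auto
qed

lemma Ck_prod:
  fixes f :: "'i \<Rightarrow> 'a::euclidean_space \<Rightarrow> real"
  assumes "finite A" "\<And>i. i \<in> A \<Longrightarrow> Ck k (f i)"
  shows "Ck k (\<lambda>x. \<Prod>i\<in>A. f i x)"
  using assms by (induction A rule: finite_induct) (auto intro: Ck_const Ck_mult)

lemma Ck_inner_affine: "Ck k (\<lambda>x::'a::euclidean_space. c * (x \<bullet> i - d))"
proof -
  have D: "((\<lambda>x::'a. c * (x \<bullet> i - d)) has_derivative (\<lambda>h. c * (h \<bullet> i))) (at x)" for x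
    by (auto intro!: derivative_eq_intros)
  then have "frechet_derivative (\<lambda>x::'a. c * (x \<bullet> i - d)) (at x) v = c * (v \<bullet> i)" for x v
    using frechet_derivative_at by metis
  then show ?thesis using D
    by (cases k) (auto intro!: continuous_intros Ck_const differentiableI)
qed

text \<open>For \<open>Q = 1\<close> this is the standard smooth function that vanishes on the negative half-line.  The
polynomial parameter makes the family closed under differentiation (\<open>flat_fun_deriv\<close>), so that all
derivatives are handled by one induction.\<close>

definition flat_fun :: "real poly \<Rightarrow> real \<Rightarrow> real" where
  "flat_fun Q x = (if x > 0 then poly Q (1 / x) * exp (- (1 / x)) else 0)"

text \<open>The exponential beats every polynomial; this gives the derivative at the
origin, where the two branches of \<open>flat_fun\<close> meet.\<close>

lemma flat_fun_tendsto_0: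
  fixes Q :: "real poly"
  shows "((\<lambda>x. poly Q (1 / x) * exp (- (1 / x))) \<longlongrightarrow> 0) (at_right 0)"
proof -
  have *: "((\<lambda>y. poly Q y * exp (- y)) \<longlongrightarrow> 0) at_top" for Q :: "real poly"
  proof (induction Q)
    case 0
    then show ?case by simp
  next
    case (pCons a Q)
    have "((\<lambda>y. y ^ n * exp (- y)) \<longlongrightarrow> (0::real)) at_top" for n
      using tendsto_power_div_exp_0[of n] by (simp add: exp_minus field_simps)
    then have "((\<lambda>y. \<Sum>i\<le>degree (pCons a Q). coeff (pCons a Q) i * (y ^ i * exp (- y))) \<longlongrightarrow>
       (\<Sum>i\<le>degree (pCons a Q). coeff (pCons a Q) i * 0)) at_top"
      by (intro tendsto_sum tendsto_mult tendsto_const)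
    then show ?case by (simp add: poly_altdef sum_distrib_right mult.assoc)
  qed
  have "filterlim (\<lambda>x::real. 1 / x) at_top (at_right 0)"
    using filterlim_inverse_at_top_right by (simp add: divide_inverse)
  from filterlim_compose[OF *[of Q] this] show ?thesis .
qed

lemma flat_fun_deriv:
  "(flat_fun Q has_real_derivative flat_fun ([:0, 0, 1:] * (Q - pderiv Q)) x) (at x)"
proof -
  consider "x > 0" | "x < 0" | "x = 0" by linarith
  then show ?thesis
  proof cases
    case 1
    have "((\<lambda>x. poly Q (1 / x) * exp (- (1 / x))) has_real_derivative
        flat_fun ([:0, 0, 1:] * (Q - pderiv Q)) x) (at x)"
      using 1 by (auto intro!: derivative_eq_intros DERIV_chain'[where g="poly Q"]
          simp: flat_fun_def field_simps power2_eq_square)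
    moreover have "\<forall>\<^sub>F y in nhds x. (0::real) < y"
      using 1 by (metis eventually_nhds greaterThan_iff open_greaterThan)
    ultimately show ?thesis
      by (subst DERIV_cong_ev[OF refl _ refl, of _ "\<lambda>x. poly Q (1 / x) * exp (- (1 / x))"])
         (auto elim!: eventually_mono simp: flat_fun_def)
  next
    case 2
    moreover have "\<forall>\<^sub>F y in nhds x. y < (0::real)"
      using 2 by (metis eventually_nhds lessThan_iff open_lessThan)
    ultimately show ?thesis
      by (subst DERIV_cong_ev[OF refl _ refl, of _ "\<lambda>x. 0"])
         (auto elim!: eventually_mono simp: flat_fun_def)
  next
    case 3
    have "((\<lambda>h. flat_fun Q h / h) \<longlongrightarrow> 0) (at_left 0)"
      by (rule Lim_transform_eventually[OF tendsto_const])
         (auto simp: flat_fun_def eventually_at_filter)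
    moreover have "((\<lambda>h. flat_fun Q h / h) \<longlongrightarrow> 0) (at_right 0)"
      by (rule Lim_transform_eventually[OF flat_fun_tendsto_0[of "[:0,1:] * Q"]])
         (auto simp: flat_fun_def eventually_at_filter)
    ultimately have "((\<lambda>h. flat_fun Q h / h) \<longlongrightarrow> 0) (at 0)"
      using filterlim_split_at by blast
    then show ?thesis
      using 3 by (simp add: DERIV_def flat_fun_def)
  qed
qed

lemma Ck_flat_fun:
  fixes f :: "'a::euclidean_space \<Rightarrow> real"
  shows "Ck k f \<Longrightarrow> Ck k (\<lambda>x. flat_fun Q (f x))"
proof (induction k arbitrary: Q)
  case 0
  have "continuous_on UNIV (flat_fun Q)"
    using flat_fun_deriv DERIV_isCont continuous_at_imp_continuous_on by blast
  then show ?case using 0 by (auto intro: continuous_on_compose2)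
next
  case (Suc k)
  then have d: "f differentiable (at x)" for x by auto
  have D: "((\<lambda>x. flat_fun Q (f x)) has_derivative
     (\<lambda>h. frechet_derivative f (at x) h * flat_fun ([:0, 0, 1:] * (Q - pderiv Q)) (f x))) (at x)" for x
    by (rule has_derivative_compose[OF d[of x, unfolded frechet_derivative_works]
          flat_fun_deriv[unfolded has_field_derivative_def], THEN has_derivative_eq_rhs])
       (simp add: mult.commute)
  have eq: "frechet_derivative (\<lambda>x. flat_fun Q (f x)) (at x) v =
      frechet_derivative f (at x) v * flat_fun ([:0, 0, 1:] * (Q - pderiv Q)) (f x)" for x v
    using frechet_derivative_at[OF D] by metis
  have "Ck k (\<lambda>x. frechet_derivative (\<lambda>x. flat_fun Q (f x)) (at x) v)" if "v \<in> Basis" for v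
    unfolding eq using Suc that Ck_SucD by (intro Ck_mult Suc.IH) auto
  then show ?case using D by (auto simp: differentiable_def)
qed

text \<open>The bump functions are products over the coordinates, so their limit as \<open>n\<close> grows is the indicator
function of the box, and the family is countable once the corners are rational.\<close>

definition box_bump :: "nat \<Rightarrow> 'a::euclidean_space \<Rightarrow> 'a \<Rightarrow> 'a \<Rightarrow> real" where
  "box_bump n a b x =
     (\<Prod>i\<in>Basis. flat_fun 1 (real (Suc n) * (x \<bullet> i - a \<bullet> i)) * flat_fun 1 (real (Suc n) * (b \<bullet> i - x \<bullet> i)))"

lemma Ck_box_bump: "Ck k (box_bump n a b)"
proof -
  have "Ck k (\<lambda>x::'a. real (Suc n) * (b \<bullet> i - x \<bullet> i))" for i
    using Ck_inner_affine[of k "- real (Suc n)" i "b \<bullet> i"] by (simp add: algebra_simps)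
  then show ?thesis
    unfolding box_bump_def[abs_def]
    by (intro Ck_prod finite_Basis Ck_mult[where f = "\<lambda>x. flat_fun 1 (_ x)"] Ck_flat_fun
        Ck_inner_affine)
qed

lemma box_bump_measurable [measurable]: "box_bump n a b \<in> borel_measurable borel"
  by (intro borel_measurable_continuous_onI Ck_continuous[OF Ck_box_bump[of 0]])

lemma flat_fun_1: "flat_fun 1 x = (if x > 0 then exp (- (1 / x)) else 0)"
  by (simp add: flat_fun_def)

lemma box_bump_outside: "x \<notin> box a b \<Longrightarrow> box_bump n a b x = 0"
  by (force simp: box_bump_def box_def flat_fun_1 not_less zero_less_mult_iff)

lemma box_bump_bounds: "0 \<le> box_bump n a b x" "box_bump n a b x \<le> 1"
  unfolding box_bump_def flat_fun_1
  by (auto intro!: prod_nonneg prod_le_1 mult_nonneg_nonneg mult_le_one)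

lemma box_bump_tendsto: "(\<lambda>n. box_bump n a b x) \<longlonglongrightarrow> indicator (box a b) x"
proof (cases "x \<in> box a b")
  case True
  have *: "(\<lambda>n. flat_fun 1 (real (Suc n) * c)) \<longlonglongrightarrow> 1" if "c > 0" for c
  proof -
    have "(\<lambda>n. exp (- (1 / (real (Suc n) * c)))) \<longlonglongrightarrow> exp (- 0)"
    proof (intro tendsto_intros)
      have "(\<lambda>n. (1 / c) * (1 / real (Suc n))) \<longlonglongrightarrow> (1 / c) * 0"
        by (intro tendsto_mult tendsto_const LIMSEQ_Suc lim_1_over_n)
      then show "(\<lambda>n. 1 / (real (Suc n) * c)) \<longlonglongrightarrow> 0" by (simp add: field_simps)
    qed
    then show ?thesis using that by (simp add: flat_fun_1 zero_less_mult_iff)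
  qed
  have "(\<lambda>n. box_bump n a b x) \<longlonglongrightarrow> (\<Prod>i\<in>(Basis::'a set). 1 * 1)"
    unfolding box_bump_def using True by (intro tendsto_prod tendsto_mult *) (auto simp: box_def)
  then show ?thesis using True by simp
qed (simp add: box_bump_outside)

lemma box_bump_support: "closure {x. box_bump n a b x \<noteq> 0} \<subseteq> cbox a b"
proof -
  have "{x. box_bump n a b x \<noteq> 0} \<subseteq> cbox a b"
    using box_bump_outside box_subset_cbox by (metis (mono_tags, lifting) mem_Collect_eq subset_iff)
  then show ?thesis by (rule closure_minimal) (rule closed_cbox)
qed

lemma box_bump_C0inf: "cbox a b \<subseteq> G \<Longrightarrow> box_bump n a b \<in> C0inf G"
  using box_bump_support[of n a b] Ck_box_bump[of _ n a b]
  by (auto simp: C0inf_def compact_eq_bounded_closed intro: bounded_subset[OF bounded_cbox])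

section \<open>The fundamental lemma of the calculus of variations\<close>

definition rational_vectors :: "'a::euclidean_space set" where
  "rational_vectors = {a. \<forall>i\<in>Basis. a \<bullet> i \<in> \<rat>}"

lemma countable_rational_vectors: "countable (rational_vectors :: 'a::euclidean_space set)"
proof -
  have "(rational_vectors :: 'a set) \<subseteq> (\<lambda>f. \<Sum>i\<in>Basis. f i *\<^sub>R i) ` (Basis \<rightarrow>\<^sub>E \<rat>)"
  proof
    fix a :: 'a assume "a \<in> rational_vectors"
    then have "(\<lambda>i\<in>Basis. a \<bullet> i) \<in> Basis \<rightarrow>\<^sub>E \<rat>" by (auto simp: rational_vectors_def)
    moreover have "a = (\<Sum>i\<in>Basis. (\<lambda>i\<in>Basis. a \<bullet> i) i *\<^sub>R i)"
      by (simp add: euclidean_representation)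
    ultimately show "a \<in> (\<lambda>f. \<Sum>i\<in>Basis. f i *\<^sub>R i) ` (Basis \<rightarrow>\<^sub>E \<rat>)" by blast
  qed
  moreover have "countable ((\<lambda>f. \<Sum>i\<in>Basis. f i *\<^sub>R i) ` ((Basis :: 'a set) \<rightarrow>\<^sub>E (\<rat>::real set)))"
    by (intro countable_image countable_PiE) (auto simp: countable_rat)
  ultimately show ?thesis by (rule countable_subset)
qed

lemma open_UNION_rational_box:
  fixes G :: "'a::euclidean_space set"
  assumes "open G" "x \<in> G"
  obtains a b where "a \<in> rational_vectors" "b \<in> rational_vectors" "x \<in> box a b" "cbox a b \<subseteq> G"
proof -
  obtain e where e: "e > 0" "cball x e \<subseteq> G"
    using assms open_contains_cball by blast
  obtain a b where ab: "x \<in> box a b" "\<forall>i\<in>Basis. a \<bullet> i \<in> \<rat>" "\<forall>i\<in>Basis. b \<bullet> i \<in> \<rat>" "box a b \<subseteq> ball x e"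
    using rational_boxes[OF e(1)] by metis
  have "cbox a b = closure (box a b)" using ab(1) closure_box by blast
  also have "\<dots> \<subseteq> cball x e"
    using ab(4) ball_subset_cball by (intro closure_minimal) auto
  finally show ?thesis using that ab e by (auto simp: rational_vectors_def)
qed

text \<open>The positive and the negative part of \<open>g\<close> define finite measures that agree on the boxes with
rational corners.  These boxes are stable under intersection and generate the Borel sets, so the
measures coincide.\<close>

lemma AE_zero_of_rational_box_integrals:
  fixes g :: "'a::euclidean_space \<Rightarrow> real"
  assumes g: "integrable lborel g"
    and zero: "\<And>a b. a \<in> rational_vectors \<Longrightarrow> b \<in> rational_vectors \<Longrightarrow>
       (LINT x|lborel. indicator (box a b) x * g x) = 0"
  shows "AE x in lborel. g x = 0"
proof -
  have [measurable]: "g \<in> borel_measurable lborel" using g by auto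
  define E where "E = (\<lambda>(a, b). box a b) ` (rational_vectors \<times> rational_vectors :: ('a \<times> 'a) set)"
  define M where "M = density lborel (\<lambda>x. ennreal (g x))"
  define N where "N = density lborel (\<lambda>x. ennreal (- g x))"
  have cE: "countable E" by (auto simp: E_def countable_rational_vectors)
  have basis: "topological_basis E"
  proof (rule topological_basisI)
    show "open X" if "X \<in> E" for X using that by (auto simp: E_def open_box)
    show "\<exists>B\<in>E. x \<in> B \<and> B \<subseteq> O'" if "open O'" "x \<in> O'" for O' :: "'a set" and x
      using open_UNION_rational_box[OF that] box_subset_cbox unfolding E_def
      by (metis (no_types, lifting) SigmaI case_prod_conv image_eqI subset_trans)
  qed
  have sigma: "sets borel = sigma_sets UNIV E"
    by (subst borel_eq_countable_basis[OF cE basis]) simp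
  have stable: "Int_stable E"
  proof (rule Int_stableI)
    fix X Y assume "X \<in> E" "Y \<in> E"
    then obtain a b c d where *: "X = box a b" "Y = box c d" "a \<in> rational_vectors" "b \<in> rational_vectors"
       "c \<in> rational_vectors" "d \<in> rational_vectors" by (auto simp: E_def)
    then show "X \<inter> Y \<in> E"
      unfolding E_def
      by (intro image_eqI[of _ _ "(\<Sum>i\<in>Basis. max (a \<bullet> i) (c \<bullet> i) *\<^sub>R i, \<Sum>i\<in>Basis. min (b \<bullet> i) (d \<bullet> i) *\<^sub>R i)"])
         (auto simp: box_Int_box rational_vectors_def max_def min_def)
  qed
  have fin: "(\<integral>\<^sup>+x. ennreal (h x) * indicator X x \<partial>lborel) \<noteq> \<infinity>"
     if "integrable lborel h" for X and h :: "'a \<Rightarrow> real"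
  proof -
    have "(\<integral>\<^sup>+x. ennreal (h x) * indicator X x \<partial>lborel) \<le> (\<integral>\<^sup>+x. ennreal (norm (h x)) \<partial>lborel)"
      by (intro nn_integral_mono) (auto simp: indicator_def intro: ennreal_leI)
    also have "\<dots> < \<infinity>" using that by (simp add: integrable_iff_bounded)
    finally show ?thesis by simp
  qed
  have "M = N"
  proof (rule measure_eqI_generator_eq_countable[OF stable, of UNIV _ _ E])
    show "emeasure M X = emeasure N X" if "X \<in> E" for X
    proof -
      obtain a b where X: "X = box a b" "a \<in> rational_vectors" "b \<in> rational_vectors"
        using \<open>X \<in> E\<close> by (auto simp: E_def)
      have i: "integrable lborel (\<lambda>x. indicator X x * g x)"
        using integrable_mult_indicator[OF _ g, of X] X by simp
      have "enn2real (\<integral>\<^sup>+x. ennreal (indicator X x * g x) \<partial>lborel) =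
            enn2real (\<integral>\<^sup>+x. ennreal (- (indicator X x * g x)) \<partial>lborel)"
        using zero[OF X(2,3)] real_lebesgue_integral_def[OF i] X by simp
      moreover have "(\<integral>\<^sup>+x. ennreal (indicator X x * g x) \<partial>lborel) < top"
         "(\<integral>\<^sup>+x. ennreal (- (indicator X x * g x)) \<partial>lborel) < top"
        using fin[OF i, of UNIV] fin[OF integrable_minus[OF i], of UNIV] by (auto simp: top.not_eq_extremum)
      ultimately have "(\<integral>\<^sup>+x. ennreal (indicator X x * g x) \<partial>lborel) =
            (\<integral>\<^sup>+x. ennreal (- (indicator X x * g x)) \<partial>lborel)"
        by (metis ennreal_enn2real)
      moreover have "ennreal (indicator X x * g x) = ennreal (g x) * indicator X x"
         "ennreal (- (indicator X x * g x)) = ennreal (- g x) * indicator X x" for x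
        by (auto simp: indicator_def)
      ultimately show ?thesis using X by (simp add: M_def N_def emeasure_density)
    qed
    show "\<Union> E = UNIV"
    proof -
      have "x \<in> \<Union> E" for x
      proof -
        obtain a b where "a \<in> rational_vectors" "b \<in> rational_vectors" "x \<in> box a b"
          using open_UNION_rational_box[OF open_UNIV UNIV_I] by metis
        then show ?thesis unfolding E_def by (intro UnionI[of "box a b"]) auto
      qed
      then show ?thesis by blast
    qed
    show "emeasure M a \<noteq> \<infinity>" if "a \<in> E" for a
    proof -
      have "a \<in> sets lborel" using that by (auto simp: E_def)
      then show ?thesis using fin[OF g, of a] by (simp add: M_def emeasure_density)
    qed
    show "sets M = sigma_sets UNIV E" "sets N = sigma_sets UNIV E"
      using sigma by (simp_all add: M_def N_def)
  qed (simp_all add: cE)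
  then have "AE x in lborel. ennreal (g x) = ennreal (- g x)"
    unfolding M_def N_def by (intro sigma_finite_measure.density_unique[OF sigma_finite_lborel]) auto
  then show ?thesis
  proof eventually_elim
    case (elim x)
    then show ?case by (cases "g x \<ge> 0") (auto simp: ennreal_neg ennreal_eq_0_iff not_le)
  qed
qed

lemma locally_integrable_times_test:
  fixes f :: "'a::euclidean_space \<Rightarrow> real"
  assumes f: "locally_integrable G f" and "continuous_on UNIV g"
    and K: "compact K" "K \<subseteq> G" and supp: "\<And>x. x \<notin> K \<Longrightarrow> g x = 0"
  shows "integrable lebesgue (\<lambda>x. f x * g x)"
proof -
  have int: "integrable lebesgue (\<lambda>x. indicator K x *\<^sub>R f x)"
    using f K by (auto simp: locally_integrable_def set_integrable_def)
  have "continuous_on K g" using assms continuous_on_subset by blast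
  then obtain B where B: "\<And>x. x \<in> K \<Longrightarrow> norm (g x) \<le> B"
    using compact_imp_bounded[OF compact_continuous_image[OF _ K(1), of g]] unfolding bounded_iff
    by auto
  have "integrable lebesgue (\<lambda>x. (indicator K x *\<^sub>R f x) * g x)"
  proof (rule Bochner_Integration.integrable_bound)
    show "integrable lebesgue (\<lambda>x. B * (indicator K x *\<^sub>R f x))" using int by simp
    have "g \<in> borel_measurable lebesgue"
      using assms(2) by (simp add: borel_measurable_continuous_onI measurable_completion)
    then show "(\<lambda>x. (indicator K x *\<^sub>R f x) * g x) \<in> borel_measurable lebesgue"
      using int by (intro borel_measurable_times) auto
    have "norm (indicator K x *\<^sub>R f x * g x) \<le> norm (B * (indicator K x *\<^sub>R f x))" for x
    proof (cases "x \<in> K")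
      case True
      then have "\<bar>g x\<bar> \<le> \<bar>B\<bar>" using B by fastforce
      then show ?thesis using True by (simp add: abs_mult mult.commute[of "\<bar>B\<bar>"] mult_left_mono)
    qed auto
    then show "AE x in lebesgue. norm (indicator K x *\<^sub>R f x * g x) \<le> norm (B * (indicator K x *\<^sub>R f x))"
      by simp
  qed
  moreover have "(\<lambda>x. (indicator K x *\<^sub>R f x) * g x) = (\<lambda>x. f x * g x)"
    using supp by (auto simp: indicator_def fun_eq_iff)
  ultimately show ?thesis by (simp only:)
qed

text \<open>Fundamental lemma of the calculus of variations.  Letting \<open>n\<close> tend to infinity turns the bumps into
indicators of boxes.  Only countably many test functions occur; this is what later allows the
exceptional null sets of times, one for each test function, to be united.\<close>

lemma AE_zero_of_box_bumps:
  fixes f :: "'a::euclidean_space \<Rightarrow> real"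
  assumes G: "open G" and f: "locally_integrable G f"
    and zero: "\<And>a b n. a \<in> rational_vectors \<Longrightarrow> b \<in> rational_vectors \<Longrightarrow> cbox a b \<subseteq> G \<Longrightarrow>
      (LINT x|lebesgue_on G. f x * box_bump n a b x) = 0"
  shows "AE x in lebesgue_on G. f x = 0"
proof -
  have Gs: "G \<in> sets lebesgue" using G by auto
  have box0: "(LINT x|lebesgue. indicator (box a b) x * f x) = 0"
    if ab: "a \<in> rational_vectors" "b \<in> rational_vectors" "cbox a b \<subseteq> G" for a b
  proof -
    have int: "integrable lebesgue (\<lambda>x. indicator (cbox a b) x *\<^sub>R f x)"
      using f ab by (auto simp: locally_integrable_def set_integrable_def)
    have "(\<lambda>n. LINT x|lebesgue. (indicator (cbox a b) x *\<^sub>R f x) * box_bump n a b x) \<longlonglongrightarrow>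
        (LINT x|lebesgue. (indicator (cbox a b) x *\<^sub>R f x) * indicator (box a b) x)"
    proof (rule integral_dominated_convergence[where w="\<lambda>x. norm (indicator (cbox a b) x *\<^sub>R f x)"])
      show "(\<lambda>x. indicator (cbox a b) x *\<^sub>R f x * indicator (box a b) x) \<in> borel_measurable lebesgue"
        using int by (intro borel_measurable_times borel_measurable_indicator) auto
      show "(\<lambda>x. indicator (cbox a b) x *\<^sub>R f x * box_bump n a b x) \<in> borel_measurable lebesgue" for n
        using int box_bump_measurable
        by (intro borel_measurable_times) (auto intro: measurable_completion)
      show "AE x in lebesgue. (\<lambda>n. indicator (cbox a b) x *\<^sub>R f x * box_bump n a b x) \<longlonglongrightarrow>
         indicator (cbox a b) x *\<^sub>R f x * indicator (box a b) x"
        by (intro AE_I2 tendsto_mult tendsto_const box_bump_tendsto)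
      show "AE x in lebesgue. norm (indicator (cbox a b) x *\<^sub>R f x * box_bump n a b x)
         \<le> norm (indicator (cbox a b) x *\<^sub>R f x)" for n
        using box_bump_bounds[of n a b] by (intro AE_I2) (simp add: abs_mult mult_left_le)
    qed (use int in auto)
    moreover have "(LINT x|lebesgue. (indicator (cbox a b) x *\<^sub>R f x) * box_bump n a b x) = 0" for n
    proof -
      have "(LINT x|lebesgue. (indicator (cbox a b) x *\<^sub>R f x) * box_bump n a b x) =
         (LINT x|lebesgue. indicator G x *\<^sub>R (f x * box_bump n a b x))"
        using box_bump_outside[of _ a b n] box_subset_cbox[of a b] ab(3)
        by (intro Bochner_Integration.integral_cong) (auto simp: indicator_def)
      also have "\<dots> = (LINT x|lebesgue_on G. f x * box_bump n a b x)"
        using Gs by (simp add: integral_restrict_space)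
      finally show ?thesis using zero ab by simp
    qed
    moreover have "(\<lambda>x. (indicator (cbox a b) x *\<^sub>R f x) * indicator (box a b) x) =
        (\<lambda>x. indicator (box a b) x * f x)"
      using box_subset_cbox[of a b] by (auto simp: indicator_def fun_eq_iff)
    ultimately show ?thesis by (simp only: LIMSEQ_const_iff)
  qed
  have loc: "AE x in lebesgue. x \<in> box A B \<longrightarrow> f x = 0"
    if AB: "A \<in> rational_vectors" "B \<in> rational_vectors" "cbox A B \<subseteq> G" for A B
  proof -
    have "integrable lebesgue (\<lambda>x. indicator (cbox A B) x *\<^sub>R f x)"
      using f AB by (auto simp: locally_integrable_def set_integrable_def)
    then have "integrable lebesgue (\<lambda>x. indicator (box A B) x * (indicator (cbox A B) x *\<^sub>R f x))"
      by (subst mult.commute) (rule integrable_real_mult_indicator, auto)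
    moreover have "(\<lambda>x. indicator (box A B) x * (indicator (cbox A B) x *\<^sub>R f x)) =
        (\<lambda>x. indicator (box A B) x * f x)"
      using box_subset_cbox[of A B] by (auto simp: indicator_def fun_eq_iff)
    ultimately have int: "integrable lebesgue (\<lambda>x. indicator (box A B) x * f x)" by (simp only:)
    obtain g where g[measurable]: "g \<in> borel_measurable lborel"
      and gae: "AE x in lborel. indicator (box A B) x * f x = g x"
      using completion_ex_borel_measurable_real[of "\<lambda>x. indicator (box A B) x * f x" lborel] int by auto
    have gl: "AE x in lebesgue. indicator (box A B) x * f x = g x"
      using gae by (simp add: AE_completion_iff)
    have "integrable lebesgue g"
      using int measurable_completion[OF g] gl by (rule Bochner_Integration.integrable_cong_AE_imp)
    then have ig: "integrable lborel g" by (simp add: integrable_completion)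
    have "AE x in lborel. g x = 0"
    proof (rule AE_zero_of_rational_box_integrals[OF ig])
      fix a b :: 'a assume ab: "a \<in> rational_vectors" "b \<in> rational_vectors"
      define a' where "a' = (\<Sum>i\<in>Basis. max (a \<bullet> i) (A \<bullet> i) *\<^sub>R i)"
      define b' where "b' = (\<Sum>i\<in>Basis. min (b \<bullet> i) (B \<bullet> i) *\<^sub>R i)"
      have eq: "box a b \<inter> box A B = box a' b'" "cbox a b \<inter> cbox A B = cbox a' b'"
        by (auto simp: a'_def b'_def box_Int_box Int_interval)
      have "a' \<in> rational_vectors" "b' \<in> rational_vectors"
        using ab AB by (auto simp: rational_vectors_def a'_def b'_def max_def min_def)
      moreover have "cbox a' b' \<subseteq> G" using eq AB by auto
      ultimately have "(LINT x|lebesgue. indicator (box a' b') x * f x) = 0" using box0 by blast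
      moreover have "(LINT x|lborel. indicator (box a b) x * g x) = (LINT x|lebesgue. indicator (box a b) x * g x)"
        by (simp add: integral_completion)
      moreover have "\<dots> = (LINT x|lebesgue. indicator (box a' b') x * f x)"
      proof (rule integral_cong_AE)
        show "AE x in lebesgue. indicator (box a b) x * g x = indicator (box a' b') x * f x"
          using gl
        proof eventually_elim
          case (elim x)
          then show ?case by (auto simp: indicator_def simp flip: eq(1))
        qed
        have "(\<lambda>x. indicator (box a' b') x * f x) = (\<lambda>x. indicator (box a b) x * (indicator (box A B) x * f x))"
          by (auto simp: indicator_def fun_eq_iff simp flip: eq(1))
        moreover have "\<dots> \<in> borel_measurable lebesgue"
          by (intro borel_measurable_times[OF borel_measurable_indicator borel_measurable_integrable[OF int]]) auto
        ultimately show "(\<lambda>x. indicator (box a' b') x * f x) \<in> borel_measurable lebesgue"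
          by (simp only:)
      qed (simp add: measurable_completion)
      ultimately show "(LINT x|lborel. indicator (box a b) x * g x) = 0" by simp
    qed
    then have "AE x in lebesgue. g x = 0" by (simp add: AE_completion_iff)
    with gl show ?thesis by eventually_elim (auto simp: indicator_def)
  qed
  define R where "R = {(A, B). A \<in> rational_vectors \<and> B \<in> rational_vectors \<and> cbox A B \<subseteq> G}"
  have "countable R"
    by (rule countable_subset[of _ "rational_vectors \<times> rational_vectors"])
       (auto simp: R_def countable_rational_vectors)
  then have "AE x in lebesgue. \<forall>(A, B)\<in>R. x \<in> box A B \<longrightarrow> f x = 0"
    by (subst AE_ball_countable) (use loc in \<open>auto simp: R_def\<close>)
  then have "AE x in lebesgue. x \<in> G \<longrightarrow> f x = 0"
  proof eventually_elim
    case (elim x)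
    show ?case
    proof
      assume "x \<in> G"
      then obtain a b where "a \<in> rational_vectors" "b \<in> rational_vectors" "x \<in> box a b" "cbox a b \<subseteq> G"
        using open_UNION_rational_box[OF G] by metis
      then show "f x = 0" using elim by (auto simp: R_def)
    qed
  qed
  then show ?thesis using Gs by (simp add: AE_restrict_space_iff)
qed

section \<open>Power kernels and the interpolation inequality on a time slice\<close>

lemma nn_integral_lborel_translate:
  fixes f :: "'a::euclidean_space \<Rightarrow> ennreal"
  assumes [measurable]: "f \<in> borel_measurable borel"
  shows "(\<integral>\<^sup>+x. f (c + x) \<partial>lborel) = (\<integral>\<^sup>+x. f x \<partial>lborel)"
proof -
  have "(\<integral>\<^sup>+x. f x \<partial>lborel) = (\<integral>\<^sup>+x. f x \<partial>distr lborel borel ((+) c))"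
    by (simp add: lborel_distr_plus)
  also have "\<dots> = (\<integral>\<^sup>+x. f (c + x) \<partial>lborel)"
    by (subst nn_integral_distr) auto
  finally show ?thesis by simp
qed

lemma pred_ball [measurable]: "Measurable.pred borel (\<lambda>y. y \<in> ball (x::'a::metric_space) r)"
  using borel_open[OF open_ball[of x r]] by (simp add: pred_def del: mem_ball)

text \<open>The ball is covered by dyadic shells; the shell of radius \<open>\<delta> / 2^k\<close> contributes a multiple of
\<open>2^(k (a - d))\<close>, a convergent geometric series for \<open>a < d\<close>.\<close>

lemma nn_integral_norm_powr_ball_finite:
  fixes a \<delta> :: real
  assumes a: "a < real DIM('a::euclidean_space)" and \<delta>: "\<delta> > 0"
  shows "(\<integral>\<^sup>+z. ennreal (norm z powr (- a)) * indicator (ball 0 \<delta>) (z::'a) \<partial>lborel) < \<infinity>"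
proof (cases "a \<le> 0")
  case True
  have "(\<integral>\<^sup>+z. ennreal (norm z powr (- a)) * indicator (ball 0 \<delta>) (z::'a) \<partial>lborel)
      \<le> (\<integral>\<^sup>+z. ennreal (\<delta> powr (- a)) * indicator (ball 0 \<delta>) (z::'a) \<partial>lborel)"
    using True by (intro nn_integral_mono) (auto simp: indicator_def intro!: ennreal_leI powr_mono2)
  also have "\<dots> = ennreal (\<delta> powr (- a)) * emeasure lborel (ball (0::'a) \<delta>)"
    by (simp add: nn_integral_cmult_indicator)
  also have "\<dots> < \<infinity>"
    using emeasure_lborel_ball_finite by (auto simp: ennreal_mult_less_top)
  finally show ?thesis .
next
  case False
  define d where "d = DIM('a)"
  define t where "t k = (\<delta> / 2 ^ Suc k) powr (- a)" for k
  have "ennreal (norm z powr (- a)) * indicator (ball 0 \<delta>) z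
      \<le> (\<Sum>k. ennreal (t k) * indicator (ball 0 (\<delta> / 2 ^ k)) z)" for z :: 'a
  proof (cases "z = 0 \<or> z \<notin> ball 0 \<delta>")
    case zd: False
    \<comment> \<open>the index of the dyadic shell that contains \<open>z\<close>\<close>
    define k where "k = (LEAST k. \<delta> / 2 ^ Suc k \<le> norm z)"
    have "\<exists>k. \<delta> / 2 ^ Suc k \<le> norm z"
    proof -
      obtain k where "(1/2) ^ k < norm z / \<delta>"
        using real_arch_pow_inv[of "norm z / \<delta>" "1/2"] zd \<delta> by auto
      then have "\<delta> / 2 ^ k \<le> norm z" using \<delta> by (simp add: field_simps power_one_over)
      moreover have "\<delta> / 2 ^ Suc k \<le> \<delta> / 2 ^ k" using \<delta> by (simp add: field_simps)
      ultimately show ?thesis by (intro exI[of _ k]) linarith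
    qed
    then have k: "\<delta> / 2 ^ Suc k \<le> norm z" unfolding k_def by (rule LeastI_ex)
    have "norm z < \<delta> / 2 ^ k"
    proof (cases k)
      case 0
      then show ?thesis using zd by simp
    next
      case (Suc j)
      then have "\<not> \<delta> / 2 ^ Suc j \<le> norm z" using not_less_Least[of j "\<lambda>k. \<delta> / 2 ^ Suc k \<le> norm z"] unfolding k_def by simp
      then show ?thesis using Suc by simp
    qed
    then have "ennreal (norm z powr (- a)) * indicator (ball 0 \<delta>) z
       \<le> ennreal (t k) * indicator (ball 0 (\<delta> / 2 ^ k)) z"
      using k \<delta> False by (auto simp: t_def indicator_def intro!: ennreal_leI powr_mono2')
    also have "\<dots> \<le> (\<Sum>k. ennreal (t k) * indicator (ball 0 (\<delta> / 2 ^ k)) z)"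
    proof -
      have "(\<Sum>i\<in>{k}. u i) \<le> suminf u" for u :: "nat \<Rightarrow> ennreal"
        by (rule sum_le_suminf) auto
      then show ?thesis by simp
    qed
    finally show ?thesis .
  qed auto
  then have "(\<integral>\<^sup>+z. ennreal (norm z powr (- a)) * indicator (ball 0 \<delta>) (z::'a) \<partial>lborel)
      \<le> (\<integral>\<^sup>+z. (\<Sum>k. ennreal (t k) * indicator (ball 0 (\<delta> / 2 ^ k)) (z::'a)) \<partial>lborel)"
    by (rule nn_integral_mono)
  also have "\<dots> = (\<Sum>k. ennreal (t k) * emeasure lborel (ball (0::'a) (\<delta> / 2 ^ k)))"
    by (subst nn_integral_suminf) (auto simp: nn_integral_cmult_indicator)
  also have "\<dots> = (\<Sum>k. ennreal (t k * (unit_ball_vol (real d) * (\<delta> / 2 ^ k) ^ d)))"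
    using \<delta> by (simp add: emeasure_ball d_def t_def ennreal_mult)
  also have "\<dots> = (\<Sum>k. ennreal ((\<delta> / 2) powr (- a) * unit_ball_vol (real d) * \<delta> ^ d * (2 powr (a - real d)) ^ k))"
  proof (intro suminf_cong arg_cong[where f=ennreal])
    fix k
    have "t k = (\<delta> / 2) powr (- a) * (2 powr a) ^ k"
      using \<delta> by (simp add: t_def powr_divide powr_mult powr_minus powr_realpow[symmetric] powr_powr field_simps)
    moreover have "(\<delta> / 2 ^ k) ^ d = \<delta> ^ d * (2 powr (- real d)) ^ k"
      by (simp add: power_divide powr_minus powr_realpow power_mult[symmetric] mult.commute field_simps)
    moreover have "(2 powr (a - real d)) ^ k = (2 powr a) ^ k * (2 powr (- real d)) ^ k"
      by (simp add: power_mult_distrib[symmetric] powr_add[symmetric])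
    ultimately show "t k * (unit_ball_vol (real d) * (\<delta> / 2 ^ k) ^ d) =
       (\<delta> / 2) powr (- a) * unit_ball_vol (real d) * \<delta> ^ d * (2 powr (a - real d)) ^ k"
      by simp
  qed
  also have "\<dots> < \<infinity>"
  proof -
    have "2 powr (a - real d) < 2 powr 0" using a by (intro powr_less_mono) (auto simp: d_def)
    then have "summable (\<lambda>k. (\<delta> / 2) powr (- a) * unit_ball_vol (real d) * \<delta> ^ d * (2 powr (a - real d)) ^ k)"
      by (intro summable_mult summable_geometric) auto
    then show ?thesis
      using \<delta> by (subst suminf_ennreal2) (auto simp: less_top[symmetric])
  qed
  finally show ?thesis .
qed

text \<open>The factor \<open>I\<close> balances the two terms: if \<open>x powr s\<close> integrates to at most \<open>I\<close>, then both terms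
integrate to a multiple of \<open>I powr (1 / s)\<close>.  Integrating this inequality is therefore a proof of
Hoelder's inequality.\<close>

lemma Young_scaled:
  fixes x y I s :: real
  assumes "x \<ge> 0" "y \<ge> 0" "I > 0" "s > 1"
  shows "x * y \<le> I powr (1 / s - 1) * x powr s + I powr (1 / s) * y powr (s / (s - 1))"
proof -
  define m where "m = (1 / s) * (1 - 1 / s)"
  define s' where "s' = s / (s - 1)"
  have s': "s' > 1" "1 / s + 1 / s' = 1" using assms by (auto simp: s'_def field_simps)
  have "x * y = (x * I powr (- m)) * (y * I powr m)"
    using assms by (simp add: powr_minus field_simps)
  also have "\<dots> \<le> (x * I powr (- m)) powr s / s + (y * I powr m) powr s' / s'"
    using assms s' by (intro Youngs_inequality) auto
  also have "\<dots> \<le> (x * I powr (- m)) powr s + (y * I powr m) powr s'"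
    using assms s' by (intro add_mono) (auto simp: divide_le_eq mult_le_cancel_left1)
  also have "(x * I powr (- m)) powr s = I powr (1 / s - 1) * x powr s"
  proof -
    have "- m * s = 1 / s - 1" using assms by (simp add: m_def field_simps)
    then show ?thesis using assms by (simp add: powr_mult powr_powr)
  qed
  also have "(y * I powr m) powr s' = I powr (1 / s) * y powr s'"
  proof -
    have "m * s' = 1 / s" using assms by (simp add: m_def s'_def field_simps)
    then show ?thesis using assms by (simp add: powr_mult powr_powr)
  qed
  finally show ?thesis by (simp add: s'_def)
qed

text \<open>Hoelder's inequality with the sharp factor \<open>N powr (1 - 1 / s)\<close> replaced by \<open>1 + N\<close>.  Real bounds \<open>I\<close>
and \<open>N\<close> take the place of the integrals since the exponentiation \<open>powr\<close> is one of real numbers.\<close>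

lemma Holder_nn_integral:
  fixes F K :: "'a \<Rightarrow> real"
  assumes [measurable]: "F \<in> borel_measurable M" "K \<in> borel_measurable M"
    and pos: "\<And>x. F x \<ge> 0" "\<And>x. K x \<ge> 0" and s: "s > 1" and I: "I > 0" and N: "N \<ge> 0"
    and FI: "(\<integral>\<^sup>+x. ennreal (F x powr s) \<partial>M) \<le> ennreal I"
    and KN: "(\<integral>\<^sup>+x. ennreal (K x powr (s / (s - 1))) \<partial>M) \<le> ennreal N"
  shows "(\<integral>\<^sup>+x. ennreal (F x * K x) \<partial>M) \<le> ennreal ((1 + N) * I powr (1 / s))"
proof -
  have "(\<integral>\<^sup>+x. ennreal (F x * K x) \<partial>M) \<le>
     (\<integral>\<^sup>+x. ennreal (I powr (1 / s - 1)) * ennreal (F x powr s) +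
        ennreal (I powr (1 / s)) * ennreal (K x powr (s / (s - 1))) \<partial>M)"
    using Young_scaled[OF pos I s]
    by (intro nn_integral_mono) (simp add: ennreal_leI flip: ennreal_mult ennreal_plus)
  also have "\<dots> = ennreal (I powr (1 / s - 1)) * (\<integral>\<^sup>+x. ennreal (F x powr s) \<partial>M) +
        ennreal (I powr (1 / s)) * (\<integral>\<^sup>+x. ennreal (K x powr (s / (s - 1))) \<partial>M)"
    by (simp add: nn_integral_add nn_integral_cmult)
  also have "\<dots> \<le> ennreal (I powr (1 / s - 1)) * ennreal I + ennreal (I powr (1 / s)) * ennreal N"
    using FI KN by (intro add_mono mult_left_mono) auto
  also have "\<dots> = ennreal (I powr (1 / s - 1) * I + I powr (1 / s) * N)"
    using I N by (simp add: ennreal_mult ennreal_plus)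
  also have "I powr (1 / s - 1) * I + I powr (1 / s) * N = (1 + N) * I powr (1 / s)"
    using I by (simp add: powr_diff field_simps)
  finally show ?thesis .
qed

text \<open>The interpolation step described at the beginning, for one time slice.  Here \<open>W\<close> stands for \<open>|u(t)|\<close>
and \<open>F\<close> for \<open>|\<epsilon>(u(t))|\<close>, both already divided by an upper bound for the norms, and \<open>A\<close> is
the part of the slice on which the constant exponent \<open>s\<close> may be used.  The constant depends on the
functions only through these normalisations.\<close>

lemma slice_integral_bound:
  fixes s r \<delta> C0 V :: real
  assumes s: "s > 1" and r: "0 < r" "r < 2" "r < 2 * s / DIM('a::euclidean_space)"
    and \<delta>: "\<delta> > 0" and C0: "C0 > 0" and V: "V \<ge> 0"
  shows "\<exists>C\<ge>0. \<forall>(W::'a \<Rightarrow> real) F A.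
       W \<in> borel_measurable borel \<longrightarrow> F \<in> borel_measurable borel \<longrightarrow> A \<in> sets borel \<longrightarrow>
       (\<forall>x. W x \<ge> 0) \<longrightarrow> (\<forall>x. F x \<ge> 0) \<longrightarrow> emeasure lborel A \<le> ennreal V \<longrightarrow>
       (\<integral>\<^sup>+x. ennreal ((W x)\<^sup>2) * indicator A x \<partial>lborel) \<le> 1 \<longrightarrow>
       (AE x in lborel. x \<in> A \<longrightarrow> ennreal (W x) \<le> ennreal C0 *
          ((\<integral>\<^sup>+y. ennreal (F y * norm (x - y) powr (1 - real DIM('a))) * indicator (ball x \<delta>) y \<partial>lborel) + 1)) \<longrightarrow>
       (\<integral>\<^sup>+x. ennreal (W x powr (s + r)) * indicator A x \<partial>lborel)
          \<le> ennreal C * (1 + (\<integral>\<^sup>+y. ennreal (F y powr s) \<partial>lborel))"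
proof -
  define d where "d = real DIM('a)"
  have d: "d > 0" by (simp add: d_def)
  \<comment> \<open>the midpoint of the interval of exponents for which both kernels below are integrable\<close>
  define \<beta> where "\<beta> = ((d - s) + d * (1 - r / 2)) / 2"
  have rs: "d * r < 2 * s" using r(3) d by (simp add: d_def field_simps)
  have \<beta>: "d - s < \<beta>" "\<beta> < d * (1 - r / 2)" unfolding \<beta>_def using rs by (simp_all add: field_simps)
  define \<alpha> where "\<alpha> = d - 1 - \<beta> / s"
  have a1: "\<alpha> * (s / (s - 1)) < d"
  proof -
    have "\<alpha> * s = (d - 1) * s - \<beta>" using s by (simp add: \<alpha>_def left_diff_distrib)
    then have "\<alpha> * s < d * (s - 1)" using \<beta> by (simp add: algebra_simps)
    then show ?thesis using s by (simp add: field_simps)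
  qed
  have a2: "\<beta> * (2 / (2 - r)) < d" using \<beta>(2) r by (simp add: field_simps)
  \<comment> \<open>the kernel of Hoelder's inequality: \<open>|z|^(1-d) = |z|^(-\<beta>/s) |z|^(-\<alpha>)\<close>, the second factor to the conjugate power\<close>
  obtain N1 where N1: "N1 \<ge> 0"
      "(\<integral>\<^sup>+z. ennreal (norm z powr (- (\<alpha> * (s / (s - 1))))) * indicator (ball 0 \<delta>) (z::'a) \<partial>lborel) = ennreal N1"
    using nn_integral_norm_powr_ball_finite[OF a1[unfolded d_def] \<delta>] by (cases rule: ennreal_cases) (auto simp: d_def)
  \<comment> \<open>the kernel that remains after Young's inequality\<close>
  obtain N2 where N2: "N2 \<ge> 0"
      "(\<integral>\<^sup>+z. ennreal (norm z powr (- (\<beta> * (2 / (2 - r))))) * indicator (ball 0 \<delta>) (z::'a) \<partial>lborel) = ennreal N2"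
    using nn_integral_norm_powr_ball_finite[OF a2[unfolded d_def] \<delta>] by (cases rule: ennreal_cases) (auto simp: d_def)
  define C1 where "C1 = (C0 * (2 + N1)) powr s"
  have C1: "C1 > 0" using C0 N1 by (simp add: C1_def)
  define C where "C = C1 * (V + 1) + C1 * (1 + N2)"
  show ?thesis
  proof (intro exI[of _ C] conjI allI impI)
    show "C \<ge> 0" using C1 V N2 by (simp add: C_def)
    fix W F :: "'a \<Rightarrow> real" and A :: "'a set"
    assume [measurable]: "W \<in> borel_measurable borel" "F \<in> borel_measurable borel" "A \<in> sets borel"
      and W': "\<forall>x. W x \<ge> 0" and F': "\<forall>x. F x \<ge> 0" and AV: "emeasure lborel A \<le> ennreal V"
      and W2: "(\<integral>\<^sup>+x. ennreal ((W x)\<^sup>2) * indicator A x \<partial>lborel) \<le> 1"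
      and bd: "AE x in lborel. x \<in> A \<longrightarrow> ennreal (W x) \<le> ennreal C0 *
          ((\<integral>\<^sup>+y. ennreal (F y * norm (x - y) powr (1 - real DIM('a))) * indicator (ball x \<delta>) y \<partial>lborel) + 1)"
    note W = W'[rule_format] and F = F'[rule_format]
    define k where "k z = norm z powr (- \<beta>) * indicator (ball 0 \<delta>) (z::'a)" for z
    have [measurable]: "k \<in> borel_measurable borel" unfolding k_def by measurable
    have k0: "k z \<ge> 0" for z by (simp add: k_def)
    define J where "J x = (\<integral>\<^sup>+y. ennreal (F y powr s * k (x - y)) \<partial>lborel)" for x
    have [measurable]: "J \<in> borel_measurable borel" unfolding J_def by measurable
    have pw: "ennreal (W x powr s) \<le> ennreal C1 * (1 + J x)"
      if x: "ennreal (W x) \<le> ennreal C0 *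
          ((\<integral>\<^sup>+y. ennreal (F y * norm (x - y) powr (1 - real DIM('a))) * indicator (ball x \<delta>) y \<partial>lborel) + 1)" for x
    proof (cases "J x")
      case (real i)
      let ?F = "\<lambda>y. F y * norm (x - y) powr (- \<beta> / s) * indicator (ball x \<delta>) y"
      let ?K = "\<lambda>y. norm (x - y) powr (- \<alpha>) * indicator (ball x \<delta>) y"
      \<comment> \<open>\<open>1 + i\<close> instead of \<open>i\<close>, since Hoelder's inequality is stated for a positive bound\<close>
      have "(\<integral>\<^sup>+y. ennreal (?F y * ?K y) \<partial>lborel) \<le> ennreal ((1 + N1) * (1 + i) powr (1 / s))"
      proof (rule Holder_nn_integral)
        have "?F y powr s = F y powr s * k (x - y)" for y
          using s F norm_minus_commute[of x y] by (auto simp: powr_mult powr_powr k_def indicator_def dist_norm)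
        then have "(\<integral>\<^sup>+y. ennreal (?F y powr s) \<partial>lborel) = ennreal i"
          using real by (simp add: J_def)
        also have "\<dots> \<le> ennreal (1 + i)" by (rule ennreal_leI) simp
        finally show "(\<integral>\<^sup>+y. ennreal (?F y powr s) \<partial>lborel) \<le> ennreal (1 + i)" .
        have "ennreal (?K y powr (s / (s - 1))) =
           ennreal (norm (- x + y) powr (- (\<alpha> * (s / (s - 1))))) * indicator (ball 0 \<delta>) (- x + y)" for y
          using norm_minus_commute[of x y] by (auto simp: powr_powr indicator_def dist_norm)
        then have "(\<integral>\<^sup>+y. ennreal (?K y powr (s / (s - 1))) \<partial>lborel) = ennreal N1"
          using nn_integral_lborel_translate[of "\<lambda>z. ennreal (norm z powr (- (\<alpha> * (s / (s - 1))))) * indicator (ball 0 \<delta>) z" "- x"]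
          by (simp only: N1) simp
        then show "(\<integral>\<^sup>+y. ennreal (?K y powr (s / (s - 1))) \<partial>lborel) \<le> ennreal N1" by simp
      qed (use F s N1 real in auto)
      moreover have "ennreal (?F y * ?K y) = ennreal (F y * norm (x - y) powr (1 - real DIM('a))) * indicator (ball x \<delta>) y" for y
      proof -
        have "- \<beta> / s + - \<alpha> = 1 - real DIM('a)" by (simp add: \<alpha>_def d_def)
        then have "norm (x - y) powr (1 - real DIM('a)) = norm (x - y) powr (- \<beta> / s) * norm (x - y) powr (- \<alpha>)"
          using powr_add by metis
        then show ?thesis by (simp add: indicator_def mult.assoc)
      qed
      ultimately have "ennreal (W x) \<le> ennreal C0 * (ennreal ((1 + N1) * (1 + i) powr (1 / s)) + 1)"
        using x by (auto elim!: order_trans intro!: mult_left_mono add_mono)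
      also have "\<dots> = ennreal (C0 * ((1 + N1) * (1 + i) powr (1 / s) + 1))"
        using C0 N1 real by (subst ennreal_mult) (auto simp: ennreal_plus[where b=1])
      finally have "W x \<le> C0 * ((1 + N1) * (1 + i) powr (1 / s) + 1)"
        using C0 N1 real by (subst (asm) ennreal_le_iff) auto
      also have "\<dots> \<le> C0 * (2 + N1) * (1 + i) powr (1 / s)"
        using C0 real s by (simp add: algebra_simps ge_one_powr_ge_zero)
      finally have "W x powr s \<le> (C0 * (2 + N1) * (1 + i) powr (1 / s)) powr s"
        using W s by (intro powr_mono2) auto
      also have "\<dots> = C1 * (1 + i)"
        using C0 N1 s real by (simp add: powr_mult powr_powr C1_def)
      finally show ?thesis
        using real C1 by (simp add: ennreal_leI flip: ennreal_mult ennreal_plus ennreal_1)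
    next
      case top
      then show ?thesis using C1 by (simp add: ennreal_mult_top)
    qed
    have "(\<integral>\<^sup>+x. ennreal (W x powr (s + r)) * indicator A x \<partial>lborel)
       \<le> (\<integral>\<^sup>+x. ennreal C1 * (ennreal (W x powr r) * indicator A x) +
             ennreal C1 * (ennreal (W x powr r) * indicator A x * J x) \<partial>lborel)"
    proof (rule nn_integral_mono_AE)
      show "AE x in lborel. ennreal (W x powr (s + r)) * indicator A x \<le>
          ennreal C1 * (ennreal (W x powr r) * indicator A x) +
             ennreal C1 * (ennreal (W x powr r) * indicator A x * J x)"
        using bd
      proof eventually_elim
        case (elim x)
        show ?case
        proof (cases "x \<in> A")
          case True
          have "ennreal (W x powr (s + r)) = ennreal (W x powr r) * ennreal (W x powr s)"
            by (simp add: powr_add mult.commute flip: ennreal_mult)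
          also have "\<dots> \<le> ennreal (W x powr r) * (ennreal C1 * (1 + J x))"
            using pw elim True by (intro mult_left_mono) auto
          finally show ?thesis using True by (simp add: algebra_simps)
        qed auto
      qed
    qed
    also have "\<dots> = ennreal C1 * (\<integral>\<^sup>+x. ennreal (W x powr r) * indicator A x \<partial>lborel) +
         ennreal C1 * (\<integral>\<^sup>+x. ennreal (W x powr r) * indicator A x * J x \<partial>lborel)"
      by (simp add: nn_integral_add nn_integral_cmult)
    also have "\<dots> \<le> ennreal C1 * ennreal (V + 1) +
         ennreal C1 * (ennreal (1 + N2) * (\<integral>\<^sup>+y. ennreal (F y powr s) \<partial>lborel))"
    proof (intro add_mono mult_left_mono)
      have "W x powr r \<le> 1 + (W x)\<^sup>2" for x
      proof (cases "W x \<le> 1")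
        case True
        then have "W x powr r \<le> 1" using W r powr_le1 by simp
        then show ?thesis by (simp add: add_increasing2)
      next
        case False
        then have "W x powr r \<le> W x powr 2" using r by (intro powr_mono) auto
        then show ?thesis using False by simp
      qed
      then have "(\<integral>\<^sup>+x. ennreal (W x powr r) * indicator A x \<partial>lborel) \<le>
         (\<integral>\<^sup>+x. indicator A x + ennreal ((W x)\<^sup>2) * indicator A x \<partial>lborel)"
      proof (intro nn_integral_mono)
        fix x
        have "ennreal (W x powr r) \<le> ennreal (1 + (W x)\<^sup>2)"
          by (intro ennreal_leI) fact
        then show "ennreal (W x powr r) * indicator A x \<le> indicator A x + ennreal ((W x)\<^sup>2) * indicator A x"
          by (simp add: indicator_def)
      qed
      also have "\<dots> = emeasure lborel A + (\<integral>\<^sup>+x. ennreal ((W x)\<^sup>2) * indicator A x \<partial>lborel)"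
        by (simp add: nn_integral_add)
      also have "\<dots> \<le> ennreal V + 1" using AV W2 by (rule add_mono)
      finally show "(\<integral>\<^sup>+x. ennreal (W x powr r) * indicator A x \<partial>lborel) \<le> ennreal (V + 1)"
        using V by simp
      have "(\<integral>\<^sup>+x. ennreal (W x powr r) * indicator A x * J x \<partial>lborel) =
         (\<integral>\<^sup>+x. (\<integral>\<^sup>+y. ennreal (W x powr r) * indicator A x * ennreal (F y powr s * k (x - y)) \<partial>lborel) \<partial>lborel)"
        unfolding J_def by (simp add: nn_integral_cmult)
      also have "\<dots> = (\<integral>\<^sup>+y. (\<integral>\<^sup>+x. ennreal (W x powr r) * indicator A x * ennreal (F y powr s * k (x - y)) \<partial>lborel) \<partial>lborel)"
        by (rule lborel_pair.Fubini') measurable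
      also have "\<dots> \<le> (\<integral>\<^sup>+y. ennreal (F y powr s) * ennreal (1 + N2) \<partial>lborel)"
      proof (rule nn_integral_mono)
        fix y
        have yo: "W x powr r * k (x - y) \<le> (W x)\<^sup>2 + k (x - y) powr (2 / (2 - r))" for x
        proof -
          have "W x powr r * k (x - y) \<le>
            (W x powr r) powr (2 / r) / (2 / r) + k (x - y) powr (2 / (2 - r)) / (2 / (2 - r))"
            using r k0 by (intro Youngs_inequality) (auto simp: field_simps)
          also have "\<dots> \<le> (W x powr r) powr (2 / r) + k (x - y) powr (2 / (2 - r))"
            using r by (intro add_mono) (auto simp: divide_le_eq intro!: mult_left_mono)
          also have "(W x powr r) powr (2 / r) = (W x)\<^sup>2"
            using r W[of x] by (simp add: powr_powr)
          finally show ?thesis .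
        qed
        have "(\<integral>\<^sup>+x. ennreal (W x powr r) * indicator A x * ennreal (F y powr s * k (x - y)) \<partial>lborel) =
          (\<integral>\<^sup>+x. ennreal (F y powr s) * (ennreal (W x powr r * k (x - y)) * indicator A x) \<partial>lborel)"
          using k0 by (intro nn_integral_cong) (simp add: ennreal_mult mult_ac)
        also have "\<dots> = ennreal (F y powr s) * (\<integral>\<^sup>+x. ennreal (W x powr r * k (x - y)) * indicator A x \<partial>lborel)"
          by (simp add: nn_integral_cmult)
        also have "(\<integral>\<^sup>+x. ennreal (W x powr r * k (x - y)) * indicator A x \<partial>lborel) \<le>
          (\<integral>\<^sup>+x. ennreal ((W x)\<^sup>2) * indicator A x + ennreal (k (- y + x) powr (2 / (2 - r))) \<partial>lborel)"
          using yo by (intro nn_integral_mono)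
             (auto simp: indicator_def ennreal_leI simp flip: ennreal_plus)
        also have "\<dots> = (\<integral>\<^sup>+x. ennreal ((W x)\<^sup>2) * indicator A x \<partial>lborel) +
           (\<integral>\<^sup>+x. ennreal (k x powr (2 / (2 - r))) \<partial>lborel)"
          by (subst nn_integral_lborel_translate[of "\<lambda>x. ennreal (k x powr (2 / (2 - r)))" "- y", symmetric])
             (auto simp: nn_integral_add)
        also have "(\<integral>\<^sup>+x. ennreal (k x powr (2 / (2 - r))) \<partial>lborel) = ennreal N2"
          unfolding N2(2)[symmetric] using r
          by (intro nn_integral_cong) (auto simp: k_def indicator_def powr_powr)
        also have "(\<integral>\<^sup>+x. ennreal ((W x)\<^sup>2) * indicator A x \<partial>lborel) + ennreal N2 \<le> ennreal (1 + N2)"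
          using W2 N2 by (simp add: add_mono)
        finally show "(\<integral>\<^sup>+x. ennreal (W x powr r) * indicator A x * ennreal (F y powr s * k (x - y)) \<partial>lborel)
           \<le> ennreal (F y powr s) * ennreal (1 + N2)"
          by (simp add: mult_left_mono)
      qed
      also have "\<dots> = ennreal (1 + N2) * (\<integral>\<^sup>+y. ennreal (F y powr s) \<partial>lborel)"
        by (subst nn_integral_multc) (auto simp: mult.commute)
      finally show "(\<integral>\<^sup>+x. ennreal (W x powr r) * indicator A x * J x \<partial>lborel) \<le>
         ennreal (1 + N2) * (\<integral>\<^sup>+y. ennreal (F y powr s) \<partial>lborel)" .
    qed auto
    also have "\<dots> \<le> ennreal C * (1 + (\<integral>\<^sup>+y. ennreal (F y powr s) \<partial>lborel))"
    proof -
      have "ennreal C1 * ennreal (V + 1) \<le> ennreal C" "ennreal C1 * ennreal (1 + N2) \<le> ennreal C"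
        using C1 V N2 unfolding C_def by (simp_all only: ennreal_mult'[symmetric] less_imp_le)
          (simp_all add: ennreal_leI del: ennreal_plus)
      then show ?thesis
        by (simp add: distrib_left mult.assoc[symmetric] add_mono mult_right_mono)
    qed
    finally show "(\<integral>\<^sup>+x. ennreal (W x powr (s + r)) * indicator A x \<partial>lborel)
          \<le> ennreal C * (1 + (\<integral>\<^sup>+y. ennreal (F y powr s) \<partial>lborel))" .
  qed
qed

section \<open>A pointwise bound by the symmetric gradient\<close>

lemma nn_integral_lborel_scale:
  fixes f :: "'a::euclidean_space \<Rightarrow> ennreal"
  assumes [measurable]: "f \<in> borel_measurable borel" and c: "c > 0"
  shows "(\<integral>\<^sup>+x. f (c *\<^sub>R x) \<partial>lborel) = ennreal (1 / c ^ DIM('a)) * (\<integral>\<^sup>+x. f x \<partial>lborel)"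
proof -
  have "(\<integral>\<^sup>+x. f x \<partial>lborel) =
      (\<integral>\<^sup>+x. f x \<partial>density (distr lborel borel (\<lambda>x. 0 + c *\<^sub>R x)) (\<lambda>_. ennreal (\<bar>c\<bar> ^ DIM('a))))"
    using lborel_affine[of c "0::'a"] c by simp
  also have "\<dots> = ennreal (c ^ DIM('a)) * (\<integral>\<^sup>+x. f (c *\<^sub>R x) \<partial>lborel)"
    using c by (simp add: nn_integral_density nn_integral_distr nn_integral_cmult)
  finally show ?thesis
    using c by (simp add: mult.assoc[symmetric] ennreal_mult[symmetric])
qed

text \<open>This is the radial integral that turns an average over rays into a kernel.\<close>

lemma nn_integral_power_tail:
  fixes a :: real
  assumes a: "a > 0"
  shows "(\<integral>\<^sup>+s. ennreal (1 / s ^ (n + 2)) * indicator {a..} s \<partial>lborel) = ennreal (1 / (real (n + 1) * a ^ (n + 1)))"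
proof -
  have "(\<integral>\<^sup>+s. ennreal (1 / s ^ (n + 2)) * indicator {a..} s \<partial>lborel) =
      ennreal (0 - (- (inverse a ^ Suc n / real (Suc n))))"
  proof (rule nn_integral_FTC_atLeast)
    show "((\<lambda>s. - (inverse s ^ Suc n / real (Suc n))) has_real_derivative 1 / s ^ (n + 2)) (at s)" if "a \<le> s" for s
    proof -
      have "s \<noteq> 0" using a that by simp
      from DERIV_minus[OF DERIV_cdivide[OF DERIV_power_Suc[OF DERIV_inverse[OF this]]]]
      show ?thesis
        by (rule DERIV_cong) (simp add: divide_inverse power_inverse add_eq_0_iff)
    qed
    have "((\<lambda>s::real. inverse s ^ Suc n) \<longlongrightarrow> 0 ^ Suc n) at_top"
      by (intro tendsto_power tendsto_inverse_0_at_top filterlim_ident)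
    from tendsto_mult_left[OF this, of "- (1 / real (Suc n))"]
    show "((\<lambda>s::real. - (inverse s ^ Suc n / real (Suc n))) \<longlongrightarrow> 0) at_top"
      by simp
  qed (use a in auto)
  also have "0 - (- (inverse a ^ Suc n / real (Suc n))) = 1 / (real (n + 1) * a ^ (n + 1))"
    by (simp add: divide_inverse power_inverse mult.commute)
  finally show ?thesis .
qed

text \<open>Polar coordinates without spheres: substituting \<open>z = s w\<close> for fixed \<open>s\<close> produces the Jacobian
\<open>s^(-d)\<close>, and after exchanging the integrals the remaining integral over \<open>s \<ge> |z| / \<delta>\<close> of
\<open>s^(-d-2)\<close> combines with \<open>|z|\<^sup>2\<close> to the kernel \<open>|z|^(1-d)\<close>.\<close>

lemma ray_average_bound:
  fixes N :: "'a::euclidean_space \<Rightarrow> real" and \<delta> :: real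
  assumes [measurable]: "N \<in> borel_measurable borel" and N: "\<And>z. N z \<ge> 0" and \<delta>: "\<delta> > 0"
  shows "(\<integral>\<^sup>+w. (\<integral>\<^sup>+s. ennreal ((norm w)\<^sup>2 * N (s *\<^sub>R w)) * indicator {0..1} s \<partial>lborel) * indicator (ball 0 \<delta>) w \<partial>lborel)
    \<le> ennreal (\<delta> ^ (DIM('a) + 1)) * (\<integral>\<^sup>+z. ennreal (N z * norm z powr (1 - real DIM('a))) * indicator (ball 0 \<delta>) z \<partial>lborel)"
proof -
  let ?n = "DIM('a)"
  have "(\<integral>\<^sup>+w. (\<integral>\<^sup>+s. ennreal ((norm w)\<^sup>2 * N (s *\<^sub>R w)) * indicator {0..1} s \<partial>lborel) * indicator (ball 0 \<delta>) w \<partial>lborel)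
     = (\<integral>\<^sup>+w. (\<integral>\<^sup>+s. ennreal ((norm w)\<^sup>2 * N (s *\<^sub>R w)) * indicator {0..1} s * indicator (ball 0 \<delta>) w \<partial>lborel) \<partial>lborel)"
    by (simp add: nn_integral_multc)
  also have "\<dots> = (\<integral>\<^sup>+s. (\<integral>\<^sup>+w. ennreal ((norm w)\<^sup>2 * N (s *\<^sub>R w)) * indicator {0..1} s * indicator (ball 0 \<delta>) w \<partial>lborel) \<partial>lborel)"
    by (rule lborel_pair.Fubini') measurable
  also have "\<dots> = (\<integral>\<^sup>+s. (\<integral>\<^sup>+z. ennreal ((norm z)\<^sup>2 * N z) * (ennreal (1 / s ^ (?n + 2)) * indicator {0<..1} s) *
      indicator (ball 0 (s * \<delta>)) z \<partial>lborel) \<partial>lborel)"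
  proof (rule nn_integral_cong_AE)
    have "AE s in lborel. s \<noteq> (0::real)" by (rule AE_lborel_singleton)
    then show "AE s in lborel. (\<integral>\<^sup>+w. ennreal ((norm w)\<^sup>2 * N (s *\<^sub>R w)) * indicator {0..1} s * indicator (ball 0 \<delta>) w \<partial>lborel) =
       (\<integral>\<^sup>+z. ennreal ((norm z)\<^sup>2 * N z) * (ennreal (1 / s ^ (?n + 2)) * indicator {0<..1} s) *
      indicator (ball 0 (s * \<delta>)) z \<partial>lborel)"
    proof eventually_elim
      case (elim s)
      show ?case
      proof (cases "s \<in> {0<..1}")
        case True
        let ?f = "\<lambda>z. ennreal ((norm z)\<^sup>2 * N z) * indicator (ball 0 (s * \<delta>)) z"
        have "(\<integral>\<^sup>+w. ennreal ((norm w)\<^sup>2 * N (s *\<^sub>R w)) * indicator {0..1} s * indicator (ball 0 \<delta>) w \<partial>lborel) =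
          (\<integral>\<^sup>+w. ennreal (1 / s\<^sup>2) * ?f (s *\<^sub>R w) \<partial>lborel)"
        proof (rule nn_integral_cong)
          fix w :: 'a
          have "norm (s *\<^sub>R w) < s * \<delta> \<longleftrightarrow> norm w < \<delta>" using True by simp
          moreover have "(norm w)\<^sup>2 * N (s *\<^sub>R w) = 1 / s\<^sup>2 * ((norm (s *\<^sub>R w))\<^sup>2 * N (s *\<^sub>R w))"
            using True by (simp add: power_mult_distrib)
          ultimately show "ennreal ((norm w)\<^sup>2 * N (s *\<^sub>R w)) * indicator {0..1} s * indicator (ball 0 \<delta>) w =
             ennreal (1 / s\<^sup>2) * ?f (s *\<^sub>R w)"
            using True N by (simp add: indicator_def ennreal_mult[symmetric])
        qed
        also have "\<dots> = ennreal (1 / s\<^sup>2) * (ennreal (1 / s ^ ?n) * (\<integral>\<^sup>+z. ?f z \<partial>lborel))"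
        proof -
          have m: "?f \<in> borel_measurable borel" by measurable
          have "(\<integral>\<^sup>+w. ennreal (1 / s\<^sup>2) * ?f (s *\<^sub>R w) \<partial>lborel) = ennreal (1 / s\<^sup>2) * (\<integral>\<^sup>+w. ?f (s *\<^sub>R w) \<partial>lborel)"
            using m by (intro nn_integral_cmult) measurable
          also have "(\<integral>\<^sup>+w. ?f (s *\<^sub>R w) \<partial>lborel) = ennreal (1 / s ^ ?n) * (\<integral>\<^sup>+z. ?f z \<partial>lborel)"
            using True by (intro nn_integral_lborel_scale[OF m]) simp
          finally show ?thesis .
        qed
        also have "\<dots> = ennreal (1 / s ^ (?n + 2)) * (\<integral>\<^sup>+z. ?f z \<partial>lborel)"
        proof -
          have "1 / s\<^sup>2 * (1 / s ^ ?n) = 1 / s ^ (?n + 2)"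
            by (simp add: power_add power2_eq_square)
          moreover have "ennreal (1 / s\<^sup>2 * (1 / s ^ ?n)) = ennreal (1 / s\<^sup>2) * ennreal (1 / s ^ ?n)"
            using True by (intro ennreal_mult) auto
          ultimately show ?thesis by (simp only: mult.assoc)
        qed
        also have "\<dots> = (\<integral>\<^sup>+z. ennreal (1 / s ^ (?n + 2)) * ?f z \<partial>lborel)"
          by (simp add: nn_integral_cmult)
        finally show ?thesis using True by (simp add: mult_ac)
      next
        case False
        then show ?thesis using elim by auto
      qed
    qed
  qed
  also have "\<dots> = (\<integral>\<^sup>+z. (\<integral>\<^sup>+s. ennreal ((norm z)\<^sup>2 * N z) * (ennreal (1 / s ^ (?n + 2)) * indicator {0<..1} s) *
      indicator (ball 0 (s * \<delta>)) z \<partial>lborel) \<partial>lborel)"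
    unfolding ball_def by (rule lborel_pair.Fubini') measurable
  also have "\<dots> \<le> (\<integral>\<^sup>+z. ennreal (\<delta> ^ (?n + 1)) * (ennreal (N z * norm z powr (1 - real ?n)) * indicator (ball 0 \<delta>) z) \<partial>lborel)"
  proof (rule nn_integral_mono)
    fix z :: 'a
    show "(\<integral>\<^sup>+s. ennreal ((norm z)\<^sup>2 * N z) * (ennreal (1 / s ^ (?n + 2)) * indicator {0<..1} s) *
      indicator (ball 0 (s * \<delta>)) z \<partial>lborel) \<le> ennreal (\<delta> ^ (?n + 1)) * (ennreal (N z * norm z powr (1 - real ?n)) * indicator (ball 0 \<delta>) z)"
    proof (cases "z = 0")
      case z: False
      define a where "a = norm z / \<delta>"
      have a: "a > 0" using z \<delta> by (simp add: a_def)
      have "(\<integral>\<^sup>+s. ennreal ((norm z)\<^sup>2 * N z) * (ennreal (1 / s ^ (?n + 2)) * indicator {0<..1} s) *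
          indicator (ball 0 (s * \<delta>)) z \<partial>lborel)
        \<le> (\<integral>\<^sup>+s. (ennreal ((norm z)\<^sup>2 * N z) * indicator (ball 0 \<delta>) z) * (ennreal (1 / s ^ (?n + 2)) * indicator {a..} s) \<partial>lborel)"
      proof (rule nn_integral_mono)
        fix s :: real
        have "a \<le> s \<and> norm z < \<delta>" if "0 < s" "s \<le> 1" "norm z < s * \<delta>"
        proof -
          have "s * \<delta> \<le> \<delta>" using that \<delta> by simp
          then have "norm z < \<delta>" using that by linarith
          moreover have "a \<le> s" using that \<delta> by (simp add: a_def pos_divide_le_eq)
          ultimately show ?thesis by blast
        qed
        then show "ennreal ((norm z)\<^sup>2 * N z) * (ennreal (1 / s ^ (?n + 2)) * indicator {0<..1} s) *
          indicator (ball 0 (s * \<delta>)) z \<le> (ennreal ((norm z)\<^sup>2 * N z) * indicator (ball 0 \<delta>) z) * (ennreal (1 / s ^ (?n + 2)) * indicator {a..} s)"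
          by (auto simp: indicator_def)
      qed
      also have "\<dots> = (ennreal ((norm z)\<^sup>2 * N z) * indicator (ball 0 \<delta>) z) * ennreal (1 / (real (?n + 1) * a ^ (?n + 1)))"
        unfolding nn_integral_power_tail[OF a, symmetric] by (rule nn_integral_cmult) measurable
      also have "\<dots> \<le> (ennreal ((norm z)\<^sup>2 * N z) * indicator (ball 0 \<delta>) z) * ennreal (1 / a ^ (?n + 1))"
      proof (intro mult_left_mono ennreal_leI divide_left_mono)
        show "a ^ (?n + 1) \<le> real (?n + 1) * a ^ (?n + 1)"
          using a mult_right_mono[of 1 "real (?n + 1)" "a ^ (?n + 1)"] by simp
      qed (use a in auto)
      also have "\<dots> = ennreal ((norm z)\<^sup>2 * N z * (1 / a ^ (?n + 1))) * indicator (ball 0 \<delta>) z"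
      proof -
        have "ennreal ((norm z)\<^sup>2 * N z * (1 / a ^ (?n + 1))) = ennreal ((norm z)\<^sup>2 * N z) * ennreal (1 / a ^ (?n + 1))"
          using N a by (intro ennreal_mult) auto
        then show ?thesis by (simp only: mult_ac)
      qed
      also have "(norm z)\<^sup>2 * N z * (1 / a ^ (?n + 1)) = \<delta> ^ (?n + 1) * (N z * norm z powr (1 - real ?n))"
      proof -
        have "norm z powr (1 - real ?n) = norm z / norm z ^ ?n"
          using z by (simp add: powr_diff powr_realpow)
        then show ?thesis using z \<delta> by (simp add: a_def power_divide field_simps power2_eq_square)
      qed
      finally show ?thesis using N \<delta> by (simp add: ennreal_mult mult.assoc)
    qed auto
  qed
  also have "\<dots> = ennreal (\<delta> ^ (?n + 1)) * (\<integral>\<^sup>+z. ennreal (N z * norm z powr (1 - real ?n)) * indicator (ball 0 \<delta>) z \<partial>lborel)"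
    by (rule nn_integral_cmult) measurable
  finally show ?thesis .
qed

definition sym_deriv :: "(real^'d \<Rightarrow> real^'d) \<Rightarrow> real^'d \<Rightarrow> real^'d^'d::finite" where
  "sym_deriv \<phi> x = (\<chi> i j. (frechet_derivative \<phi> (at x) (axis j 1) $ i + frechet_derivative \<phi> (at x) (axis i 1) $ j) / 2)"

text \<open>Only the symmetric part of a matrix contributes to its quadratic form.\<close>

lemma sym_deriv_quadratic_form:
  fixes \<phi> :: "real^'d \<Rightarrow> real^'d::finite"
  assumes "\<phi> differentiable (at x)"
  shows "w \<bullet> frechet_derivative \<phi> (at x) w = (\<Sum>i\<in>UNIV. \<Sum>j\<in>UNIV. w $ i * w $ j * sym_deriv \<phi> x $ i $ j)"
proof -
  let ?D = "frechet_derivative \<phi> (at x)"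
  let ?M = "\<lambda>i j. w $ i * w $ j * (?D (axis j 1) $ i)"
  have lin: "linear ?D" using assms linear_frechet_derivative by blast
  have "?D w = ?D (\<Sum>j\<in>UNIV. w $ j *\<^sub>R axis j 1)"
    using basis_expansion[of w] by (simp add: scalar_mult_eq_scaleR)
  also have "\<dots> = (\<Sum>j\<in>UNIV. w $ j *\<^sub>R ?D (axis j 1))"
    using lin by (simp add: linear_sum linear_cmul o_def)
  finally have "w \<bullet> ?D w = (\<Sum>i\<in>UNIV. \<Sum>j\<in>UNIV. ?M i j)"
    by (simp add: inner_vec_def sum_distrib_left mult_ac)
  moreover have "(\<Sum>i\<in>UNIV. \<Sum>j\<in>UNIV. ?M j i) = (\<Sum>i\<in>UNIV. \<Sum>j\<in>UNIV. ?M i j)"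
    by (rule sum.swap)
  moreover have "(\<Sum>i\<in>UNIV. \<Sum>j\<in>UNIV. w $ i * w $ j * sym_deriv \<phi> x $ i $ j) =
     ((\<Sum>i\<in>UNIV. \<Sum>j\<in>UNIV. ?M i j) + (\<Sum>i\<in>UNIV. \<Sum>j\<in>UNIV. ?M j i)) / 2"
    by (simp add: sym_deriv_def sum.distrib[symmetric] sum_divide_distrib field_simps)
  ultimately show ?thesis by simp
qed

lemma abs_quadratic_form_le:
  fixes S :: "real^'d^'d::finite"
  shows "\<bar>\<Sum>i\<in>UNIV. \<Sum>j\<in>UNIV. w $ i * w $ j * S $ i $ j\<bar> \<le> real CARD('d) ^ 2 * ((norm w)\<^sup>2 * norm S)"
proof -
  have "\<bar>\<Sum>i\<in>UNIV. \<Sum>j\<in>UNIV. w $ i * w $ j * S $ i $ j\<bar> \<le> (\<Sum>i\<in>(UNIV::'d set). \<Sum>j\<in>(UNIV::'d set). (norm w)\<^sup>2 * norm S)"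
  proof (intro order_trans[OF sum_abs] sum_mono)
    fix i j
    have "\<bar>w $ i\<bar> * \<bar>w $ j\<bar> * \<bar>S $ i $ j\<bar> \<le> norm w * norm w * norm S"
    proof (intro mult_mono)
      have "\<bar>S $ i $ j\<bar> \<le> norm (S $ i)" by (rule component_le_norm_cart)
      also have "\<dots> \<le> norm S" by (rule Finite_Cartesian_Product.norm_nth_le)
      finally show "\<bar>S $ i $ j\<bar> \<le> norm S" .
    qed (auto intro: component_le_norm_cart)
    then show "\<bar>w $ i * w $ j * S $ i $ j\<bar> \<le> (norm w)\<^sup>2 * norm S"
      by (simp add: abs_mult power2_eq_square)
  qed
  then show ?thesis by (simp add: power2_eq_square mult.assoc)
qed

text \<open>Fundamental theorem of calculus for \<open>w \<bullet> \<phi>\<close> on the segment from \<open>x\<close> to \<open>x + w\<close>.\<close>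

lemma ray_inequality:
  fixes \<phi> :: "real^'d \<Rightarrow> real^'d::finite"
  assumes diff: "\<And>x. \<phi> differentiable (at x)" and cont: "continuous_on UNIV (sym_deriv \<phi>)"
  shows "ennreal \<bar>w \<bullet> \<phi> x\<bar> \<le> ennreal (norm w * norm (\<phi> (x + w))) +
    ennreal (real CARD('d) ^ 2) * (\<integral>\<^sup>+s. ennreal ((norm w)\<^sup>2 * norm (sym_deriv \<phi> (x + s *\<^sub>R w))) * indicator {0..1} s \<partial>lborel)"
proof -
  let ?Q = "\<lambda>s. \<Sum>i\<in>UNIV. \<Sum>j\<in>UNIV. w $ i * w $ j * sym_deriv \<phi> (x + s *\<^sub>R w) $ i $ j"
  have c: "continuous_on UNIV (\<lambda>s. sym_deriv \<phi> (x + s *\<^sub>R w))"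
    by (intro continuous_on_compose2[OF cont] continuous_intros) auto
  have [measurable]: "(\<lambda>s. sym_deriv \<phi> (x + s *\<^sub>R w)) \<in> borel_measurable borel"
    using c by (rule borel_measurable_continuous_onI)
  have cQ: "continuous_on UNIV ?Q"
    by (intro continuous_intros c)
  have FTC: "(\<integral>s. indicator {0..1} s *\<^sub>R ?Q s \<partial>lborel) = w \<bullet> \<phi> (x + 1 *\<^sub>R w) - w \<bullet> \<phi> (x + 0 *\<^sub>R w)"
  proof (rule integral_FTC_atLeastAtMost)
    fix s :: real
    have "((\<lambda>s. \<phi> (x + s *\<^sub>R w)) has_derivative (\<lambda>h. frechet_derivative \<phi> (at (x + s *\<^sub>R w)) (h *\<^sub>R w))) (at s)"
      by (rule has_derivative_compose[OF _ diff[unfolded frechet_derivative_works]])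
         (auto intro!: derivative_eq_intros)
    then have "((\<lambda>s. w \<bullet> \<phi> (x + s *\<^sub>R w)) has_derivative (\<lambda>h. w \<bullet> frechet_derivative \<phi> (at (x + s *\<^sub>R w)) (h *\<^sub>R w))) (at s)"
      by (rule has_derivative_inner_right)
    moreover have "(\<lambda>h. w \<bullet> frechet_derivative \<phi> (at (x + s *\<^sub>R w)) (h *\<^sub>R w)) = (\<lambda>h. h *\<^sub>R ?Q s)"
      using linear_cmul[OF linear_frechet_derivative[OF diff[of "x + s *\<^sub>R w"]]]
      by (simp add: sym_deriv_quadratic_form[OF diff, symmetric])
    ultimately have "((\<lambda>s. w \<bullet> \<phi> (x + s *\<^sub>R w)) has_vector_derivative ?Q s) (at s)"
      by (simp add: has_vector_derivative_def)
    then show "((\<lambda>s. w \<bullet> \<phi> (x + s *\<^sub>R w)) has_vector_derivative ?Q s) (at s within {0..1})"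
      by (rule has_vector_derivative_at_within)
  qed (use cQ continuous_on_subset in auto)
  have "integrable lborel (\<lambda>s. indicator {0..1} s *\<^sub>R ?Q s)"
    using borel_integrable_atLeastAtMost'[of 0 1 ?Q] cQ continuous_on_subset
    by (auto simp: set_integrable_def)
  note int = this
  have "ennreal \<bar>w \<bullet> \<phi> (x + w) - w \<bullet> \<phi> x\<bar> \<le> (\<integral>\<^sup>+s. ennreal (norm (indicator {0..1} s *\<^sub>R ?Q s)) \<partial>lborel)"
    using integral_norm_bound_ennreal[OF int] unfolding FTC by simp
  also have "\<dots> \<le> (\<integral>\<^sup>+s. ennreal (real CARD('d) ^ 2) * (ennreal ((norm w)\<^sup>2 * norm (sym_deriv \<phi> (x + s *\<^sub>R w))) * indicator {0..1} s) \<partial>lborel)"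
    using abs_quadratic_form_le[of w "sym_deriv \<phi> (x + _ *\<^sub>R w)"]
    by (intro nn_integral_mono) (simp add: indicator_def ennreal_mult[symmetric] ennreal_leI)
  also have "\<dots> = ennreal (real CARD('d) ^ 2) * (\<integral>\<^sup>+s. ennreal ((norm w)\<^sup>2 * norm (sym_deriv \<phi> (x + s *\<^sub>R w))) * indicator {0..1} s \<partial>lborel)"
    by (intro nn_integral_cmult) measurable
  finally have *: "ennreal \<bar>w \<bullet> \<phi> (x + w) - w \<bullet> \<phi> x\<bar> \<le> \<dots>" .
  have "\<bar>w \<bullet> \<phi> x\<bar> \<le> norm w * norm (\<phi> (x + w)) + \<bar>w \<bullet> \<phi> (x + w) - w \<bullet> \<phi> x\<bar>"
    using Cauchy_Schwarz_ineq2[of w "\<phi> (x + w)"] by linarith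
  then have "ennreal \<bar>w \<bullet> \<phi> x\<bar> \<le> ennreal (norm w * norm (\<phi> (x + w))) + ennreal \<bar>w \<bullet> \<phi> (x + w) - w \<bullet> \<phi> x\<bar>"
    by (simp add: ennreal_leI flip: ennreal_plus)
  also have "\<dots> \<le> ennreal (norm w * norm (\<phi> (x + w))) +
    ennreal (real CARD('d) ^ 2) * (\<integral>\<^sup>+s. ennreal ((norm w)\<^sup>2 * norm (sym_deriv \<phi> (x + s *\<^sub>R w))) * indicator {0..1} s \<partial>lborel)"
    by (intro add_left_mono *)
  finally show ?thesis .
qed

text \<open>Integrating \<open>ray_inequality\<close> over the ball \<open>|w| < \<delta>\<close>.  The left-hand side stays proportional to
\<open>|\<phi>(x)|\<close> because a fixed fraction of the directions \<open>w\<close> makes an acute angle with \<open>\<phi>(x)\<close>.\<close>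

lemma pointwise_bound_sym_deriv:
  fixes \<delta> :: real
  assumes \<delta>: "\<delta> > 0"
  shows "\<exists>C>0. \<forall>(\<phi> :: real^'d \<Rightarrow> real^'d::finite) x.
      (\<forall>x. \<phi> differentiable (at x)) \<longrightarrow> continuous_on UNIV (sym_deriv \<phi>) \<longrightarrow>
      ennreal (norm (\<phi> x)) \<le> ennreal C *
        ((\<integral>\<^sup>+y. ennreal (norm (sym_deriv \<phi> y) * norm (x - y) powr (1 - real CARD('d))) * indicator (ball x \<delta>) y \<partial>lborel)
         + (\<integral>\<^sup>+y. ennreal (norm (\<phi> y)) * indicator (ball x \<delta>) y \<partial>lborel))"
proof -
  let ?n = "CARD('d)"
  define c where "c = \<delta> / 4 * (unit_ball_vol (real ?n) * (\<delta> / 4) ^ ?n)"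
  have c: "c > 0" using \<delta> by (simp add: c_def)
  define D where "D = max \<delta> (real ?n ^ 2 * \<delta> ^ (?n + 1))"
  have D: "D > 0" using \<delta> by (simp add: D_def)
  show ?thesis
  proof (intro exI[of _ "D / c"] conjI allI impI)
    show "D / c > 0" using c D by simp
    fix \<phi> :: "real^'d \<Rightarrow> real^'d" and x :: "real^'d"
    assume diff': "\<forall>x. \<phi> differentiable (at x)" and cont: "continuous_on UNIV (sym_deriv \<phi>)"
    note diff = diff'[rule_format]
    have [measurable]: "\<phi> \<in> borel_measurable borel"
      using diff by (intro borel_measurable_continuous_onI continuous_at_imp_continuous_on)
        (auto intro: differentiable_imp_continuous_within)
    have [measurable]: "sym_deriv \<phi> \<in> borel_measurable borel"
      using cont by (rule borel_measurable_continuous_onI)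
    let ?A = "\<integral>\<^sup>+y. ennreal (norm (sym_deriv \<phi> y) * norm (x - y) powr (1 - real CARD('d))) * indicator (ball x \<delta>) y \<partial>lborel"
    let ?B = "\<integral>\<^sup>+y. ennreal (norm (\<phi> y)) * indicator (ball x \<delta>) y \<partial>lborel"
    let ?R = "\<lambda>w. \<integral>\<^sup>+s. ennreal ((norm w)\<^sup>2 * norm (sym_deriv \<phi> (x + s *\<^sub>R w))) * indicator {0..1} s \<partial>lborel"
    define v where "v = \<phi> x"
    have low: "ennreal (c * norm v) \<le> (\<integral>\<^sup>+w. ennreal \<bar>w \<bullet> v\<bar> * indicator (ball 0 \<delta>) w \<partial>lborel)"
    proof (cases "v = 0")
      case False
      \<comment> \<open>every \<open>w\<close> in the ball of radius \<open>\<delta> / 4\<close> about this point satisfies \<open>w \<bullet> v \<ge> \<delta> / 4 * norm v\<close>\<close>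
      define e where "e = (\<delta> / 2 / norm v) *\<^sub>R v"
      have ne: "norm e = \<delta> / 2" using False \<delta> by (simp add: e_def)
      have ev: "e \<bullet> v = \<delta> / 2 * norm v" using False by (simp add: e_def dot_square_norm power2_eq_square)
      have w: "\<delta> / 4 * norm v \<le> w \<bullet> v \<and> norm w < \<delta>" if "w \<in> ball e (\<delta> / 4)" for w
      proof
        have n: "norm (w - e) \<le> \<delta> / 4" using that by (simp add: dist_norm norm_minus_commute)
        have "\<bar>(w - e) \<bullet> v\<bar> \<le> \<delta> / 4 * norm v"
          using Cauchy_Schwarz_ineq2[of "w - e" v] n by (smt (verit) mult_right_mono norm_ge_zero)
        then show "\<delta> / 4 * norm v \<le> w \<bullet> v" using ev inner_diff_left[of w e v] by linarith
        show "norm w < \<delta>" using norm_triangle_ineq[of "w - e" e] n ne \<delta> by simp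
      qed
      have "ennreal (c * norm v) = ennreal (\<delta> / 4 * norm v) * emeasure lborel (ball e (\<delta> / 4))"
        using \<delta> by (simp add: c_def emeasure_ball ennreal_mult[symmetric] mult_ac)
      also have "\<dots> = (\<integral>\<^sup>+w. ennreal (\<delta> / 4 * norm v) * indicator (ball e (\<delta> / 4)) w \<partial>lborel)"
        by (simp add: nn_integral_cmult_indicator)
      also have "\<dots> \<le> (\<integral>\<^sup>+w. ennreal \<bar>w \<bullet> v\<bar> * indicator (ball 0 \<delta>) w \<partial>lborel)"
      proof (rule nn_integral_mono)
        fix w
        show "ennreal (\<delta> / 4 * norm v) * indicator (ball e (\<delta> / 4)) w \<le> ennreal \<bar>w \<bullet> v\<bar> * indicator (ball 0 \<delta>) w"
        proof (cases "w \<in> ball e (\<delta> / 4)")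
          case True
          from w[OF this] True show ?thesis by (auto simp: indicator_def intro!: ennreal_leI)
        qed auto
      qed
      finally show ?thesis .
    qed auto
    have "(\<integral>\<^sup>+w. ennreal \<bar>w \<bullet> v\<bar> * indicator (ball 0 \<delta>) w \<partial>lborel) \<le>
       (\<integral>\<^sup>+w. ennreal (norm w * norm (\<phi> (x + w))) * indicator (ball 0 \<delta>) w +
          ennreal (real ?n ^ 2) * (?R w * indicator (ball 0 \<delta>) w) \<partial>lborel)"
    proof (rule nn_integral_mono)
      fix w
      show "ennreal \<bar>w \<bullet> v\<bar> * indicator (ball 0 \<delta>) w \<le> ennreal (norm w * norm (\<phi> (x + w))) * indicator (ball 0 \<delta>) w +
          ennreal (real ?n ^ 2) * (?R w * indicator (ball 0 \<delta>) w)"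
        using ray_inequality[OF diff cont, of w x]
        by (cases "w \<in> ball 0 \<delta>") (simp_all add: v_def)
    qed
    also have "\<dots> = (\<integral>\<^sup>+w. ennreal (norm w * norm (\<phi> (x + w))) * indicator (ball 0 \<delta>) w \<partial>lborel) +
       ennreal (real ?n ^ 2) * (\<integral>\<^sup>+w. ?R w * indicator (ball 0 \<delta>) w \<partial>lborel)"
      by (subst nn_integral_add) (auto intro!: nn_integral_cmult simp del: mem_ball)
    also have "\<dots> \<le> ennreal D * ?B + ennreal D * ?A"
    proof (rule add_mono)
      have tr: "(\<integral>\<^sup>+y. f (- x + y) \<partial>lborel) = (\<integral>\<^sup>+y. f y \<partial>lborel)" if "f \<in> borel_measurable borel" for f
        using that by (rule nn_integral_lborel_translate)
      have "(\<integral>\<^sup>+w. ennreal (norm w * norm (\<phi> (x + w))) * indicator (ball 0 \<delta>) w \<partial>lborel)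
         \<le> (\<integral>\<^sup>+w. ennreal D * (ennreal (norm (\<phi> (x + w))) * indicator (ball x \<delta>) (x + w)) \<partial>lborel)"
      proof (rule nn_integral_mono)
        fix w
        have "norm w * norm (\<phi> (x + w)) \<le> D * norm (\<phi> (x + w))" if "norm w < \<delta>"
          using that by (intro mult_right_mono) (auto simp: D_def)
        then show "ennreal (norm w * norm (\<phi> (x + w))) * indicator (ball 0 \<delta>) w \<le>
           ennreal D * (ennreal (norm (\<phi> (x + w))) * indicator (ball x \<delta>) (x + w))"
          using D by (auto simp: indicator_def dist_norm ennreal_mult[symmetric] intro!: ennreal_leI)
      qed
      also have "\<dots> = ennreal D * (\<integral>\<^sup>+w. ennreal (norm (\<phi> (x + w))) * indicator (ball x \<delta>) (x + w) \<partial>lborel)"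
        by (intro nn_integral_cmult) measurable
      also have "(\<integral>\<^sup>+w. ennreal (norm (\<phi> (x + w))) * indicator (ball x \<delta>) (x + w) \<partial>lborel) = ?B"
        by (rule nn_integral_lborel_translate) measurable
      finally show "(\<integral>\<^sup>+w. ennreal (norm w * norm (\<phi> (x + w))) * indicator (ball 0 \<delta>) w \<partial>lborel) \<le> ennreal D * ?B" .
      have "(\<integral>\<^sup>+w. ?R w * indicator (ball 0 \<delta>) w \<partial>lborel) \<le> ennreal (\<delta> ^ (?n + 1)) *
          (\<integral>\<^sup>+z. ennreal (norm (sym_deriv \<phi> (x + z)) * norm z powr (1 - real ?n)) * indicator (ball 0 \<delta>) z \<partial>lborel)"
        using ray_average_bound[of "\<lambda>z. norm (sym_deriv \<phi> (x + z))" \<delta>] \<delta> by simp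
      also have "(\<integral>\<^sup>+z. ennreal (norm (sym_deriv \<phi> (x + z)) * norm z powr (1 - real ?n)) * indicator (ball 0 \<delta>) z \<partial>lborel)
         = (\<integral>\<^sup>+z. ennreal (norm (sym_deriv \<phi> (x + z)) * norm (x - (x + z)) powr (1 - real ?n)) * indicator (ball x \<delta>) (x + z) \<partial>lborel)"
        by (intro nn_integral_cong) (simp add: indicator_def dist_norm)
      also have "\<dots> = ?A"
        by (rule nn_integral_lborel_translate[of "\<lambda>y. ennreal (norm (sym_deriv \<phi> y) * norm (x - y) powr (1 - real ?n)) * indicator (ball x \<delta>) y"])
           measurable
      finally have "ennreal (real ?n ^ 2) * (\<integral>\<^sup>+w. ?R w * indicator (ball 0 \<delta>) w \<partial>lborel) \<le>
         ennreal (real ?n ^ 2) * (ennreal (\<delta> ^ (?n + 1)) * ?A)"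
        by (intro mult_left_mono) auto
      also have "\<dots> = ennreal (real ?n ^ 2 * \<delta> ^ (?n + 1)) * ?A"
        using \<delta> by (simp only: mult.assoc[symmetric] ennreal_mult' zero_le_power less_imp_le zero_le_power2)
      also have "\<dots> \<le> ennreal D * ?A"
        by (intro mult_right_mono ennreal_leI) (auto simp: D_def)
      finally show "ennreal (real ?n ^ 2) * (\<integral>\<^sup>+w. ?R w * indicator (ball 0 \<delta>) w \<partial>lborel) \<le> ennreal D * ?A" .
    qed
    finally have "ennreal (c * norm v) \<le> ennreal D * (?A + ?B)"
      using low by (simp add: distrib_left add.commute)
    then have "ennreal (1 / c) * ennreal (c * norm v) \<le> ennreal (1 / c) * (ennreal D * (?A + ?B))"
      by (rule mult_left_mono) auto
    then show "ennreal (norm (\<phi> x)) \<le> ennreal (D / c) * (?A + ?B)"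
      using c D by (simp add: mult.assoc[symmetric] ennreal_mult[symmetric] v_def)
  qed
qed

section \<open>Weak symmetric gradients\<close>

text \<open>The smoothness predicate only speaks of derivatives along basis vectors; linearity extends this to
all directions.\<close>

lemma frechet_derivative_direction:
  assumes "f differentiable (at x)"
  shows "frechet_derivative f (at x) v = (\<Sum>b\<in>Basis. (v \<bullet> b) *\<^sub>R frechet_derivative f (at x) b)"
proof -
  have lin: "linear (frechet_derivative f (at x))" using assms by (rule linear_frechet_derivative)
  have "frechet_derivative f (at x) v = frechet_derivative f (at x) (\<Sum>b\<in>Basis. (v \<bullet> b) *\<^sub>R b)"
    by (simp add: euclidean_representation)
  also have "\<dots> = (\<Sum>b\<in>Basis. (v \<bullet> b) *\<^sub>R frechet_derivative f (at x) b)"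
    using lin by (simp add: linear_sum linear_cmul)
  finally show ?thesis .
qed

lemma Ck_Suc_direction_continuous:
  assumes "Ck (Suc k) f"
  shows "continuous_on UNIV (\<lambda>x. frechet_derivative f (at x) v)"
proof -
  have d: "f differentiable (at x)" for x using assms by simp
  have "(\<lambda>x. frechet_derivative f (at x) v) = (\<lambda>x. \<Sum>b\<in>Basis. (v \<bullet> b) *\<^sub>R frechet_derivative f (at x) b)"
    by (rule ext) (rule frechet_derivative_direction[OF d])
  moreover have "continuous_on UNIV (\<lambda>x. \<Sum>b\<in>Basis. (v \<bullet> b) *\<^sub>R frechet_derivative f (at x) b)"
    using assms Ck_continuous[of k] by (intro continuous_intros) auto
  ultimately show ?thesis by (simp only:)
qed

lemma frechet_derivative_zero_outside:
  fixes f :: "'a::euclidean_space \<Rightarrow> 'b::real_normed_vector"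
  assumes "x \<notin> closure {x. f x \<noteq> 0}"
  shows "frechet_derivative f (at x) v = 0"
proof -
  have "((\<lambda>x. 0) has_derivative (\<lambda>h. 0)) (at x)" by simp
  then have "(f has_derivative (\<lambda>h. 0)) (at x)"
  proof (rule has_derivative_transform_within_open)
    show "open (- closure {x. f x \<noteq> 0})" by auto
    show "0 = f y" if "y \<in> - closure {x. f x \<noteq> 0}" for y
      using that closure_subset[of "{x. f x \<noteq> 0}"] by auto
  qed (use assms in auto)
  from frechet_derivative_at[OF this] show ?thesis by metis
qed

lemma C0inf_smooth:
  assumes "\<phi> \<in> C0inf G"
  shows "\<phi> differentiable (at x)" "continuous_on UNIV \<phi>"
    "continuous_on UNIV (\<lambda>x. frechet_derivative \<phi> (at x) v)"
proof -
  have "Ck (Suc 0) \<phi>" using assms unfolding C0inf_def by blast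
  from Ck_Suc_direction_continuous[OF this] Ck_continuous[OF this] this
  show "\<phi> differentiable (at x)" "continuous_on UNIV \<phi>"
     "continuous_on UNIV (\<lambda>x. frechet_derivative \<phi> (at x) v)"
    by simp_all
qed

lemma C0inf_support:
  assumes "\<phi> \<in> C0inf G"
  shows "\<exists>K. compact K \<and> K \<subseteq> G \<and> (\<forall>x. x \<notin> K \<longrightarrow> \<phi> x = 0 \<and> (\<forall>v. frechet_derivative \<phi> (at x) v = 0))"
proof (intro exI conjI allI impI)
  show "compact (closure {x. \<phi> x \<noteq> 0})" "closure {x. \<phi> x \<noteq> 0} \<subseteq> G"
    using assms unfolding C0inf_def by blast+
  fix x v assume x: "x \<notin> closure {x. \<phi> x \<noteq> 0}"
  then show "\<phi> x = 0" using closure_subset[of "{x. \<phi> x \<noteq> 0}"] by auto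
  show "frechet_derivative \<phi> (at x) v = 0" using x by (rule frechet_derivative_zero_outside)
qed

lemma compact_support_bounded:
  fixes h :: "'a::euclidean_space \<Rightarrow> real"
  assumes "continuous_on UNIV h" "compact K" "\<And>x. x \<notin> K \<Longrightarrow> h x = 0"
  shows "\<exists>M. \<forall>x. \<bar>h x\<bar> \<le> M"
proof -
  have "bounded (h ` K)"
    using assms by (intro compact_imp_bounded compact_continuous_image) (auto intro: continuous_on_subset)
  then obtain M where "\<And>x. x \<in> K \<Longrightarrow> \<bar>h x\<bar> \<le> M" unfolding bounded_iff by auto
  then have "\<bar>h x\<bar> \<le> max M 0" for x using assms(3)[of x] by (cases "x \<in> K") (auto simp: le_max_iff_disj)
  then show ?thesis by blast
qed

text \<open>Difference quotients of \<open>g\<close> integrate to zero by translation invariance, and they converge to the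
directional derivative under a common compactly supported bound.\<close>

lemma integral_derivative_compact_support:
  fixes g :: "'a::euclidean_space \<Rightarrow> real"
  assumes diff: "\<And>x. g differentiable (at x)"
    and cont: "continuous_on UNIV (\<lambda>x. frechet_derivative g (at x) e)"
    and K: "compact K" "\<And>x. x \<notin> K \<Longrightarrow> g x = 0" "\<And>x. x \<notin> K \<Longrightarrow> frechet_derivative g (at x) e = 0"
  shows "(LINT x|lebesgue. frechet_derivative g (at x) e) = 0"
proof -
  let ?D = "\<lambda>x. frechet_derivative g (at x) e"
  have cg: "continuous_on UNIV g"
    by (intro continuous_at_imp_continuous_on ballI differentiable_imp_continuous_within diff)
  have [measurable]: "g \<in> borel_measurable borel" "?D \<in> borel_measurable borel"
    using cg cont by (auto intro: borel_measurable_continuous_onI)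
  obtain R where R: "\<And>x. x \<in> K \<Longrightarrow> norm x \<le> R"
    using compact_imp_bounded[OF K(1)] bounded_iff by blast
  obtain M where M': "\<forall>x. \<bar>?D x\<bar> \<le> M" using compact_support_bounded[OF cont K(1) K(3)] by auto
  have M: "\<bar>?D x\<bar> \<le> M" "M \<ge> 0" for x
    using M'[rule_format, of x] abs_ge_zero[of "?D x"] by linarith+
  obtain B where B': "\<forall>x. \<bar>g x\<bar> \<le> B" using compact_support_bounded[OF cg K(1) K(2)] by auto
  have B: "\<bar>g x\<bar> \<le> B" for x using B' by blast
  have ig: "integrable lborel g"
  proof (rule Bochner_Integration.integrable_bound)
    show "integrable lborel (\<lambda>x. B * indicator K x)"
      using K(1) by (intro integrable_mult_right integrable_real_indicator)
        (use emeasure_compact_finite[OF K(1)] in \<open>auto simp: compact_imp_closed borel_closed\<close>)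
    show "AE x in lborel. norm (g x) \<le> norm (B * indicator K x)"
    proof (rule AE_I2)
      fix x show "norm (g x) \<le> norm (B * indicator K x)"
        using B[of x] K(2)[of x] by (cases "x \<in> K") auto
    qed
  qed simp
  \<comment> \<open>difference quotients in direction \<open>e\<close>\<close>
  define q where "q n x = real (Suc n) * (g ((1 / real (Suc n)) *\<^sub>R e + x) - g x)" for n x
  have [measurable]: "q n \<in> borel_measurable borel" for n unfolding q_def by measurable
  have "(LINT x|lborel. q n x) = 0" for n
  proof -
    let ?h = "(1 / real (Suc n)) *\<^sub>R e"
    have tr: "integrable lborel (\<lambda>x. g (?h + x))" "(LINT x|lborel. g (?h + x)) = (LINT x|lborel. g x)"
    proof -
      have d: "lborel = distr lborel borel ((+) ?h)" by (simp add: lborel_distr_plus)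
      show "integrable lborel (\<lambda>x. g (?h + x))"
        using ig by (subst (asm) d) (simp add: integrable_distr_eq)
      show "(LINT x|lborel. g (?h + x)) = (LINT x|lborel. g x)"
        by (subst (2) d) (simp add: integral_distr)
    qed
    then show ?thesis using ig unfolding q_def by simp
  qed
  moreover have "(\<lambda>n. LINT x|lborel. q n x) \<longlonglongrightarrow> (LINT x|lborel. ?D x)"
  proof (rule integral_dominated_convergence[where w="\<lambda>x. M * indicator (cball 0 (R + norm e)) x"])
    show "integrable lborel (\<lambda>x. M * indicator (cball 0 (R + norm e)) (x::'a))"
      using emeasure_compact_finite[OF compact_cball, of "0::'a" "R + norm e"]
      by (intro integrable_mult_right integrable_real_indicator) auto
    have line: "((\<lambda>s. g (s *\<^sub>R e + x)) has_real_derivative ?D (s *\<^sub>R e + x)) (at s)" for s x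
    proof -
      have "((\<lambda>s. g (s *\<^sub>R e + x)) has_derivative (\<lambda>h. frechet_derivative g (at (s *\<^sub>R e + x)) (h *\<^sub>R e))) (at s)"
        by (rule has_derivative_compose[OF _ diff[unfolded frechet_derivative_works]])
           (auto intro!: derivative_eq_intros)
      moreover have "(\<lambda>h. frechet_derivative g (at (s *\<^sub>R e + x)) (h *\<^sub>R e)) = (*) (?D (s *\<^sub>R e + x))"
        using linear_cmul[OF linear_frechet_derivative[OF diff]] by (auto simp: mult.commute)
      ultimately show ?thesis by (simp add: has_field_derivative_def)
    qed
    show "AE x in lborel. (\<lambda>n. q n x) \<longlonglongrightarrow> ?D x"
    proof (rule AE_I2)
      fix x
      have "((\<lambda>h. (g (h *\<^sub>R e + x) - g x) / h) \<longlongrightarrow> ?D x) (at 0)"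
        using line[of x 0] by (simp add: DERIV_def)
      moreover have "filterlim (\<lambda>n. 1 / real (Suc n)) (at 0) sequentially"
        by (intro filterlim_atI LIMSEQ_Suc lim_1_over_n) auto
      ultimately have "(\<lambda>n. (g ((1 / real (Suc n)) *\<^sub>R e + x) - g x) / (1 / real (Suc n))) \<longlonglongrightarrow> ?D x"
        by (rule filterlim_compose)
      then show "(\<lambda>n. q n x) \<longlonglongrightarrow> ?D x" by (simp add: q_def mult.commute)
    qed
    show "AE x in lborel. norm (q n x) \<le> M * indicator (cball 0 (R + norm e)) x" for n
    proof (rule AE_I2)
      fix x
      let ?h = "1 / real (Suc n)"
      show "norm (q n x) \<le> M * indicator (cball 0 (R + norm e)) x"
      proof (cases "x \<in> cball 0 (R + norm e)")
        case True
        have "\<exists>z. 0 < z \<and> z < ?h \<and> g (?h *\<^sub>R e + x) - g (0 *\<^sub>R e + x) = (?h - 0) * ?D (z *\<^sub>R e + x)"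
          by (intro MVT2 line) simp
        then obtain z where "g (?h *\<^sub>R e + x) - g x = ?h * ?D (z *\<^sub>R e + x)" by auto
        then have "q n x = ?D (z *\<^sub>R e + x)" by (simp add: q_def)
        then show ?thesis using M True by simp
      next
        case False
        have he: "norm (?h *\<^sub>R e) \<le> norm e" by (simp add: divide_le_eq mult_le_cancel_left1)
        have "x \<notin> K" using False R norm_ge_zero[of e] by (smt (verit) mem_cball_0)
        moreover have "?h *\<^sub>R e + x \<notin> K"
        proof
          assume "?h *\<^sub>R e + x \<in> K"
          then have "norm (?h *\<^sub>R e + x) \<le> R" by (rule R)
          moreover have "norm x \<le> norm (?h *\<^sub>R e + x) + norm (?h *\<^sub>R e)"
            using norm_triangle_ineq4[of "?h *\<^sub>R e + x" "?h *\<^sub>R e"] by simp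
          ultimately show False using he False by simp
        qed
        ultimately have "q n x = 0" using K(2) by (simp add: q_def)
        then show ?thesis using False by simp
      qed
    qed
  qed auto
  ultimately have "(LINT x|lborel. ?D x) = 0" by (simp add: LIMSEQ_const_iff)
  then show ?thesis by (simp add: integral_completion)
qed

lemma locally_integrable_continuous:
  fixes f :: "'a::euclidean_space \<Rightarrow> 'b::euclidean_space"
  assumes "continuous_on UNIV f"
  shows "locally_integrable G f"
  unfolding locally_integrable_def
proof (intro allI impI)
  fix K :: "'a set" assume "compact K"
  then have "set_integrable lborel K f"
    using assms by (intro borel_integrable_compact[unfolded set_integrable_def[symmetric]]) (auto intro: continuous_on_subset)
  then show "set_integrable lebesgue K f"
    by (simp add: set_integrable_def integrable_completion)
qed

lemma locally_integrable_component:
  fixes f :: "'a::euclidean_space \<Rightarrow> real^'n::finite"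
  assumes "locally_integrable G f"
  shows "locally_integrable G (\<lambda>x. f x $ i)"
  unfolding locally_integrable_def set_integrable_def
proof (intro allI impI)
  fix K assume "compact K" "K \<subseteq> G"
  then have "integrable lebesgue (\<lambda>x. (indicator K x *\<^sub>R f x) \<bullet> axis i 1)"
    using assms by (intro integrable_inner_left) (auto simp: locally_integrable_def set_integrable_def)
  then show "integrable lebesgue (\<lambda>x. indicator K x *\<^sub>R (f x $ i))"
    by (simp add: inner_axis)
qed

lemma locally_integrable_component2:
  fixes f :: "'a::euclidean_space \<Rightarrow> real^'n::finite^'m::finite"
  assumes "locally_integrable G f"
  shows "locally_integrable G (\<lambda>x. f x $ i $ j)"
  unfolding locally_integrable_def set_integrable_def
proof (intro allI impI)
  fix K assume "compact K" "K \<subseteq> G"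
  then have "integrable lebesgue (\<lambda>x. (indicator K x *\<^sub>R f x) \<bullet> axis i (axis j 1))"
    using assms by (intro integrable_inner_left) (auto simp: locally_integrable_def set_integrable_def)
  then show "integrable lebesgue (\<lambda>x. indicator K x *\<^sub>R (f x $ i $ j))"
    by (simp add: inner_axis)
qed

lemma locally_integrable_diff:
  "locally_integrable G f \<Longrightarrow> locally_integrable G g \<Longrightarrow> locally_integrable G (\<lambda>x. f x - g x)"
  unfolding locally_integrable_def by (auto intro: set_integral_diff)

lemma lebesgue_on_test_integrable:
  fixes f :: "'a::euclidean_space \<Rightarrow> real"
  assumes "open G" "locally_integrable G f" "continuous_on UNIV g" "compact K" "K \<subseteq> G" "\<And>x. x \<notin> K \<Longrightarrow> g x = 0"
  shows "integrable (lebesgue_on G) (\<lambda>x. f x * g x)"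
proof -
  have "integrable lebesgue (\<lambda>x. indicator G x *\<^sub>R (f x * g x))"
    using assms(1) by (intro integrable_mult_indicator locally_integrable_times_test[OF assms(2-6)]) auto
  then show ?thesis using assms(1) by (simp add: integrable_restrict_space)
qed

lemma is_sym_grad_diff:
  fixes u v :: "'a::euclidean_space \<Rightarrow> real^'d::finite"
  assumes G: "open G" and u: "is_sym_grad e G u E" and v: "is_sym_grad e G v F"
  shows "is_sym_grad e G (\<lambda>x. u x - v x) (\<lambda>x. E x - F x)"
  unfolding is_sym_grad_def
proof (intro conjI ballI allI)
  have li: "locally_integrable G u" "locally_integrable G v" "locally_integrable G E" "locally_integrable G F"
    using u v unfolding is_sym_grad_def by blast+
  then show "locally_integrable G (\<lambda>x. u x - v x)" "locally_integrable G (\<lambda>x. E x - F x)"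
    by (auto intro: locally_integrable_diff)
  fix \<phi> :: "'a \<Rightarrow> real" and i j assume \<phi>: "\<phi> \<in> C0inf G"
  obtain K where K0: "compact K" "K \<subseteq> G" "\<forall>x. x \<notin> K \<longrightarrow> \<phi> x = 0 \<and> (\<forall>v. frechet_derivative \<phi> (at x) v = 0)"
    using C0inf_support[OF \<phi>] by blast
  have K: "compact K" "K \<subseteq> G" "\<And>x. x \<notin> K \<Longrightarrow> \<phi> x = 0"
    "\<And>x v. x \<notin> K \<Longrightarrow> frechet_derivative \<phi> (at x) v = 0" "\<And>x. \<phi> differentiable (at x)"
    "continuous_on UNIV \<phi>" "\<And>v. continuous_on UNIV (\<lambda>x. frechet_derivative \<phi> (at x) v)"
    using K0 C0inf_smooth[OF \<phi>] by simp_all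
  note I1 = lebesgue_on_test_integrable[OF G _ K(6) K(1-3)]
  note I2 = lebesgue_on_test_integrable[OF G _ K(7) K(1,2,4)]
  note li' = locally_integrable_component[OF li(1)] locally_integrable_component[OF li(2)]
     locally_integrable_component2[OF li(3)] locally_integrable_component2[OF li(4)]
  have m1: "(LINT x|lebesgue_on G. (E x - F x) $ i $ j * \<phi> x) =
     (LINT x|lebesgue_on G. E x $ i $ j * \<phi> x) - (LINT x|lebesgue_on G. F x $ i $ j * \<phi> x)"
    by (simp add: left_diff_distrib I1 li')
  have m2: "distr_deriv G w (\<lambda>x. (u x - v x) $ l) \<phi> =
      distr_deriv G w (\<lambda>x. u x $ l) \<phi> - distr_deriv G w (\<lambda>x. v x $ l) \<phi>" for w l
    unfolding distr_deriv_def by (simp add: left_diff_distrib I2 li')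
  have eE: "(LINT x|lebesgue_on G. E x $ i $ j * \<phi> x) =
        1 / 2 * (distr_deriv G (e j) (\<lambda>x. u x $ i) \<phi> + distr_deriv G (e i) (\<lambda>x. u x $ j) \<phi>)"
    and eF: "(LINT x|lebesgue_on G. F x $ i $ j * \<phi> x) =
        1 / 2 * (distr_deriv G (e j) (\<lambda>x. v x $ i) \<phi> + distr_deriv G (e i) (\<lambda>x. v x $ j) \<phi>)"
    using u v \<phi> unfolding is_sym_grad_def by blast+
  show "(LINT x|lebesgue_on G. (E x - F x) $ i $ j * \<phi> x) = 1 / 2 *
     (distr_deriv G (e j) (\<lambda>x. (u x - v x) $ i) \<phi> + distr_deriv G (e i) (\<lambda>x. (u x - v x) $ j) \<phi>)"
    unfolding m1 m2 eE eF by (simp add: field_simps)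
qed

lemma AE_matrix_eqI:
  fixes E F :: "'a \<Rightarrow> real^'n::finite^'m::finite"
  assumes "\<And>i j. AE x in M. E x $ i $ j = F x $ i $ j"
  shows "AE x in M. E x = F x"
proof -
  have "AE x in M. \<forall>i j. E x $ i $ j = F x $ i $ j"
    using assms by (simp add: AE_all_countable)
  then show ?thesis by eventually_elim (simp add: vec_eq_iff)
qed

text \<open>Uniqueness justifies the choice made in the definition of \<open>sym_grad\<close>: whatever holds almost
everywhere for one representative, such as membership in a space with variable exponent, holds for the
chosen one.\<close>

lemma sym_grad_unique:
  fixes u :: "'a::euclidean_space \<Rightarrow> real^'d::finite"
  assumes G: "open G" and E: "is_sym_grad e G u E" and F: "is_sym_grad e G u F"
  shows "AE x in lebesgue_on G. E x = F x"
proof (rule AE_matrix_eqI)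
  fix i j
  have D: "is_sym_grad e G (\<lambda>x. u x - u x) (\<lambda>x. E x - F x)"
    using is_sym_grad_diff[OF assms] .
  have "AE x in lebesgue_on G. (E x - F x) $ i $ j = 0"
  proof (rule AE_zero_of_box_bumps[OF G])
    show "locally_integrable G (\<lambda>x. (E x - F x) $ i $ j)"
      using D by (intro locally_integrable_component2) (simp add: is_sym_grad_def)
    fix a b n assume "cbox a b \<subseteq> G"
    then have "box_bump n a b \<in> C0inf G" by (rule box_bump_C0inf)
    with D show "(LINT x|lebesgue_on G. (E x - F x) $ i $ j * box_bump n a b x) = 0"
      unfolding is_sym_grad_def distr_deriv_def by simp
  qed
  then show "AE x in lebesgue_on G. E x $ i $ j = F x $ i $ j" by eventually_elim simp
qed

lemma frechet_derivative_component:
  assumes "\<phi> differentiable (at x)"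
  shows "frechet_derivative (\<lambda>x. \<phi> x $ i) (at x) v = frechet_derivative \<phi> (at x) v $ i"
    and "(\<lambda>x. \<phi> x $ i) differentiable (at x)"
proof -
  have D: "((\<lambda>x. \<phi> x $ i) has_derivative (\<lambda>h. frechet_derivative \<phi> (at x) h $ i)) (at x)"
    using bounded_linear.has_derivative[OF bounded_linear_vec_nth assms[unfolded frechet_derivative_works]] .
  then show "(\<lambda>x. \<phi> x $ i) differentiable (at x)"
     "frechet_derivative (\<lambda>x. \<phi> x $ i) (at x) v = frechet_derivative \<phi> (at x) v $ i"
    using fun_cong[OF frechet_derivative_at[OF D], of v] by (auto simp: differentiable_def)
qed

lemma sym_deriv_continuous:
  fixes \<phi> :: "real^'d \<Rightarrow> real^'d::finite"
  assumes "Ck (Suc 0) \<phi>"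
  shows "continuous_on UNIV (sym_deriv \<phi>)"
proof -
  have c: "continuous_on UNIV (\<lambda>x. frechet_derivative \<phi> (at x) v $ i)" for v i
    by (rule continuous_on_component) (rule Ck_Suc_direction_continuous[OF assms])
  have "continuous_on UNIV (\<lambda>x. (frechet_derivative \<phi> (at x) (axis j 1) $ i + frechet_derivative \<phi> (at x) (axis i 1) $ j) / 2)" for i j
    by (rule continuous_on_divide, rule continuous_on_add, rule c, rule c, rule continuous_on_const, simp)
  then have "continuous_on UNIV (\<lambda>x. \<chi> i j. (frechet_derivative \<phi> (at x) (axis j 1) $ i + frechet_derivative \<phi> (at x) (axis i 1) $ j) / 2)"
    by (intro continuous_on_vec_lambda)
  then show ?thesis
    unfolding sym_deriv_def[abs_def] .
qed

text \<open>Integration by parts against a test function that vanishes near the boundary of \<open>G\<close>.\<close>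

lemma is_sym_grad_smooth:
  fixes \<phi> :: "real^'d \<Rightarrow> real^'d::finite"
  assumes G: "open G" and \<phi>: "Ck (Suc 0) \<phi>"
  shows "is_sym_grad space_dir G \<phi> (sym_deriv \<phi>)"
  unfolding is_sym_grad_def
proof (intro conjI ballI allI)
  have d: "\<phi> differentiable (at x)" for x using \<phi> by simp
  note cD = Ck_Suc_direction_continuous[OF \<phi>]
  show "locally_integrable G \<phi>" "locally_integrable G (sym_deriv \<phi>)"
    by (intro locally_integrable_continuous Ck_continuous[OF \<phi>] sym_deriv_continuous[OF \<phi>])+
  fix \<psi> :: "real^'d \<Rightarrow> real" and i j assume \<psi>: "\<psi> \<in> C0inf G"
  obtain K where K0: "compact K" "K \<subseteq> G" "\<forall>x. x \<notin> K \<longrightarrow> \<psi> x = 0 \<and> (\<forall>v. frechet_derivative \<psi> (at x) v = 0)"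
    using C0inf_support[OF \<psi>] by blast
  have K: "compact K" "K \<subseteq> G" "\<And>x. x \<notin> K \<Longrightarrow> \<psi> x = 0"
    "\<And>x v. x \<notin> K \<Longrightarrow> frechet_derivative \<psi> (at x) v = 0" "\<And>x. \<psi> differentiable (at x)"
    "continuous_on UNIV \<psi>" "\<And>v. continuous_on UNIV (\<lambda>x. frechet_derivative \<psi> (at x) v)"
    using K0 C0inf_smooth[OF \<psi>] by simp_all
  note I1 = lebesgue_on_test_integrable[OF G locally_integrable_continuous K(6) K(1-3)]
  note I2 = lebesgue_on_test_integrable[OF G locally_integrable_continuous K(7) K(1,2,4)]
  have c\<phi>: "continuous_on UNIV (\<lambda>x. \<phi> x $ i)" for i
    using Ck_continuous[OF \<phi>] by (intro continuous_on_component)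
  have cd: "continuous_on UNIV (\<lambda>x. frechet_derivative \<phi> (at x) v $ i)" for v i
    by (intro continuous_on_component cD)
  have parts: "distr_deriv G v (\<lambda>x. \<phi> x $ l) \<psi> = (LINT x|lebesgue_on G. frechet_derivative \<phi> (at x) v $ l * \<psi> x)" for v l
  proof -
    have eq: "frechet_derivative (\<lambda>x. \<phi> x $ l * \<psi> x) (at x) v =
      \<phi> x $ l * frechet_derivative \<psi> (at x) v + frechet_derivative \<phi> (at x) v $ l * \<psi> x" for x
      using frechet_derivative_mult_real[OF frechet_derivative_component(2)[OF d] K(5)]
      by (simp add: frechet_derivative_component(1)[OF d])
    have "(LINT x|lebesgue. frechet_derivative (\<lambda>x. \<phi> x $ l * \<psi> x) (at x) v) = 0"
    proof (rule integral_derivative_compact_support[OF _ _ K(1)])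
      show "(\<lambda>x. \<phi> x $ l * \<psi> x) differentiable (at x)" for x
        using frechet_derivative_component(2)[OF d] K(5) by (rule differentiable_mult)
      show "continuous_on UNIV (\<lambda>x. frechet_derivative (\<lambda>x. \<phi> x $ l * \<psi> x) (at x) v)"
        unfolding eq by (intro continuous_on_add continuous_on_mult c\<phi> cd K)
    qed (use K eq in auto)
    also have "(LINT x|lebesgue. frechet_derivative (\<lambda>x. \<phi> x $ l * \<psi> x) (at x) v) =
       (LINT x|lebesgue. indicator G x *\<^sub>R (\<phi> x $ l * frechet_derivative \<psi> (at x) v + frechet_derivative \<phi> (at x) v $ l * \<psi> x))"
    proof (rule Bochner_Integration.integral_cong[OF refl])
      fix x
      show "frechet_derivative (\<lambda>x. \<phi> x $ l * \<psi> x) (at x) v =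
         indicator G x *\<^sub>R (\<phi> x $ l * frechet_derivative \<psi> (at x) v + frechet_derivative \<phi> (at x) v $ l * \<psi> x)"
      proof (cases "x \<in> G")
        case False
        then have "x \<notin> K" using K(2) by auto
        then show ?thesis using False K(3,4) by (simp add: eq)
      qed (simp add: eq)
    qed
    also have "\<dots> = (LINT x|lebesgue_on G. \<phi> x $ l * frechet_derivative \<psi> (at x) v + frechet_derivative \<phi> (at x) v $ l * \<psi> x)"
      using G by (subst integral_restrict_space) auto
    also have "\<dots> = (LINT x|lebesgue_on G. \<phi> x $ l * frechet_derivative \<psi> (at x) v) +
        (LINT x|lebesgue_on G. frechet_derivative \<phi> (at x) v $ l * \<psi> x)"
      by (intro Bochner_Integration.integral_add I1 I2 c\<phi> cd)
    finally show ?thesis by (simp add: distr_deriv_def)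
  qed
  have "(LINT x|lebesgue_on G. sym_deriv \<phi> x $ i $ j * \<psi> x) =
     (LINT x|lebesgue_on G. 1 / 2 * (frechet_derivative \<phi> (at x) (axis j 1) $ i * \<psi> x + frechet_derivative \<phi> (at x) (axis i 1) $ j * \<psi> x))"
    by (intro Bochner_Integration.integral_cong) (auto simp: sym_deriv_def field_simps)
  also have "\<dots> = 1 / 2 * ((LINT x|lebesgue_on G. frechet_derivative \<phi> (at x) (axis j 1) $ i * \<psi> x) +
     (LINT x|lebesgue_on G. frechet_derivative \<phi> (at x) (axis i 1) $ j * \<psi> x))"
    using I1[OF cd] by simp
  finally show "(LINT x|lebesgue_on G. sym_deriv \<phi> x $ i $ j * \<psi> x) =
     1 / 2 * (distr_deriv G (space_dir j) (\<lambda>x. \<phi> x $ i) \<psi> + distr_deriv G (space_dir i) (\<lambda>x. \<phi> x $ j) \<psi>)"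
    by (simp add: parts space_dir_def)
qed

section \<open>Modulars and Luxemburg norms\<close>

lemma modular_scale_mono:
  assumes "0 < l" "l \<le> l'" "\<And>x. x \<in> G \<Longrightarrow> q x \<ge> 0" and G: "G \<in> sets lebesgue"
  shows "modular G q (\<lambda>x. (1 / l') *\<^sub>R E x) \<le> modular G q (\<lambda>x. (1 / l) *\<^sub>R E x)"
  unfolding modular_def
proof (rule nn_integral_mono)
  fix x assume "x \<in> space (lebesgue_on G)"
  then have "x \<in> G" by simp
  moreover have "norm ((1 / l') *\<^sub>R E x) \<le> norm ((1 / l) *\<^sub>R E x)"
    using assms by (simp add: frac_le)
  ultimately show "ennreal (norm ((1 / l') *\<^sub>R E x) powr q x) \<le> ennreal (norm ((1 / l) *\<^sub>R E x) powr q x)"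
    using assms by (intro ennreal_leI powr_mono2) auto
qed

lemma modular_scale_le:
  assumes l: "l \<ge> 1" and q: "\<And>x. x \<in> G \<Longrightarrow> q x \<ge> 1"
    and [measurable]: "q \<in> borel_measurable (lebesgue_on G)" "E \<in> borel_measurable (lebesgue_on G)"
  shows "modular G q (\<lambda>x. (1 / l) *\<^sub>R E x) \<le> ennreal (1 / l) * modular G q E"
proof -
  have "modular G q (\<lambda>x. (1 / l) *\<^sub>R E x) \<le> (\<integral>\<^sup>+x. ennreal (1 / l) * ennreal (norm (E x) powr q x) \<partial>lebesgue_on G)"
    unfolding modular_def
  proof (rule nn_integral_mono)
    fix x assume "x \<in> space (lebesgue_on G)"
    then have "q x \<ge> 1" using q by simp
    then have "(1 / l) powr q x \<le> (1 / l) powr 1"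
      using l by (intro powr_mono') auto
    then have "(1 / l) powr q x * norm (E x) powr q x \<le> 1 / l * norm (E x) powr q x"
      using l by (intro mult_right_mono) auto
    then show "ennreal (norm ((1 / l) *\<^sub>R E x) powr q x) \<le> ennreal (1 / l) * ennreal (norm (E x) powr q x)"
      using l by (simp add: powr_mult ennreal_leI flip: ennreal_mult' powr_mult)
  qed
  also have "\<dots> = ennreal (1 / l) * modular G q E"
    unfolding modular_def by (rule nn_integral_cmult) measurable
  finally show ?thesis .
qed

text \<open>Without this the infimum in the Luxemburg norm could range over the empty set and would carry no
information.\<close>

lemma Lp_var_modular_unit_scale:
  assumes E: "E \<in> Lp_var G q" and q: "\<And>x. x \<in> G \<Longrightarrow> q x \<ge> 1"
    and qm: "q \<in> borel_measurable (lebesgue_on G)"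
  shows "{l. l > 0 \<and> modular G q (\<lambda>x. (1 / l) *\<^sub>R E x) \<le> 1} \<noteq> {}"
proof -
  obtain m where m: "m \<ge> 0" "modular G q E = ennreal m"
    using E by (cases "modular G q E") (auto simp: Lp_var_def)
  have "modular G q (\<lambda>x. (1 / (1 + m)) *\<^sub>R E x) \<le> ennreal (1 / (1 + m)) * ennreal m"
    using modular_scale_le[of "1 + m" G q E] m E q qm by (auto simp: Lp_var_def)
  also have "\<dots> \<le> 1"
    using m by (simp add: ennreal_mult[symmetric] ennreal_le_1)
  finally show ?thesis using m by (intro ex_in_conv[THEN iffD1] exI[of _ "1 + m"]) auto
qed

lemma Lp_var_norm_nonneg:
  assumes "E \<in> Lp_var G q" "\<And>x. x \<in> G \<Longrightarrow> q x \<ge> 1" "q \<in> borel_measurable (lebesgue_on G)"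
  shows "Lp_var_norm G q E \<ge> 0"
  unfolding Lp_var_norm_def using Lp_var_modular_unit_scale[OF assms] by (intro cInf_greatest) auto

lemma modular_le_1_of_norm_less:
  assumes "E \<in> Lp_var G q" "\<And>x. x \<in> G \<Longrightarrow> q x \<ge> 1" "q \<in> borel_measurable (lebesgue_on G)"
    and "Lp_var_norm G q E < N" and G: "G \<in> sets lebesgue"
  shows "modular G q (\<lambda>x. (1 / N) *\<^sub>R E x) \<le> 1"
proof -
  obtain l where l: "l > 0" "modular G q (\<lambda>x. (1 / l) *\<^sub>R E x) \<le> 1" "l < N"
    using cInf_lessD[OF Lp_var_modular_unit_scale[OF assms(1-3)] assms(4)[unfolded Lp_var_norm_def]] by auto
  have "modular G q (\<lambda>x. (1 / N) *\<^sub>R E x) \<le> modular G q (\<lambda>x. (1 / l) *\<^sub>R E x)"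
    using l assms(2) G by (intro modular_scale_mono) (auto intro: order_trans[of 0 1])
  then show ?thesis using l by auto
qed

lemma modular_cong_AE:
  assumes "AE x in lebesgue_on G. E x = F x"
  shows "modular G q E = modular G q F"
  unfolding modular_def using assms by (intro nn_integral_cong_AE) auto

lemma Lp_var_cong_AE:
  assumes E: "E \<in> Lp_var G q" and ae: "AE x in lebesgue_on G. E x = F x" and G: "G \<in> sets lebesgue"
  shows "F \<in> Lp_var G q"
proof -
  have "(\<lambda>x. if x \<in> G then E x else 0) \<in> borel_measurable lebesgue"
    using E G by (intro borel_measurable_if_I) (auto simp: Lp_var_def)
  moreover have "AE x in lebesgue. (if x \<in> G then E x else 0) = (if x \<in> G then F x else 0)"
    using ae G by (subst (asm) AE_restrict_space_iff) (auto elim!: eventually_mono)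
  ultimately have "(\<lambda>x. if x \<in> G then F x else 0) \<in> borel_measurable lebesgue"
    by (rule borel_measurable_AE)
  then have "F \<in> borel_measurable (lebesgue_on G)"
    by (rule borel_measurable_if_D)
  then show ?thesis using E modular_cong_AE[OF ae] by (simp add: Lp_var_def)
qed

text \<open>Since \<open>y \<le> 1 + y powr q\<close> for \<open>q \<ge> 1\<close>, smallness of the Luxemburg norm forces smallness of the
\<open>L\<^sup>1\<close> norm.  Applied with \<open>q = 2\<close> as well.\<close>

lemma L1_le_of_scaled_modular:
  fixes g :: "'a::euclidean_space \<Rightarrow> 'b::euclidean_space"
  assumes [measurable]: "g \<in> borel_measurable (lebesgue_on G)" "q \<in> borel_measurable (lebesgue_on G)"
    and q: "\<And>x. x \<in> G \<Longrightarrow> q x \<ge> 1" and l: "l > 0"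
    and mod: "modular G q (\<lambda>x. (1 / l) *\<^sub>R g x) \<le> 1"
    and V: "V \<ge> 0" "emeasure lebesgue G \<le> ennreal V" and G: "G \<in> sets lebesgue"
  shows "(\<integral>\<^sup>+x. ennreal (norm (g x)) \<partial>lebesgue_on G) \<le> ennreal (l * (V + 1))"
proof -
  have "(\<integral>\<^sup>+x. ennreal (norm (g x)) \<partial>lebesgue_on G)
     \<le> (\<integral>\<^sup>+x. ennreal l * (1 + ennreal (norm ((1 / l) *\<^sub>R g x) powr q x)) \<partial>lebesgue_on G)"
  proof (rule nn_integral_mono)
    fix x assume "x \<in> space (lebesgue_on G)"
    then have qx: "q x \<ge> 1" using q by simp
    let ?y = "norm ((1 / l) *\<^sub>R g x)"
    have "?y \<le> 1 + ?y powr q x"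
    proof (cases "?y \<le> 1")
      case False
      then have "?y powr 1 \<le> ?y powr q x" using qx by (intro powr_mono) auto
      then show ?thesis using False by simp
    qed (simp add: add_increasing2)
    then have "l * ?y \<le> l * (1 + ?y powr q x)" using l by (intro mult_left_mono) auto
    moreover have "l * ?y = norm (g x)" using l by simp
    ultimately have "ennreal (norm (g x)) \<le> ennreal (l * (1 + ?y powr q x))"
      by (intro ennreal_leI) simp
    also have "\<dots> = ennreal l * (1 + ennreal (?y powr q x))"
      using l by (subst ennreal_mult) (auto simp: ennreal_plus)
    finally show "ennreal (norm (g x)) \<le> ennreal l * (1 + ennreal (?y powr q x))" .
  qed
  also have "\<dots> = ennreal l * (\<integral>\<^sup>+x. 1 + ennreal (norm ((1 / l) *\<^sub>R g x) powr q x) \<partial>lebesgue_on G)"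
    by (rule nn_integral_cmult) measurable
  also have "(\<integral>\<^sup>+x. 1 + ennreal (norm ((1 / l) *\<^sub>R g x) powr q x) \<partial>lebesgue_on G) =
     emeasure (lebesgue_on G) (space (lebesgue_on G)) + modular G q (\<lambda>x. (1 / l) *\<^sub>R g x)"
    unfolding modular_def by (subst nn_integral_add) auto
  also have "\<dots> \<le> ennreal V + 1"
    using mod V G by (intro add_mono) (auto simp: emeasure_restrict_space)
  finally show ?thesis
    using l V by (simp add: ennreal_mult mult_left_mono)
qed

text \<open>Convolution with an integrable kernel is bounded on \<open>L\<^sup>1\<close>, in the form needed for Lebesgue measurable
functions; a Borel representative of \<open>h\<close> makes Tonelli's theorem applicable.\<close>

lemma kernel_convolution:
  fixes k :: "'a::euclidean_space \<Rightarrow> real" and h :: "'a \<Rightarrow> ennreal"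
  assumes [measurable]: "k \<in> borel_measurable borel" and h: "h \<in> borel_measurable (lebesgue_on G)"
    and G: "G \<in> sets lebesgue"
  shows "(\<lambda>x. \<integral>\<^sup>+y. h y * ennreal (k (x - y)) \<partial>lebesgue_on G) \<in> borel_measurable borel"
    and "(\<integral>\<^sup>+x. (\<integral>\<^sup>+y. h y * ennreal (k (x - y)) \<partial>lebesgue_on G) \<partial>lborel) =
       (\<integral>\<^sup>+z. ennreal (k z) \<partial>lborel) * (\<integral>\<^sup>+y. h y \<partial>lebesgue_on G)"
proof -
  have "(\<lambda>y. h y * indicator G y) \<in> borel_measurable lebesgue"
    using h G by (subst (asm) borel_measurable_restrict_space_iff_ennreal) auto
  then obtain h' where [measurable]: "h' \<in> borel_measurable lborel" and ae: "AE y in lborel. h y * indicator G y = h' y"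
    using completion_ex_borel_measurable by blast
  have eq: "(\<integral>\<^sup>+y. h y * g y \<partial>lebesgue_on G) = (\<integral>\<^sup>+y. h' y * g y \<partial>lborel)" for g
  proof -
    have "(\<integral>\<^sup>+y. h y * g y \<partial>lebesgue_on G) = (\<integral>\<^sup>+y. h y * g y * indicator G y \<partial>lebesgue)"
      using G by (subst nn_integral_restrict_space) auto
    also have "\<dots> = (\<integral>\<^sup>+y. h y * g y * indicator G y \<partial>lborel)"
      by (rule nn_integral_completion)
    also have "\<dots> = (\<integral>\<^sup>+y. h' y * g y \<partial>lborel)"
    proof (rule nn_integral_cong_AE)
      show "AE y in lborel. h y * g y * indicator G y = h' y * g y"
        using ae by eventually_elim (simp add: mult_ac flip: mult.assoc)
    qed
    finally show ?thesis .
  qed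
  show "(\<lambda>x. \<integral>\<^sup>+y. h y * ennreal (k (x - y)) \<partial>lebesgue_on G) \<in> borel_measurable borel"
    unfolding eq by measurable
  have "(\<integral>\<^sup>+x. (\<integral>\<^sup>+y. h' y * ennreal (k (x - y)) \<partial>lborel) \<partial>lborel) = (\<integral>\<^sup>+y. (\<integral>\<^sup>+x. h' y * ennreal (k (x - y)) \<partial>lborel) \<partial>lborel)"
    by (rule lborel_pair.Fubini') measurable
  also have "\<dots> = (\<integral>\<^sup>+y. h' y * (\<integral>\<^sup>+z. ennreal (k z) \<partial>lborel) \<partial>lborel)"
  proof (rule nn_integral_cong)
    fix y
    have "(\<integral>\<^sup>+x. h' y * ennreal (k (x - y)) \<partial>lborel) = h' y * (\<integral>\<^sup>+x. ennreal (k (- y + x)) \<partial>lborel)"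
      by (subst nn_integral_cmult) (auto simp: add.commute)
    also have "(\<integral>\<^sup>+x. ennreal (k (- y + x)) \<partial>lborel) = (\<integral>\<^sup>+z. ennreal (k z) \<partial>lborel)"
      by (rule nn_integral_lborel_translate) measurable
    finally show "(\<integral>\<^sup>+x. h' y * ennreal (k (x - y)) \<partial>lborel) = h' y * (\<integral>\<^sup>+z. ennreal (k z) \<partial>lborel)" .
  qed
  also have "\<dots> = (\<integral>\<^sup>+z. ennreal (k z) \<partial>lborel) * (\<integral>\<^sup>+y. h' y \<partial>lborel)"
    by (subst nn_integral_multc) (auto simp: mult.commute)
  finally show "(\<integral>\<^sup>+x. (\<integral>\<^sup>+y. h y * ennreal (k (x - y)) \<partial>lebesgue_on G) \<partial>lborel) =
       (\<integral>\<^sup>+z. ennreal (k z) \<partial>lborel) * (\<integral>\<^sup>+y. h y \<partial>lebesgue_on G)"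
    using eq[of "\<lambda>_. 1"] by (simp add: eq)
qed

lemma nn_integral_lebesgue_on_outside:
  assumes "G \<in> sets lebesgue" "\<And>x. x \<notin> G \<Longrightarrow> g x = 0"
  shows "(\<integral>\<^sup>+x. g x \<partial>lebesgue_on G) = (\<integral>\<^sup>+x. g x \<partial>lborel)"
proof -
  have "(\<integral>\<^sup>+x. g x \<partial>lebesgue_on G) = (\<integral>\<^sup>+x. g x * indicator G x \<partial>lebesgue)"
    using assms(1) by (subst nn_integral_restrict_space) auto
  also have "\<dots> = (\<integral>\<^sup>+x. g x \<partial>lebesgue)"
    using assms(2) by (intro nn_integral_cong) (auto simp: indicator_def)
  also have "\<dots> = (\<integral>\<^sup>+x. g x \<partial>lborel)" by (rule nn_integral_completion)
  finally show ?thesis .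
qed

lemma modular_2_le_1_of_L2_norm_less:
  assumes g: "g \<in> L2 G" and l: "L2_norm G g < l"
  shows "modular G (\<lambda>_. 2) (\<lambda>x. (1 / l) *\<^sub>R g x) \<le> 1"
proof -
  have "0 \<le> L2_norm G g" unfolding L2_norm_def by (intro real_sqrt_ge_zero integral_nonneg) auto
  then have l0: "l > 0" using l by linarith
  have int: "integrable (lebesgue_on G) (\<lambda>x. (norm (g x))\<^sup>2)" using g by (simp add: L2_def)
  have "(LINT x|lebesgue_on G. (norm (g x))\<^sup>2) = (L2_norm G g)\<^sup>2"
    unfolding L2_norm_def by (subst real_sqrt_pow2) (auto intro: integral_nonneg)
  also have "\<dots> \<le> l\<^sup>2" using l \<open>0 \<le> L2_norm G g\<close> by (intro power_mono) auto
  finally have le: "(LINT x|lebesgue_on G. (norm (g x))\<^sup>2) \<le> l\<^sup>2" .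
  have "modular G (\<lambda>_. 2) (\<lambda>x. (1 / l) *\<^sub>R g x) = (\<integral>\<^sup>+x. ennreal ((norm (g x))\<^sup>2 / l\<^sup>2) \<partial>lebesgue_on G)"
    unfolding modular_def using l0 by (intro nn_integral_cong) (simp add: power_divide)
  also have "\<dots> = ennreal (LINT x|lebesgue_on G. (norm (g x))\<^sup>2 / l\<^sup>2)"
    using int by (intro nn_integral_eq_integral) auto
  also have "\<dots> \<le> ennreal 1"
    using le l0 by (intro ennreal_leI) simp
  finally show ?thesis by simp
qed

lemma continuous_bounded_on_bounded:
  fixes g :: "'a::euclidean_space \<Rightarrow> 'b::real_normed_vector"
  assumes "continuous_on UNIV g" "bounded G"
  shows "\<exists>M\<ge>1. \<forall>x\<in>G. norm (g x) \<le> M"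
proof -
  have "bounded (g ` closure G)"
    using assms by (intro compact_imp_bounded compact_continuous_image) (auto intro: continuous_on_subset)
  then obtain M where "\<And>x. x \<in> closure G \<Longrightarrow> norm (g x) \<le> M" unfolding bounded_iff by auto
  then have "\<forall>x\<in>G. norm (g x) \<le> max 1 M" using closure_subset[of G] by fastforce
  then show ?thesis by (intro exI[of _ "max 1 M"]) auto
qed

text \<open>The upper bound \<open>Q\<close> of the exponent is needed for the quasi-triangle inequality
\<open>(a + b)^q \<le> 2^Q (a^q + b^q)\<close>.\<close>

lemma Lp_var_diff_bounded:
  assumes E: "E \<in> Lp_var G q" and S: "S \<in> borel_measurable (lebesgue_on G)"
    and M: "M \<ge> 1" "\<And>x. x \<in> G \<Longrightarrow> norm (S x) \<le> M"
    and q: "\<And>x. x \<in> G \<Longrightarrow> 1 \<le> q x \<and> q x \<le> Q" "q \<in> borel_measurable (lebesgue_on G)"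
    and G: "G \<in> lmeasurable"
  shows "(\<lambda>x. E x - S x) \<in> Lp_var G q"
proof -
  have [measurable]: "E \<in> borel_measurable (lebesgue_on G)" using E by (simp add: Lp_var_def)
  note [measurable] = S q(2)
  have "modular G q (\<lambda>x. E x - S x) \<le> (\<integral>\<^sup>+x. ennreal (2 powr Q) * (ennreal (norm (E x) powr q x) + ennreal (M powr Q)) \<partial>lebesgue_on G)"
    unfolding modular_def
  proof (rule nn_integral_mono)
    fix x assume "x \<in> space (lebesgue_on G)"
    then have x: "x \<in> G" by simp
    have qx: "1 \<le> q x" "q x \<le> Q" using q x by auto
    have "norm (E x - S x) \<le> norm (E x) + M"
      using norm_triangle_ineq4[of "E x" "S x"] M(2)[OF x] by linarith
    also have "\<dots> \<le> 2 * max (norm (E x)) M" by simp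
    finally have "norm (E x - S x) powr q x \<le> (2 * max (norm (E x)) M) powr q x"
      using qx by (intro powr_mono2) auto
    also have "\<dots> = 2 powr q x * max (norm (E x)) M powr q x"
      by (simp add: powr_mult)
    also have "\<dots> \<le> 2 powr Q * (norm (E x) powr q x + M powr Q)"
    proof (intro mult_mono powr_mono)
      have "M powr q x \<le> M powr Q" using qx M by (intro powr_mono) auto
      then show "max (norm (E x)) M powr q x \<le> norm (E x) powr q x + M powr Q"
        by (auto simp: max_def add_increasing add_increasing2)
    qed (use qx in auto)
    finally have "ennreal (norm (E x - S x) powr q x) \<le> ennreal (2 powr Q * (norm (E x) powr q x + M powr Q))"
      by (rule ennreal_leI)
    also have "\<dots> = ennreal (2 powr Q) * (ennreal (norm (E x) powr q x) + ennreal (M powr Q))"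
      by (subst ennreal_mult) auto
    finally show "ennreal (norm (E x - S x) powr q x) \<le> ennreal (2 powr Q) * (ennreal (norm (E x) powr q x) + ennreal (M powr Q))" .
  qed
  also have "\<dots> = ennreal (2 powr Q) * (\<integral>\<^sup>+x. ennreal (norm (E x) powr q x) + ennreal (M powr Q) \<partial>lebesgue_on G)"
    by (rule nn_integral_cmult) measurable
  also have "(\<integral>\<^sup>+x. ennreal (norm (E x) powr q x) + ennreal (M powr Q) \<partial>lebesgue_on G) =
      modular G q E + ennreal (M powr Q) * emeasure lebesgue G"
    unfolding modular_def using G by (subst nn_integral_add) (auto simp: emeasure_restrict_space)
  also have "ennreal (2 powr Q) * \<dots> < \<infinity>"
    using E G by (auto simp: Lp_var_def ennreal_mult_less_top fmeasurable_def)
  finally show ?thesis by (simp add: Lp_var_def)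
qed

lemma L2_diff_bounded:
  assumes f: "f \<in> L2 G" and S: "S \<in> borel_measurable (lebesgue_on G)"
    and M: "\<And>x. x \<in> G \<Longrightarrow> norm (S x) \<le> M" and G: "G \<in> lmeasurable"
  shows "(\<lambda>x. f x - S x) \<in> L2 G"
proof -
  have [measurable]: "f \<in> borel_measurable (lebesgue_on G)" using f by (simp add: L2_def)
  note [measurable] = S
  have "integrable (lebesgue_on G) (\<lambda>x. (norm (f x - S x))\<^sup>2)"
  proof (rule Bochner_Integration.integrable_bound)
    interpret finite_measure "lebesgue_on G" using G by (rule finite_measure_lebesgue_on)
    show "integrable (lebesgue_on G) (\<lambda>x. 2 * (norm (f x))\<^sup>2 + 2 * M\<^sup>2)"
      using f by (intro Bochner_Integration.integrable_add integrable_mult_right) (auto simp: L2_def)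
    show "AE x in lebesgue_on G. norm ((norm (f x - S x))\<^sup>2) \<le> norm (2 * (norm (f x))\<^sup>2 + 2 * M\<^sup>2)"
    proof (rule AE_I2)
      fix x assume "x \<in> space (lebesgue_on G)"
      then have "norm (S x) \<le> M" using M by simp
      then have "norm (f x - S x) \<le> norm (f x) + M" using norm_triangle_ineq4[of "f x" "S x"] by linarith
      then have "(norm (f x - S x))\<^sup>2 \<le> (norm (f x) + M)\<^sup>2" by (intro power_mono) auto
      also have "\<dots> \<le> 2 * (norm (f x))\<^sup>2 + 2 * M\<^sup>2"
        using zero_le_power2[of "norm (f x) - M"] by (simp add: power2_sum power2_diff)
      finally show "norm ((norm (f x - S x))\<^sup>2) \<le> norm (2 * (norm (f x))\<^sup>2 + 2 * M\<^sup>2)" by simp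
    qed
  qed simp
  then show ?thesis by (simp add: L2_def)
qed

section \<open>The pointwise bound in the energy space of a time slice\<close>

lemma borel_measurable_lebesgue_onI: "f \<in> borel_measurable borel \<Longrightarrow> f \<in> borel_measurable (lebesgue_on G)"
  by (intro measurable_restrict_space1 measurable_completion) simp

lemma is_sym_grad_sym_grad: "is_sym_grad e G u E \<Longrightarrow> is_sym_grad e G u (sym_grad e G u)"
  unfolding sym_grad_def by (rule someI[of "is_sym_grad e G u"])

lemma ennreal_norm_triangle_sub:
  "ennreal (norm v) \<le> ennreal (norm w) + ennreal (norm (w - v))"
  using norm_triangle_sub[of v w] norm_minus_commute[of v w] by (simp add: ennreal_leI flip: ennreal_plus)

text \<open>Approximate \<open>f\<close> by test functions \<open>\<phi>\<close>, whose extensions by zero satisfy \<open>pointwise_bound_sym_deriv\<close>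
on the whole space.  By the triangle inequality the wanted bound holds for \<open>f\<close> up to an error function
built from \<open>f - \<phi>\<close> and \<open>E - \<epsilon>(\<phi>)\<close>, and the \<open>L\<^sup>1\<close> norm of the error function tends to zero.  The
constant depends only on the dimension and on \<open>\<delta>\<close>, which makes the bound uniform in time later.\<close>

lemma slice_pointwise_bound:
  fixes \<delta> :: real
  assumes \<delta>: "\<delta> > 0"
  shows "\<exists>C>0. \<forall>\<Omega> q (f :: real^'d \<Rightarrow> real^'d::finite) E Q. open \<Omega> \<longrightarrow> bounded \<Omega> \<longrightarrow> q \<in> borel_measurable (lebesgue_on \<Omega>) \<longrightarrow>
       (\<forall>x\<in>\<Omega>. 1 \<le> q x \<and> q x \<le> Q) \<longrightarrow> f \<in> X_space \<Omega> q \<longrightarrow> is_sym_grad space_dir \<Omega> f E \<longrightarrow>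
     (AE x in lebesgue_on \<Omega>. ennreal (norm (f x)) \<le> ennreal C *
       ((\<integral>\<^sup>+y. ennreal (norm (E y) * norm (x - y) powr (1 - real CARD('d))) * indicator (ball x \<delta>) y \<partial>lebesgue_on \<Omega>)
        + (\<integral>\<^sup>+y. ennreal (norm (f y)) \<partial>lebesgue_on \<Omega>)))"
proof -
  let ?d = "real CARD('d)"
  obtain C where C: "C > 0"
    "\<forall>(\<phi> :: real^'d \<Rightarrow> real^'d) x. (\<forall>x. \<phi> differentiable (at x)) \<longrightarrow> continuous_on UNIV (sym_deriv \<phi>) \<longrightarrow>
      ennreal (norm (\<phi> x)) \<le> ennreal C *
        ((\<integral>\<^sup>+y. ennreal (norm (sym_deriv \<phi> y) * norm (x - y) powr (1 - ?d)) * indicator (ball x \<delta>) y \<partial>lborel)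
         + (\<integral>\<^sup>+y. ennreal (norm (\<phi> y)) * indicator (ball x \<delta>) y \<partial>lborel))"
    using pointwise_bound_sym_deriv[OF \<delta>, where 'd='d] by auto
  show ?thesis
  proof (intro exI[of _ C] conjI allI impI)
    show "C > 0" by fact
    fix \<Omega> and q :: "real^'d \<Rightarrow> real" and f :: "real^'d \<Rightarrow> real^'d" and E Q
    assume op: "open \<Omega>" and bd: "bounded \<Omega>" and qm: "q \<in> borel_measurable (lebesgue_on \<Omega>)"
      and q': "\<forall>x\<in>\<Omega>. 1 \<le> q x \<and> q x \<le> Q" and f: "f \<in> X_space \<Omega> q"
      and E: "is_sym_grad space_dir \<Omega> f E"
    have \<Omega>l: "\<Omega> \<in> lmeasurable" using op bd lmeasurable_open by blast
    then have \<Omega>s: "\<Omega> \<in> sets lebesgue" by auto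
    obtain V where V: "V \<ge> 0" "emeasure lebesgue \<Omega> = ennreal V"
      using \<Omega>l by (cases "emeasure lebesgue \<Omega>") (auto simp: fmeasurable_def)
    note q = q'[rule_format]
    have q1: "\<And>x. x \<in> \<Omega> \<Longrightarrow> q x \<ge> 1" using q by blast
    define k where "k z = norm z powr (1 - ?d) * indicator (ball 0 \<delta>) (z::real^'d)" for z
    have [measurable]: "k \<in> borel_measurable borel" unfolding k_def by measurable
    have [measurable]: "(\<lambda>y. ennreal (k (x - y))) \<in> borel_measurable (lebesgue_on \<Omega>)" for x
      by (rule borel_measurable_lebesgue_onI) measurable
    have k0: "k z \<ge> 0" for z by (simp add: k_def)
    have kk: "ennreal (a * norm (x - y) powr (1 - ?d)) * indicator (ball x \<delta>) y = ennreal a * ennreal (k (x - y))" if "a \<ge> 0" for a x y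
      using that norm_minus_commute[of x y] by (auto simp: k_def indicator_def dist_norm ennreal_mult)
    obtain \<kappa> where \<kappa>: "\<kappa> \<ge> 0" "(\<integral>\<^sup>+z. ennreal (k z) \<partial>lborel) = ennreal \<kappa>"
    proof -
      have "(\<integral>\<^sup>+z. ennreal (k z) \<partial>lborel) = (\<integral>\<^sup>+z. ennreal (norm z powr (- (?d - 1))) * indicator (ball 0 \<delta>) (z::real^'d) \<partial>lborel)"
        by (intro nn_integral_cong) (simp add: k_def indicator_def)
      also have "\<dots> < \<infinity>"
        by (rule nn_integral_norm_powr_ball_finite[OF _ \<delta>]) simp
      finally show thesis using that by (cases "\<integral>\<^sup>+z. ennreal (k z) \<partial>lborel") auto
    qed
    have fe: "f \<in> sym_energy space_dir \<Omega> q"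
      and approx: "\<forall>\<delta>>0. \<exists>\<phi>\<in>C0inf \<Omega>. sym_energy_norm space_dir \<Omega> q (\<lambda>x. f x - \<phi> x) < \<delta>"
      using f unfolding X_space_def by blast+
    have fL2: "f \<in> L2 \<Omega>" using fe unfolding sym_energy_def by blast
    have fm [measurable]: "f \<in> borel_measurable (lebesgue_on \<Omega>)" using fL2 by (simp add: L2_def)
    have ELp: "E \<in> Lp_var \<Omega> q"
    proof -
      obtain E' where E': "E' \<in> Lp_var \<Omega> q" "is_sym_grad space_dir \<Omega> f E'"
        using fe unfolding sym_energy_def Lp_var_sym_def by blast
      show ?thesis using Lp_var_cong_AE[OF E'(1) sym_grad_unique[OF op E'(2) E] \<Omega>s] .
    qed
    have Em [measurable]: "E \<in> borel_measurable (lebesgue_on \<Omega>)" using ELp by (simp add: Lp_var_def)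
    define T where "T h x = (\<integral>\<^sup>+y. ennreal (norm (h y)) * ennreal (k (x - y)) \<partial>lebesgue_on \<Omega>)" for h :: "real^'d \<Rightarrow> real^'d^'d" and x
    define F where "F = (\<integral>\<^sup>+y. ennreal (norm (f y)) \<partial>lebesgue_on \<Omega>)"
    define R where "R x = ennreal C * (T E x + F)" for x
    have Tm: "T h \<in> borel_measurable borel" if "h \<in> borel_measurable (lebesgue_on \<Omega>)" for h
      unfolding T_def[abs_def] using that by (intro kernel_convolution(1) \<Omega>s) auto
    have TmL: "T h \<in> borel_measurable (lebesgue_on \<Omega>)" if "h \<in> borel_measurable (lebesgue_on \<Omega>)" for h
      using Tm[OF that] by (rule borel_measurable_lebesgue_onI)
    have Rm [measurable]: "R \<in> borel_measurable (lebesgue_on \<Omega>)"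
      unfolding R_def[abs_def] using TmL[OF Em] by measurable
    define Z where "Z = (V + 1) * (1 + C * \<kappa> + C * V)"
    \<comment> \<open>the part of \<open>|f|\<close> that exceeds the wanted bound \<open>R\<close> has arbitrarily small integral\<close>
    have key: "(\<integral>\<^sup>+x. ennreal (norm (f x)) - R x \<partial>lebesgue_on \<Omega>) \<le> ennreal (Z / real (Suc n))" for n
    proof -
      define l where "l = 1 / real (Suc n)"
      have l: "l > 0" by (simp add: l_def)
      obtain \<phi> where \<phi>: "\<phi> \<in> C0inf \<Omega>" "sym_energy_norm space_dir \<Omega> q (\<lambda>x. f x - \<phi> x) < l"
        using approx[rule_format, OF l] by blast
      have ck: "Ck (Suc 0) \<phi>" using \<phi>(1) unfolding C0inf_def by blast
      define S where "S = sym_deriv \<phi>"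
      have cS: "continuous_on UNIV S" unfolding S_def using ck by (rule sym_deriv_continuous)
      have c\<phi>: "continuous_on UNIV \<phi>" using C0inf_smooth[OF \<phi>(1)] by blast
      note contm = borel_measurable_lebesgue_onI[OF borel_measurable_continuous_onI]
      have Sm [measurable]: "S \<in> borel_measurable (lebesgue_on \<Omega>)" and \<phi>m [measurable]: "\<phi> \<in> borel_measurable (lebesgue_on \<Omega>)"
        using cS c\<phi> contm by auto
      obtain K where K: "K \<subseteq> \<Omega>" "\<forall>x. x \<notin> K \<longrightarrow> \<phi> x = 0 \<and> (\<forall>v. frechet_derivative \<phi> (at x) v = 0)"
        using C0inf_support[OF \<phi>(1)] by blast
      have \<phi>out: "\<phi> x = 0" if "x \<notin> \<Omega>" for x using K that by blast
      have Sout: "S x = 0" if "x \<notin> \<Omega>" for x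
      proof -
        have "x \<notin> K" using K(1) that by blast
        then show ?thesis using K(2) by (simp add: S_def sym_deriv_def vec_eq_iff)
      qed
      obtain M1 where M1: "M1 \<ge> 1" "\<forall>x\<in>\<Omega>. norm (S x) \<le> M1" using continuous_bounded_on_bounded[OF cS bd] by blast
      obtain M2 where M2: "M2 \<ge> 1" "\<forall>x\<in>\<Omega>. norm (\<phi> x) \<le> M2" using continuous_bounded_on_bounded[OF c\<phi> bd] by blast
      have ES: "is_sym_grad space_dir \<Omega> (\<lambda>x. f x - \<phi> x) (\<lambda>x. E x - S x)"
        unfolding S_def by (rule is_sym_grad_diff[OF op E is_sym_grad_smooth[OF op ck]])
      define H where "H = sym_grad space_dir \<Omega> (\<lambda>x. f x - \<phi> x)"
      have H: "is_sym_grad space_dir \<Omega> (\<lambda>x. f x - \<phi> x) H"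
        unfolding H_def using ES by (rule is_sym_grad_sym_grad)
      have HE: "AE x in lebesgue_on \<Omega>. H x = E x - S x" by (rule sym_grad_unique[OF op H ES])
      have ESLp: "(\<lambda>x. E x - S x) \<in> Lp_var \<Omega> q"
        using ELp Sm M1(1) M1(2)[rule_format] q qm \<Omega>l by (rule Lp_var_diff_bounded)
      have HLp: "H \<in> Lp_var \<Omega> q"
        using ESLp by (rule Lp_var_cong_AE) (use HE \<Omega>s in \<open>auto elim: eventually_mono\<close>)
      have fL: "(\<lambda>x. f x - \<phi> x) \<in> L2 \<Omega>"
        using fL2 \<phi>m M2(2)[rule_format] \<Omega>l by (rule L2_diff_bounded)
      have "L2_norm \<Omega> (\<lambda>x. f x - \<phi> x) \<ge> 0" unfolding L2_norm_def by (intro real_sqrt_ge_zero integral_nonneg) auto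
      moreover have "Lp_var_norm \<Omega> q H \<ge> 0" by (rule Lp_var_norm_nonneg[OF HLp q1 qm])
      ultimately have n: "L2_norm \<Omega> (\<lambda>x. f x - \<phi> x) < l" "Lp_var_norm \<Omega> q H < l"
        using \<phi>(2) by (auto simp: sym_energy_norm_def H_def)
      have a: "(\<integral>\<^sup>+x. ennreal (norm (f x - \<phi> x)) \<partial>lebesgue_on \<Omega>) \<le> ennreal (l * (V + 1))"
        by (rule L1_le_of_scaled_modular[OF _ _ _ l modular_2_le_1_of_L2_norm_less[OF fL n(1)] V(1) _ \<Omega>s])
           (auto simp: V)
      have "(\<integral>\<^sup>+x. ennreal (norm (H x)) \<partial>lebesgue_on \<Omega>) \<le> ennreal (l * (V + 1))"
        by (rule L1_le_of_scaled_modular[OF _ qm q1 l modular_le_1_of_norm_less[OF HLp q1 qm n(2) \<Omega>s] V(1) _ \<Omega>s])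
           (use HLp in \<open>auto simp: V Lp_var_def\<close>)
      also have "(\<integral>\<^sup>+x. ennreal (norm (H x)) \<partial>lebesgue_on \<Omega>) = (\<integral>\<^sup>+x. ennreal (norm (E x - S x)) \<partial>lebesgue_on \<Omega>)"
        using HE by (intro nn_integral_cong_AE) auto
      finally have b: "(\<integral>\<^sup>+x. ennreal (norm (E x - S x)) \<partial>lebesgue_on \<Omega>) \<le> ennreal (l * (V + 1))" .
      define A where "A = (\<integral>\<^sup>+x. ennreal (norm (f x - \<phi> x)) \<partial>lebesgue_on \<Omega>)"
      \<comment> \<open>the error function; its integral is of the order of \<open>l\<close>\<close>
      define e where "e x = ennreal (norm (f x - \<phi> x)) + ennreal C * (T (\<lambda>y. E y - S y) x + A)" for x
      note tri = ennreal_norm_triangle_sub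
      have pw: "ennreal (norm (f x)) \<le> R x + e x" for x
      proof -
        have "(\<integral>\<^sup>+y. ennreal (norm (S y) * norm (x - y) powr (1 - ?d)) * indicator (ball x \<delta>) y \<partial>lborel) = T S x"
          unfolding T_def using Sout by (subst nn_integral_lebesgue_on_outside[OF \<Omega>s]) (auto simp: kk)
        also have "T S x \<le> (\<integral>\<^sup>+y. ennreal (norm (E y)) * ennreal (k (x - y)) + ennreal (norm (E y - S y)) * ennreal (k (x - y)) \<partial>lebesgue_on \<Omega>)"
          unfolding T_def by (intro nn_integral_mono) (simp add: mult_right_mono tri flip: distrib_right)
        also have "\<dots> = T E x + T (\<lambda>y. E y - S y) x"
          unfolding T_def
          by (rule nn_integral_add) measurable
        finally have 1: "(\<integral>\<^sup>+y. ennreal (norm (S y) * norm (x - y) powr (1 - ?d)) * indicator (ball x \<delta>) y \<partial>lborel)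
           \<le> T E x + T (\<lambda>y. E y - S y) x" .
        have "(\<integral>\<^sup>+y. ennreal (norm (\<phi> y)) * indicator (ball x \<delta>) y \<partial>lborel) \<le> (\<integral>\<^sup>+y. ennreal (norm (\<phi> y)) \<partial>lborel)"
          by (intro nn_integral_mono) (auto simp: indicator_def)
        also have "\<dots> = (\<integral>\<^sup>+y. ennreal (norm (\<phi> y)) \<partial>lebesgue_on \<Omega>)"
          using \<phi>out by (subst nn_integral_lebesgue_on_outside[OF \<Omega>s]) auto
        also have "\<dots> \<le> (\<integral>\<^sup>+y. ennreal (norm (f y)) + ennreal (norm (f y - \<phi> y)) \<partial>lebesgue_on \<Omega>)"
          by (intro nn_integral_mono tri)
        also have "\<dots> = F + A" unfolding F_def A_def by (rule nn_integral_add) measurable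
        finally have 2: "(\<integral>\<^sup>+y. ennreal (norm (\<phi> y)) * indicator (ball x \<delta>) y \<partial>lborel) \<le> F + A" .
        have "ennreal (norm (f x)) \<le> ennreal (norm (f x - \<phi> x)) + ennreal (norm (\<phi> x))"
          using tri[of "f x" "\<phi> x"] norm_minus_commute[of "f x" "\<phi> x"] by (simp add: add.commute)
        also have "ennreal (norm (\<phi> x)) \<le> ennreal C * ((T E x + T (\<lambda>y. E y - S y) x) + (F + A))"
          using C(2)[rule_format, of \<phi> x] C0inf_smooth(1)[OF \<phi>(1)] cS 1 2 unfolding S_def
          by (blast intro: order_trans mult_left_mono add_mono zero_le)
        finally show ?thesis unfolding R_def e_def by (simp add: distrib_left add_ac)
      qed
      have Tesm: "T (\<lambda>y. E y - S y) \<in> borel_measurable (lebesgue_on \<Omega>)" by (rule TmL) measurable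
      have "(\<integral>\<^sup>+x. ennreal (norm (f x)) - R x \<partial>lebesgue_on \<Omega>) \<le> (\<integral>\<^sup>+x. e x \<partial>lebesgue_on \<Omega>)"
        using pw by (intro nn_integral_mono) (simp add: ennreal_minus_le_iff)
      also have "\<dots> = A + (\<integral>\<^sup>+x. ennreal C * (T (\<lambda>y. E y - S y) x + A) \<partial>lebesgue_on \<Omega>)"
        unfolding e_def A_def[symmetric] using Tesm by (subst nn_integral_add) (auto simp: A_def)
      also have "(\<integral>\<^sup>+x. ennreal C * (T (\<lambda>y. E y - S y) x + A) \<partial>lebesgue_on \<Omega>) =
         ennreal C * ((\<integral>\<^sup>+x. T (\<lambda>y. E y - S y) x \<partial>lebesgue_on \<Omega>) + A * ennreal V)"
        using Tesm \<Omega>s by (subst nn_integral_cmult) (auto simp: nn_integral_add emeasure_restrict_space V)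
      also have "(\<integral>\<^sup>+x. T (\<lambda>y. E y - S y) x \<partial>lebesgue_on \<Omega>) \<le> (\<integral>\<^sup>+x. T (\<lambda>y. E y - S y) x \<partial>lborel)"
        using \<Omega>s by (subst nn_integral_restrict_space) (auto simp: nn_integral_completion indicator_def intro!: nn_integral_mono)
      also have "\<dots> = ennreal \<kappa> * (\<integral>\<^sup>+x. ennreal (norm (E x - S x)) \<partial>lebesgue_on \<Omega>)"
        unfolding T_def \<kappa>(2)[symmetric] by (rule kernel_convolution(2)) (use \<Omega>s in auto)
      also have "A + ennreal C * (ennreal \<kappa> * (\<integral>\<^sup>+x. ennreal (norm (E x - S x)) \<partial>lebesgue_on \<Omega>) + A * ennreal V)
         \<le> ennreal (l * (V + 1)) + ennreal C * (ennreal \<kappa> * ennreal (l * (V + 1)) + ennreal (l * (V + 1)) * ennreal V)"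
        using a b unfolding A_def by (intro add_mono mult_mono) auto
      also have "\<dots> = ennreal (l * (V + 1) + C * (\<kappa> * (l * (V + 1)) + l * (V + 1) * V))"
        using l V(1) C(1) \<kappa>(1) by (simp add: ennreal_mult ennreal_plus del: ennreal_plus_if)
      also have "l * (V + 1) + C * (\<kappa> * (l * (V + 1)) + l * (V + 1) * V) = l * Z"
        unfolding Z_def by (simp add: algebra_simps)
      also have "l * Z = Z / real (Suc n)" by (simp add: l_def)
      finally show ?thesis by (simp add: add_mono mult_left_mono)
    qed
    have "(\<integral>\<^sup>+x. ennreal (norm (f x)) - R x \<partial>lebesgue_on \<Omega>) \<le> ennreal 0"
    proof (rule LIMSEQ_le_const)
      have "(\<lambda>n. Z * (1 / real (Suc n))) \<longlonglongrightarrow> Z * 0"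
        by (intro tendsto_mult tendsto_const LIMSEQ_Suc lim_1_over_n)
      then show "(\<lambda>n. ennreal (Z / real (Suc n))) \<longlonglongrightarrow> ennreal 0"
        by (intro tendsto_ennrealI) simp
    qed (use key in blast)
    then have "AE x in lebesgue_on \<Omega>. ennreal (norm (f x)) - R x = 0"
      by (subst (asm) le_zero_eq[symmetric, THEN sym] ennreal_0, subst nn_integral_0_iff_AE[symmetric]) auto
    then show "AE x in lebesgue_on \<Omega>. ennreal (norm (f x)) \<le> ennreal C *
       ((\<integral>\<^sup>+y. ennreal (norm (E y) * norm (x - y) powr (1 - real CARD('d))) * indicator (ball x \<delta>) y \<partial>lebesgue_on \<Omega>)
        + (\<integral>\<^sup>+y. ennreal (norm (f y)) \<partial>lebesgue_on \<Omega>))"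
    proof eventually_elim
      case (elim x)
      then have "ennreal (norm (f x)) \<le> R x" by (rule ennreal_minus_eq_0)
      then show ?case by (simp add: R_def T_def F_def kk)
    qed
  qed
qed

section \<open>Slicing the weak symmetric gradient in time\<close>

text \<open>Functions on the cylinder are only Lebesgue measurable, and Lebesgue measure on a product is not the
product of the Lebesgue measures.  Fubini's theorem is therefore applied to Borel representatives.\<close>

lemma lebesgue_on_borel_rep:
  fixes g :: "'a::euclidean_space \<Rightarrow> real"
  assumes G: "G \<in> sets lebesgue" and g: "integrable (lebesgue_on G) g"
  shows "\<exists>g'. g' \<in> borel_measurable borel \<and> integrable lborel g' \<and> (AE x in lborel. indicator G x * g x = g' x)"
proof -
  have int: "integrable lebesgue (\<lambda>x. indicator G x * g x)"
    using g G by (simp add: integrable_restrict_space)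
  obtain g' where g': "g' \<in> borel_measurable lborel" "AE x in lborel. indicator G x * g x = g' x"
    using completion_ex_borel_measurable_real[OF borel_measurable_integrable[OF int]] by blast
  have "integrable lebesgue g'"
    using int measurable_completion[OF g'(1)] by (rule Bochner_Integration.integrable_cong_AE_imp)
       (use g'(2) in \<open>simp add: AE_completion_iff eq_commute\<close>)
  then have "integrable lborel g'" using g'(1) by (simp add: integrable_completion)
  then show ?thesis using g' by (intro exI[of _ g']) simp
qed

lemma borel_rep_integrable:
  fixes g :: "'a::euclidean_space \<Rightarrow> real"
  assumes G: "G \<in> sets lebesgue" and g': "integrable lborel g'" "AE x in lborel. indicator G x * g x = g' x"
  shows "integrable (lebesgue_on G) g"
proof -
  have ae: "AE x in lebesgue. g' x = indicator G x * g x"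
    using g'(2) by (simp add: AE_completion_iff eq_commute)
  have i: "integrable lebesgue g'" using g'(1) by (simp add: integrable_completion)
  have m: "(\<lambda>x. indicator G x * g x) \<in> borel_measurable lebesgue"
    by (rule borel_measurable_AE[OF borel_measurable_integrable[OF i] ae])
  have "integrable lebesgue (\<lambda>x. indicator G x * g x)"
    using i m ae by (rule Bochner_Integration.integrable_cong_AE_imp)
  then show ?thesis using G by (simp add: integrable_restrict_space)
qed

lemma borel_rep_integral:
  fixes g :: "'a::euclidean_space \<Rightarrow> real"
  assumes G: "G \<in> sets lebesgue" and g': "g' \<in> borel_measurable borel" "AE x in lborel. indicator G x * g x = g' x"
    and \<phi>: "\<phi> \<in> borel_measurable borel"
  shows "(LINT x|lebesgue_on G. g x * \<phi> x) = (LINT x|lborel. g' x * \<phi> x)"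
proof -
  have m: "(\<lambda>x. g' x * \<phi> x) \<in> borel_measurable lebesgue"
    using g'(1) \<phi> by (intro measurable_completion) simp
  have ae: "AE x in lebesgue. g' x * \<phi> x = indicator G x *\<^sub>R (g x * \<phi> x)"
    using g'(2) unfolding AE_completion_iff by eventually_elim (simp add: mult.assoc[symmetric])
  have m2: "(\<lambda>x. indicator G x *\<^sub>R (g x * \<phi> x)) \<in> borel_measurable lebesgue"
    by (rule borel_measurable_AE[OF m ae])
  have "(LINT x|lebesgue_on G. g x * \<phi> x) = (LINT x|lebesgue. indicator G x *\<^sub>R (g x * \<phi> x))"
    using G by (simp add: integral_restrict_space)
  also have "\<dots> = (LINT x|lebesgue. g' x * \<phi> x)"
  proof (rule integral_cong_AE[OF m2 m])
    show "AE x in lebesgue. indicator G x *\<^sub>R (g x * \<phi> x) = g' x * \<phi> x"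
      using ae by eventually_elim (rule sym)
  qed
  also have "\<dots> = (LINT x|lborel. g' x * \<phi> x)"
    using g'(1) \<phi> by (intro integral_completion) simp
  finally show ?thesis .
qed

lemma borel_measurable_fst_snd_comp:
  fixes f :: "'a::euclidean_space \<Rightarrow> real" and h :: "'b::euclidean_space \<Rightarrow> real"
  shows "f \<in> borel_measurable borel \<Longrightarrow> (\<lambda>z::'a \<times> 'b. f (fst z)) \<in> borel_measurable borel"
    and "h \<in> borel_measurable borel \<Longrightarrow> (\<lambda>z::'a \<times> 'b. h (snd z)) \<in> borel_measurable borel"
  by (rule measurable_compose[OF borel_measurable_continuous_onI], auto intro: continuous_intros)+

lemma AE_lborel_slices:
  fixes P :: "'a::euclidean_space \<times> 'b::euclidean_space \<Rightarrow> bool"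
  assumes "AE z in lborel. P z"
  shows "AE t in lborel. AE x in lborel. P (t, x)"
proof -
  have "AE z in lborel \<Otimes>\<^sub>M lborel. P z" using assms unfolding lborel_prod .
  then show ?thesis by (rule lborel_pair.AE_pair)
qed

lemma cylinder_lmeasurable:
  fixes \<Omega> :: "(real^'d::finite) set"
  assumes "open \<Omega>" "bounded \<Omega>"
  shows "open (cylinder T \<Omega>)" "bounded (cylinder T \<Omega>)" "cylinder T \<Omega> \<in> lmeasurable" "cylinder T \<Omega> \<in> sets lebesgue"
proof -
  show "open (cylinder T \<Omega>)" unfolding cylinder_def using assms by (intro open_Times) auto
  moreover show "bounded (cylinder T \<Omega>)" unfolding cylinder_def using assms by (intro bounded_Times) auto
  ultimately show "cylinder T \<Omega> \<in> lmeasurable" by (rule lmeasurable_open[rotated])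
  then show "cylinder T \<Omega> \<in> sets lebesgue" by auto
qed

lemma is_sym_grad_cong_AE:
  fixes u :: "'a::euclidean_space \<Rightarrow> real^'d::finite"
  assumes E: "is_sym_grad e G u E" and ae: "AE x in lebesgue_on G. E x = F x" and G: "open G"
    and F: "locally_integrable G F"
  shows "is_sym_grad e G u F"
proof -
  have "(LINT x|lebesgue_on G. F x $ i $ j * \<phi> x) = (LINT x|lebesgue_on G. E x $ i $ j * \<phi> x)" if \<phi>: "\<phi> \<in> C0inf G" for \<phi> i j
  proof (rule integral_cong_AE)
    obtain K where K: "compact K" "K \<subseteq> G" "\<forall>x. x \<notin> K \<longrightarrow> \<phi> x = 0 \<and> (\<forall>v. frechet_derivative \<phi> (at x) v = 0)"
      using C0inf_support[OF \<phi>] by blast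
    have I: "integrable (lebesgue_on G) (\<lambda>x. H x $ i $ j * \<phi> x)" if "locally_integrable G H" for H :: "'a \<Rightarrow> real^'d^'d"
      using K C0inf_smooth(2)[OF \<phi>] that
      by (intro lebesgue_on_test_integrable[OF G _ _ K(1,2)] locally_integrable_component2) auto
    show "(\<lambda>x. F x $ i $ j * \<phi> x) \<in> borel_measurable (lebesgue_on G)" using I[OF F] by blast
    show "(\<lambda>x. E x $ i $ j * \<phi> x) \<in> borel_measurable (lebesgue_on G)"
      using I E unfolding is_sym_grad_def by blast
    show "AE x in lebesgue_on G. F x $ i $ j * \<phi> x = E x $ i $ j * \<phi> x"
      using ae by eventually_elim simp
  qed
  then show ?thesis using E F unfolding is_sym_grad_def by simp
qed

lemma is_sym_gradD:
  assumes "is_sym_grad e G u E" "\<phi> \<in> C0inf G"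
  shows "(LINT x|lebesgue_on G. E x $ i $ j * \<phi> x) =
    1 / 2 * (distr_deriv G (e j) (\<lambda>x. u x $ i) \<phi> + distr_deriv G (e i) (\<lambda>x. u x $ j) \<phi>)"
  using assms unfolding is_sym_grad_def by blast

lemma integrable_mult_bounded:
  fixes g h :: "'a \<Rightarrow> real"
  assumes g: "integrable M g" and h: "h \<in> borel_measurable M" "\<And>x. \<bar>h x\<bar> \<le> B"
  shows "integrable M (\<lambda>x. g x * h x)"
proof (rule Bochner_Integration.integrable_bound[where f="\<lambda>x. B * g x"])
  show "integrable M (\<lambda>x. B * g x)" using g by simp
  show "(\<lambda>x. g x * h x) \<in> borel_measurable M" using g h by simp
  have "\<bar>h x\<bar> \<le> \<bar>B\<bar>" for x using h(2)[of x] by linarith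
  then show "AE x in M. norm (g x * h x) \<le> norm (B * g x)"
    by (intro AE_I2) (simp add: abs_mult mult.commute[of "\<bar>B\<bar>"] mult_left_mono)
qed

lemma Ck_linear_projection:
  fixes L :: "'a::euclidean_space \<Rightarrow> 'b::euclidean_space" and f :: "'b \<Rightarrow> real"
  assumes L: "bounded_linear L" and B: "\<And>v. v \<in> Basis \<Longrightarrow> L v \<in> insert 0 Basis"
  shows "Ck k f \<Longrightarrow> Ck k (\<lambda>x. f (L x))"
proof (induction k arbitrary: f)
  case 0
  then show ?case
    using L by (auto intro: continuous_on_compose2 linear_continuous_on)
next
  case (Suc k)
  have d: "f differentiable (at y)" for y using Suc.prems by simp
  have D: "((\<lambda>x. f (L x)) has_derivative (\<lambda>h. frechet_derivative f (at (L x)) (L h))) (at x)" for x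
    by (rule has_derivative_compose[OF bounded_linear_imp_has_derivative[OF L] d[unfolded frechet_derivative_works]])
  have eq: "frechet_derivative (\<lambda>x. f (L x)) (at x) v = frechet_derivative f (at (L x)) (L v)" for x v
    using fun_cong[OF frechet_derivative_at[OF D], of x v] by simp
  have "Ck k (\<lambda>x. frechet_derivative (\<lambda>x. f (L x)) (at x) v)" if "v \<in> Basis" for v
  proof (cases "L v = 0")
    case True
    then have "frechet_derivative f (at (L x)) (L v) = 0" for x
      using linear_0[OF linear_frechet_derivative[OF d]] by simp
    then have "(\<lambda>x. frechet_derivative (\<lambda>x. f (L x)) (at x) v) = (\<lambda>x. 0)"
      by (simp only: eq)
    then show ?thesis using Ck_const[of k "0::real"] by (simp only:)
  next
    case False
    then have "L v \<in> Basis" using B that by blast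
    then have "Ck k (\<lambda>y. frechet_derivative f (at y) (L v))" using Suc.prems by simp
    then show ?thesis unfolding eq by (rule Suc.IH)
  qed
  then show ?case using D by (auto simp: differentiable_def)
qed

lemma C0inf_tensor:
  fixes \<psi> :: "'a::euclidean_space \<Rightarrow> real" and \<phi> :: "'b::euclidean_space \<Rightarrow> real"
  assumes \<psi>: "\<psi> \<in> C0inf A" and \<phi>: "\<phi> \<in> C0inf B"
  shows "(\<lambda>z. \<psi> (fst z) * \<phi> (snd z)) \<in> C0inf (A \<times> B)"
proof -
  let ?f = "\<lambda>z. \<psi> (fst z) * \<phi> (snd z)"
  have "Ck k \<psi>" "Ck k \<phi>" for k using \<psi> \<phi> unfolding C0inf_def by blast+
  then have "Ck k (\<lambda>z::'a \<times> 'b. \<psi> (fst z))" "Ck k (\<lambda>z::'a \<times> 'b. \<phi> (snd z))" for k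
    by (auto intro!: Ck_linear_projection[OF bounded_linear_fst] Ck_linear_projection[OF bounded_linear_snd]
        simp: Basis_prod_def)
  then have ck: "Ck k ?f" for k by (intro Ck_mult)
  let ?K = "closure {t. \<psi> t \<noteq> 0} \<times> closure {x. \<phi> x \<noteq> 0}"
  have K: "compact ?K" "?K \<subseteq> A \<times> B"
  proof -
    have "compact (closure {t. \<psi> t \<noteq> 0})" "compact (closure {x. \<phi> x \<noteq> 0})"
      "closure {t. \<psi> t \<noteq> 0} \<subseteq> A" "closure {x. \<phi> x \<noteq> 0} \<subseteq> B"
      using \<psi> \<phi> unfolding C0inf_def by blast+
    then show "compact ?K" "?K \<subseteq> A \<times> B" by (auto intro!: compact_Times)
  qed
  have "{z. ?f z \<noteq> 0} \<subseteq> ?K"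
    using closure_subset[of "{t. \<psi> t \<noteq> 0}"] closure_subset[of "{x. \<phi> x \<noteq> 0}"] by auto
  then have sub: "closure {z. ?f z \<noteq> 0} \<subseteq> ?K"
    using compact_imp_closed[OF K(1)] by (rule closure_minimal)
  moreover have "compact (closure {z. ?f z \<noteq> 0})"
    using compact_Int_closed[OF K(1) closed_closure[of "{z. ?f z \<noteq> 0}"]] sub by (simp only: Int_absorb1)
  ultimately show ?thesis using ck K(2) unfolding C0inf_def by blast
qed

lemma frechet_derivative_tensor:
  fixes \<psi> :: "'a::euclidean_space \<Rightarrow> real" and \<phi> :: "'b::euclidean_space \<Rightarrow> real"
  assumes \<psi>: "\<psi> differentiable (at t)" and \<phi>: "\<phi> differentiable (at x)"
  shows "frechet_derivative (\<lambda>z. \<psi> (fst z) * \<phi> (snd z)) (at (t, x)) (0, v) = \<psi> t * frechet_derivative \<phi> (at x) v"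
proof -
  note D1 = \<psi>[unfolded frechet_derivative_works] and D2 = \<phi>[unfolded frechet_derivative_works]
  have "((\<lambda>z. \<psi> (fst z)) has_derivative (\<lambda>h. frechet_derivative \<psi> (at t) (fst h))) (at (t, x))"
    using D1 by (intro has_derivative_compose[OF has_derivative_fst[OF has_derivative_ident]]) simp
  moreover have "((\<lambda>z. \<phi> (snd z)) has_derivative (\<lambda>h. frechet_derivative \<phi> (at x) (snd h))) (at (t, x))"
    using D2 by (intro has_derivative_compose[OF has_derivative_snd[OF has_derivative_ident]]) simp
  ultimately have D: "((\<lambda>z. \<psi> (fst z) * \<phi> (snd z)) has_derivative
      (\<lambda>h. \<psi> (fst (t, x)) * frechet_derivative \<phi> (at x) (snd h) + frechet_derivative \<psi> (at t) (fst h) * \<phi> (snd (t, x)))) (at (t, x))"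
    by (rule has_derivative_mult)
  show ?thesis
    using fun_cong[OF frechet_derivative_at[OF D], of "(0, v)"] linear_0[OF linear_frechet_derivative[OF \<psi>]] by simp
qed

lemma half_sum_zero:
  fixes x y z :: real
  assumes "x = 1 / 2 * (- y + - z)"
  shows "x + 1 / 2 * (y + z) = 0"
  using assms by (simp add: field_simps)

lemma AE_lborel_imp_lebesgue_on:
  assumes "AE x in lborel. P x" "G \<in> sets lebesgue"
  shows "AE x in lebesgue_on G. P x"
proof -
  have "AE x in lebesgue. P x" using assms(1) by (simp add: AE_completion_iff)
  then have "AE x in lebesgue. x \<in> G \<longrightarrow> P x" by eventually_elim simp
  then show ?thesis using assms(2) by (simp add: AE_restrict_space_iff)
qed

lemma AE_lebesgue_on_imp_lborel:
  assumes "AE x in lebesgue_on G. P x" "G \<in> sets lebesgue"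
  shows "AE x in lborel. x \<in> G \<longrightarrow> P x"
  using assms by (simp add: AE_restrict_space_iff AE_completion_iff)

text \<open>Testing the weak formulation on the cylinder with products of a function of \<open>t\<close> and a bump in \<open>x\<close>
shows that a function of \<open>t\<close> alone is orthogonal to all bumps in time, so it vanishes.  The arguments
\<open>e\<close>, \<open>v1\<close>, \<open>v2\<close> are Borel representatives of \<open>E z $ i $ j\<close>, \<open>u z $ i\<close>, \<open>u z $ j\<close>.\<close>

lemma slice_weak_identity:
  fixes \<Omega> :: "(real^'d::finite) set" and a b :: "real^'d"
  assumes \<Omega>: "open \<Omega>" "bounded \<Omega>" and ab: "a \<in> rational_vectors" "b \<in> rational_vectors" "cbox a b \<subseteq> \<Omega>"
    and E: "is_sym_grad cyl_dir (cylinder T \<Omega>) u E"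
    and e: "e \<in> borel_measurable borel" "integrable lborel e" "AE z in lborel. indicator (cylinder T \<Omega>) z * E z $ i $ j = e z"
    and v1: "v1 \<in> borel_measurable borel" "integrable lborel v1" "AE z in lborel. indicator (cylinder T \<Omega>) z * u z $ i = v1 z"
    and v2: "v2 \<in> borel_measurable borel" "integrable lborel v2" "AE z in lborel. indicator (cylinder T \<Omega>) z * u z $ j = v2 z"
  shows "AE t in lebesgue_on {0<..<T}.
     (LINT x|lborel. e (t, x) * box_bump n a b x) =
      - 1 / 2 * ((LINT x|lborel. v1 (t, x) * frechet_derivative (box_bump n a b) (at x) (space_dir j))
           + (LINT x|lborel. v2 (t, x) * frechet_derivative (box_bump n a b) (at x) (space_dir i)))"
proof -
  let ?Q = "cylinder T \<Omega>"
  let ?\<phi> = "box_bump n a b"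
  let ?D = "\<lambda>l x. frechet_derivative ?\<phi> (at x) (space_dir l)"
  have Qs: "?Q \<in> sets lebesgue" using cylinder_lmeasurable[OF \<Omega>] by blast
  have C0: "?\<phi> \<in> C0inf \<Omega>" using ab(3) by (rule box_bump_C0inf)
  obtain K where K: "compact K" "\<forall>x. x \<notin> K \<longrightarrow> ?\<phi> x = 0 \<and> (\<forall>v. frechet_derivative ?\<phi> (at x) v = 0)"
    using C0inf_support[OF C0] by blast
  have cD: "continuous_on UNIV (?D l)" for l using C0inf_smooth(3)[OF C0] by blast
  have mD [measurable]: "?D l \<in> borel_measurable borel" for l using cD by (rule borel_measurable_continuous_onI)
  have bD: "\<exists>M. \<forall>x. \<bar>?D l x\<bar> \<le> M" for l
    by (rule compact_support_bounded[OF cD K(1)]) (use K(2) in blast)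
  have b\<phi>: "\<bar>?\<phi> x\<bar> \<le> 1" for x using box_bump_bounds[of n a b x] by simp
  have I: "integrable lborel (\<lambda>z. g z * h (snd z))"
    if "integrable lborel g" "h \<in> borel_measurable borel" "\<exists>M. \<forall>x. \<bar>h x\<bar> \<le> M"
    for g :: "real \<times> (real^'d) \<Rightarrow> real" and h :: "real^'d \<Rightarrow> real"
  proof -
    from that(3) obtain M where "\<forall>x. \<bar>h x\<bar> \<le> M" ..
    then show ?thesis using that(1,2) by (intro integrable_mult_bounded[where B=M]) (auto intro: borel_measurable_fst_snd_comp)
  qed
  have I1: "integrable lborel (\<lambda>z. e z * ?\<phi> (snd z))"
    using e(2) b\<phi> by (intro I) auto
  have I2: "integrable lborel (\<lambda>z. v1 z * ?D j (snd z))" "integrable lborel (\<lambda>z. v2 z * ?D i (snd z))"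
    using v1(2) v2(2) bD by (auto intro!: I)
  define w where "w z = e z * ?\<phi> (snd z) + 1 / 2 * (v1 z * ?D j (snd z) + v2 z * ?D i (snd z))" for z
  have Iw: "integrable lborel w" unfolding w_def[abs_def] using I1 I2 by simp
  then have Iw': "integrable (lborel \<Otimes>\<^sub>M lborel) w" unfolding lborel_prod .
  \<comment> \<open>the defect of the weak identity on the slice at time \<open>t\<close>\<close>
  define h where "h t = (LINT x|lborel. w (t, x))" for t
  have Ih: "integrable lborel h"
    unfolding h_def[abs_def] using lborel_pair.integrable_fst'[OF Iw'] .
  have h0: "AE t in lebesgue_on {0<..<T}. h t = 0"
  proof (rule AE_zero_of_box_bumps)
    show "locally_integrable {0<..<T} h"
      unfolding locally_integrable_def set_integrable_def
    proof (intro allI impI integrable_mult_indicator)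
      show "integrable lebesgue h" using Ih by (simp add: integrable_completion)
    qed (auto simp: compact_imp_closed borel_closed)
    fix a0 b0 :: real and m assume sub: "cbox a0 b0 \<subseteq> {0<..<T}"
    then have C0': "box_bump m a0 b0 \<in> C0inf {0<..<T}" by (rule box_bump_C0inf)
    let ?\<psi> = "box_bump m a0 b0"
    let ?\<Phi> = "\<lambda>z. ?\<psi> (fst z) * ?\<phi> (snd z)"
    have \<Phi>: "?\<Phi> \<in> C0inf ?Q" unfolding cylinder_def by (rule C0inf_tensor[OF C0' C0])
    have b\<psi>: "\<bar>?\<psi> t\<bar> \<le> 1" for t using box_bump_bounds[of m a0 b0 t] by simp
    have D\<Phi>: "frechet_derivative ?\<Phi> (at z) (cyl_dir l) = ?\<psi> (fst z) * ?D l (snd z)" for z l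
      using frechet_derivative_tensor[OF C0inf_smooth(1)[OF C0', of "fst z"] C0inf_smooth(1)[OF C0, of "snd z"], of "axis l 1"]
      by (simp add: cyl_dir_def space_dir_def)
    have J: "integrable lborel (\<lambda>z. g z * ?\<psi> (fst z))" if "integrable lborel g" for g :: "real \<times> (real^'d) \<Rightarrow> real"
      using that b\<psi> by (intro integrable_mult_bounded[where B=1]) (auto intro: borel_measurable_fst_snd_comp)
    have m\<psi>: "(\<lambda>z::real \<times> (real^'d). ?\<psi> (fst z)) \<in> borel_measurable borel"
      by (rule borel_measurable_fst_snd_comp(1)) measurable
    have m\<phi>: "(\<lambda>z::real \<times> (real^'d). ?\<phi> (snd z)) \<in> borel_measurable borel"
      by (rule borel_measurable_fst_snd_comp(2)) measurable
    have mDD: "(\<lambda>z::real \<times> (real^'d). ?D l (snd z)) \<in> borel_measurable borel" for l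
      by (rule borel_measurable_fst_snd_comp(2)[OF mD])
    have "(LINT z|lebesgue_on ?Q. E z $ i $ j * ?\<Phi> z) = (LINT z|lborel. e z * ?\<Phi> z)"
      by (rule borel_rep_integral[OF Qs e(1,3) borel_measurable_times[OF m\<psi> m\<phi>]])
    then have r1: "(LINT z|lebesgue_on ?Q. E z $ i $ j * ?\<Phi> z) = (LINT z|lborel. e z * ?\<phi> (snd z) * ?\<psi> (fst z))"
      by (simp only: mult_ac)
    have "(LINT z|lebesgue_on ?Q. u z $ i * (?\<psi> (fst z) * ?D j (snd z))) = (LINT z|lborel. v1 z * (?\<psi> (fst z) * ?D j (snd z)))"
      by (rule borel_rep_integral[OF Qs v1(1,3) borel_measurable_times[OF m\<psi> mDD]])
    then have r2: "distr_deriv ?Q (cyl_dir j) (\<lambda>z. u z $ i) ?\<Phi> = - (LINT z|lborel. v1 z * ?D j (snd z) * ?\<psi> (fst z))"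
      unfolding distr_deriv_def D\<Phi> by (simp only: mult_ac)
    have "(LINT z|lebesgue_on ?Q. u z $ j * (?\<psi> (fst z) * ?D i (snd z))) = (LINT z|lborel. v2 z * (?\<psi> (fst z) * ?D i (snd z)))"
      by (rule borel_rep_integral[OF Qs v2(1,3) borel_measurable_times[OF m\<psi> mDD]])
    then have r3: "distr_deriv ?Q (cyl_dir i) (\<lambda>z. u z $ j) ?\<Phi> = - (LINT z|lborel. v2 z * ?D i (snd z) * ?\<psi> (fst z))"
      unfolding distr_deriv_def D\<Phi> by (simp only: mult_ac)
    have weak: "(LINT z|lebesgue_on ?Q. E z $ i $ j * ?\<Phi> z) =
       1 / 2 * (distr_deriv ?Q (cyl_dir j) (\<lambda>z. u z $ i) ?\<Phi> + distr_deriv ?Q (cyl_dir i) (\<lambda>z. u z $ j) ?\<Phi>)"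
      by (rule is_sym_gradD[OF E \<Phi>])
    have "(LINT z|lborel. w z * ?\<psi> (fst z)) = (LINT z|lborel. e z * ?\<phi> (snd z) * ?\<psi> (fst z) +
        1 / 2 * (v1 z * ?D j (snd z) * ?\<psi> (fst z) + v2 z * ?D i (snd z) * ?\<psi> (fst z)))"
      by (intro Bochner_Integration.integral_cong refl) (simp add: w_def algebra_simps)
    moreover have "\<dots> = (LINT z|lborel. e z * ?\<phi> (snd z) * ?\<psi> (fst z)) +
        1 / 2 * ((LINT z|lborel. v1 z * ?D j (snd z) * ?\<psi> (fst z)) + (LINT z|lborel. v2 z * ?D i (snd z) * ?\<psi> (fst z)))"
      using J[OF I1] J[OF I2(1)] J[OF I2(2)] by simp
    ultimately have z: "(LINT z|lborel. w z * ?\<psi> (fst z)) = 0"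
      using half_sum_zero[OF weak[unfolded r1 r2 r3]] by (simp only:)
    have Jw: "integrable (lborel \<Otimes>\<^sub>M lborel) (\<lambda>z. w z * ?\<psi> (fst z))"
      using J[OF Iw] unfolding lborel_prod .
    have "(LINT t|lebesgue_on {0<..<T}. h t * ?\<psi> t) = (LINT t|lborel. h t * ?\<psi> t)"
    proof -
      have "(LINT t|lebesgue_on {0<..<T}. h t * ?\<psi> t) = (LINT t|lebesgue. indicator {0<..<T} t *\<^sub>R (h t * ?\<psi> t))"
        by (subst integral_restrict_space) auto
      also have "\<dots> = (LINT t|lebesgue. h t * ?\<psi> t)"
      proof (rule Bochner_Integration.integral_cong[OF refl])
        fix t
        have "?\<psi> t = 0" if "t \<notin> {0<..<T}"
          using box_bump_outside[of t a0 b0 m] box_subset_cbox[of a0 b0] sub that by blast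
        then show "indicator {0<..<T} t *\<^sub>R (h t * ?\<psi> t) = h t * ?\<psi> t"
          by (cases "t \<in> {0<..<T}") auto
      qed
      also have "\<dots> = (LINT t|lborel. h t * ?\<psi> t)"
        using Ih by (intro integral_completion) simp
      finally show ?thesis .
    qed
    also have "\<dots> = (LINT t|lborel. LINT x|lborel. w (t, x) * ?\<psi> t)"
      by (simp add: h_def)
    also have "\<dots> = (LINT z|lborel. w z * ?\<psi> (fst z))"
      using lborel_pair.integral_fst'[OF Jw] unfolding lborel_prod by simp
    finally show "(LINT t|lebesgue_on {0<..<T}. h t * ?\<psi> t) = 0" using z by simp
  qed simp
  have "AE t in lborel. integrable lborel (\<lambda>x. e (t, x) * ?\<phi> x)"
     "AE t in lborel. integrable lborel (\<lambda>x. v1 (t, x) * ?D j x)"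
     "AE t in lborel. integrable lborel (\<lambda>x. v2 (t, x) * ?D i x)"
    using lborel_pair.AE_integrable_fst'[OF I1[folded lborel_prod]]
      lborel_pair.AE_integrable_fst'[OF I2(1)[folded lborel_prod]]
      lborel_pair.AE_integrable_fst'[OF I2(2)[folded lborel_prod]] by simp_all
  then have "AE t in lborel. (LINT x|lborel. w (t, x)) = (LINT x|lborel. e (t, x) * ?\<phi> x) +
     1 / 2 * ((LINT x|lborel. v1 (t, x) * ?D j x) + (LINT x|lborel. v2 (t, x) * ?D i x))"
    by eventually_elim (simp add: w_def)
  then have "AE t in lebesgue_on {0<..<T}. (LINT x|lborel. w (t, x)) = (LINT x|lborel. e (t, x) * ?\<phi> x) +
     1 / 2 * ((LINT x|lborel. v1 (t, x) * ?D j x) + (LINT x|lborel. v2 (t, x) * ?D i x))"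
    by (rule AE_lborel_imp_lebesgue_on) simp
  with h0 show ?thesis by eventually_elim (simp add: h_def)
qed

lemma locally_integrable_matrixI:
  fixes F :: "'a::euclidean_space \<Rightarrow> real^'n::finite^'m::finite"
  assumes F: "\<And>i j. integrable (lebesgue_on G) (\<lambda>x. F x $ i $ j)" and G: "G \<in> sets lebesgue"
  shows "locally_integrable G F"
  unfolding locally_integrable_def
proof (intro allI impI)
  fix K assume K: "compact K" "K \<subseteq> G"
  show "set_integrable lebesgue K F"
  proof (rule absolutely_integrable_componentwise)
    fix b :: "real^'n^'m" assume "b \<in> Basis"
    then obtain i j where b: "b = axis i (axis j 1)"
      by (auto simp: Basis_vec_def)
    have "integrable lebesgue (\<lambda>x. indicator G x *\<^sub>R (F x $ i $ j))"
      using F G by (simp add: integrable_restrict_space)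
    then have "set_integrable lebesgue G (\<lambda>x. F x $ i $ j)" by (simp add: set_integrable_def)
    moreover have "K \<in> sets lebesgue" using K(1) by (simp add: compact_imp_closed borel_closed)
    ultimately have "set_integrable lebesgue K (\<lambda>x. F x $ i $ j)"
      using K(2) by (rule set_integrable_subset)
    then show "set_integrable lebesgue K (\<lambda>x. F x \<bullet> b)" by (simp add: b inner_axis)
  qed
qed

text \<open>Both \<open>E (t, _)\<close> and the gradient \<open>F\<close> of the slice satisfy the weak identity for the countably many
bumps with rational corners, for all \<open>t\<close> outside one null set.  By the fundamental lemma they
coincide.\<close>

lemma sym_grad_slices:
  fixes \<Omega> :: "(real^'d::finite) set"
  assumes \<Omega>: "open \<Omega>" "bounded \<Omega>" and E: "is_sym_grad cyl_dir (cylinder T \<Omega>) u E"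
    and iE: "\<And>i j. integrable (lebesgue_on (cylinder T \<Omega>)) (\<lambda>z. E z $ i $ j)"
    and iu: "\<And>i. integrable (lebesgue_on (cylinder T \<Omega>)) (\<lambda>z. u z $ i)"
    and ex: "AE t in lebesgue_on {0<..<T}. \<exists>F. is_sym_grad space_dir \<Omega> (\<lambda>x. u (t, x)) F"
  shows "AE t in lebesgue_on {0<..<T}. is_sym_grad space_dir \<Omega> (\<lambda>x. u (t, x)) (\<lambda>x. E (t, x))"
proof -
  let ?Q = "cylinder T \<Omega>"
  have Qs: "?Q \<in> sets lebesgue" using cylinder_lmeasurable[OF \<Omega>] by blast
  have \<Omega>s: "\<Omega> \<in> sets lebesgue" using \<Omega> by simp
  define rep where "rep g g' \<longleftrightarrow> g' \<in> borel_measurable borel \<and> integrable lborel g' \<and> (AE z in lborel. indicator ?Q z * g z = g' z)"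
    for g g' :: "real \<times> (real^'d) \<Rightarrow> real"
  define e where "e i j = (SOME g'. rep (\<lambda>z. E z $ i $ j) g')" for i j
  define v where "v i = (SOME g'. rep (\<lambda>z. u z $ i) g')" for i
  have e: "rep (\<lambda>z. E z $ i $ j) (e i j)" for i j
    unfolding e_def rep_def by (rule someI_ex[OF lebesgue_on_borel_rep[OF Qs iE]])
  have v: "rep (\<lambda>z. u z $ i) (v i)" for i
    unfolding v_def rep_def by (rule someI_ex[OF lebesgue_on_borel_rep[OF Qs iu]])
  have em: "e i j \<in> borel_measurable borel" and vm: "v i \<in> borel_measurable borel" for i j
    using e v unfolding rep_def by blast+
  have ei: "integrable lborel (e i j)" for i j using e unfolding rep_def by blast
  have eAE: "AE z in lborel. indicator ?Q z * E z $ i $ j = e i j z" for i j using e unfolding rep_def by blast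
  have vAE: "AE z in lborel. indicator ?Q z * u z $ i = v i z" for i using v unfolding rep_def by blast
  have vi: "integrable lborel (v i)" for i using v unfolding rep_def by blast
  let ?I = "lebesgue_on {0<..<T}"
  have A1: "AE t in ?I. \<forall>i j. AE x in lborel. indicator ?Q (t, x) * E (t, x) $ i $ j = e i j (t, x)"
    using AE_lborel_imp_lebesgue_on[OF AE_lborel_slices[OF eAE], of "{0<..<T}"] by (simp add: AE_all_countable)
  have A2: "AE t in ?I. \<forall>i. AE x in lborel. indicator ?Q (t, x) * u (t, x) $ i = v i (t, x)"
    using AE_lborel_imp_lebesgue_on[OF AE_lborel_slices[OF vAE], of "{0<..<T}"] by (simp add: AE_all_countable)
  have A3: "AE t in ?I. \<forall>i j. integrable lborel (\<lambda>x. e i j (t, x))"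
    using AE_lborel_imp_lebesgue_on[OF lborel_pair.AE_integrable_fst'[OF ei[folded lborel_prod]], of "{0<..<T}"]
    by (simp add: AE_all_countable)
  define R where "R = {(a, b). a \<in> rational_vectors \<and> b \<in> rational_vectors \<and> cbox a b \<subseteq> \<Omega>}"
  have "countable R"
    by (rule countable_subset[of _ "rational_vectors \<times> rational_vectors"])
       (auto simp: R_def countable_rational_vectors)
  define W where "W t i j ab n \<longleftrightarrow> (LINT x|lborel. e i j (t, x) * box_bump n (fst ab) (snd ab) x) =
      - 1 / 2 * ((LINT x|lborel. v i (t, x) * frechet_derivative (box_bump n (fst ab) (snd ab)) (at x) (space_dir j))
           + (LINT x|lborel. v j (t, x) * frechet_derivative (box_bump n (fst ab) (snd ab)) (at x) (space_dir i)))" for t i j ab n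
  have "AE t in ?I. W t i j ab n" if "ab \<in> R" for i j ab n
  proof -
    have "fst ab \<in> rational_vectors" "snd ab \<in> rational_vectors" "cbox (fst ab) (snd ab) \<subseteq> \<Omega>"
      using that by (auto simp: R_def)
    from slice_weak_identity[OF \<Omega> this E em ei eAE vm vi vAE vm vi vAE]
    show ?thesis unfolding W_def .
  qed
  then have "\<forall>ab\<in>R. AE t in ?I. \<forall>i j n. W t i j ab n" by (simp add: AE_all_countable)
  then have A4: "AE t in ?I. \<forall>ab\<in>R. \<forall>i j n. W t i j ab n"
    by (subst AE_ball_countable[OF \<open>countable R\<close>])
  have A5: "AE t in ?I. t \<in> {0<..<T}" by (rule AE_I2) simp
  show ?thesis
    using A1 A2 A3 A4 A5 ex
  proof eventually_elim
    case (elim t)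
    have ind: "indicator ?Q (t, x) = (indicator \<Omega> x :: real)" for x
      using elim(5) by (simp add: cylinder_def indicator_def)
    have e1: "AE x in lborel. indicator \<Omega> x * E (t, x) $ i $ j = e i j (t, x)" for i j
      using elim(1) by (simp add: ind)
    have v1: "AE x in lborel. indicator \<Omega> x * u (t, x) $ i = v i (t, x)" for i
      using elim(2) by (simp add: ind)
    have ms: "(\<lambda>x. g (t, x)) \<in> borel_measurable borel" if "g \<in> borel_measurable borel" for g :: "real \<times> (real^'d) \<Rightarrow> real"
      by (rule measurable_compose[OF _ that]) (auto intro!: borel_measurable_continuous_onI continuous_intros)
    have li: "locally_integrable \<Omega> (\<lambda>x. E (t, x))"
    proof (rule locally_integrable_matrixI[OF _ \<Omega>s])
      show "integrable (lebesgue_on \<Omega>) (\<lambda>x. E (t, x) $ i $ j)" for i j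
        using elim(3) by (intro borel_rep_integrable[OF \<Omega>s _ e1]) blast
    qed
    obtain F where F: "is_sym_grad space_dir \<Omega> (\<lambda>x. u (t, x)) F" using elim(6) by blast
    then have liF: "locally_integrable \<Omega> F" unfolding is_sym_grad_def by blast
    have "AE x in lebesgue_on \<Omega>. F x $ i $ j = E (t, x) $ i $ j" for i j
    proof -
      have "AE x in lebesgue_on \<Omega>. F x $ i $ j - E (t, x) $ i $ j = 0"
      proof (rule AE_zero_of_box_bumps[OF \<Omega>(1)])
        show "locally_integrable \<Omega> (\<lambda>x. F x $ i $ j - E (t, x) $ i $ j)"
          by (intro locally_integrable_diff locally_integrable_component2 li liF)
        fix a b :: "real^'d" and n
        assume ab: "a \<in> rational_vectors" "b \<in> rational_vectors" "cbox a b \<subseteq> \<Omega>"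
        let ?\<phi> = "box_bump n a b"
        have C0: "?\<phi> \<in> C0inf \<Omega>" using ab(3) by (rule box_bump_C0inf)
        have mD: "(\<lambda>x. frechet_derivative ?\<phi> (at x) w) \<in> borel_measurable borel" for w
          by (intro borel_measurable_continuous_onI C0inf_smooth(3)[OF C0])
        have W: "W t i j (a, b) n" using elim(4) ab by (auto simp: R_def)
        have "(LINT x|lebesgue_on \<Omega>. E (t, x) $ i $ j * ?\<phi> x) = (LINT x|lborel. e i j (t, x) * ?\<phi> x)"
          by (rule borel_rep_integral[OF \<Omega>s ms[OF em] e1]) simp
        moreover have "(LINT x|lebesgue_on \<Omega>. u (t, x) $ l * frechet_derivative ?\<phi> (at x) w) =
            (LINT x|lborel. v l (t, x) * frechet_derivative ?\<phi> (at x) w)" for l w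
          by (rule borel_rep_integral[OF \<Omega>s ms[OF vm] v1 mD])
        ultimately have eq: "(LINT x|lebesgue_on \<Omega>. E (t, x) $ i $ j * ?\<phi> x) = (LINT x|lebesgue_on \<Omega>. F x $ i $ j * ?\<phi> x)"
          using W unfolding is_sym_gradD[OF F C0] W_def distr_deriv_def by (simp add: field_simps)
        obtain K where K: "compact K" "K \<subseteq> \<Omega>" "\<forall>x. x \<notin> K \<longrightarrow> ?\<phi> x = 0 \<and> (\<forall>v. frechet_derivative ?\<phi> (at x) v = 0)"
          using C0inf_support[OF C0] by blast
        have I: "integrable (lebesgue_on \<Omega>) (\<lambda>x. H x $ i $ j * ?\<phi> x)" if "locally_integrable \<Omega> H" for H :: "real^'d \<Rightarrow> real^'d^'d"
          using K C0inf_smooth(2)[OF C0] that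
          by (intro lebesgue_on_test_integrable[OF \<Omega>(1) _ _ K(1,2)] locally_integrable_component2) auto
        show "(LINT x|lebesgue_on \<Omega>. (F x $ i $ j - E (t, x) $ i $ j) * ?\<phi> x) = 0"
          using I[OF li] I[OF liF] eq by (simp add: left_diff_distrib)
      qed
      then show ?thesis by eventually_elim simp
    qed
    then have "AE x in lebesgue_on \<Omega>. F x = E (t, x)" by (rule AE_matrix_eqI)
    then show ?case by (rule is_sym_grad_cong_AE[OF F _ \<Omega>(1) li])
  qed
qed

section \<open>Level sets of the exponent and integration in time\<close>

text \<open>This form removes the case distinction between \<open>s < d\<close> and \<open>s \<ge> d\<close>.\<close>

lemma parabolic_exponent_eq_min:
  assumes "d \<ge> 1" "s > 0"
  shows "parabolic_exponent d s = s + min (2 * s / real d) 2"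
  using assms by (auto simp: parabolic_exponent_def min_def field_simps)

lemma parabolic_exponent_add_le:
  assumes "d \<ge> 2" "s > 0" "h \<ge> 0"
  shows "parabolic_exponent d (s + h) \<le> parabolic_exponent d s + 2 * h"
proof -
  have "h / real d * 2 \<le> h / 2 * 2" using assms by (intro mult_right_mono divide_left_mono) auto
  then have "2 * (s + h) / real d \<le> 2 * s / real d + h"
    by (simp add: add_divide_distrib mult.commute)
  then show ?thesis using assms by (simp add: parabolic_exponent_eq_min min_def)
qed

lemma parabolic_exponent_mono:
  assumes "d \<ge> 1" "0 < s" "s \<le> s'"
  shows "parabolic_exponent d s \<le> parabolic_exponent d s'"
proof -
  have "2 * s / real d \<le> 2 * s' / real d" using assms by (intro divide_right_mono) auto
  then have "min (2 * s / real d) 2 \<le> min (2 * s' / real d) 2" by (intro min.mono) auto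
  then show ?thesis using assms by (simp add: parabolic_exponent_eq_min)
qed

text \<open>On a level set where \<open>p\<close> lies between \<open>s\<close> and \<open>s + \<epsilon> / 4\<close>, the exponent \<open>s + r\<close> dominates the target
exponent while \<open>r\<close> stays strictly below the bound \<open>min (2 s / d) 2\<close> required for the interpolation.\<close>

lemma interpolation_exponent_exists:
  assumes d: "d \<ge> 2" and s: "s > 0" and \<epsilon>: "\<epsilon> > 0"
  shows "\<exists>r. 0 < r \<and> r < 2 \<and> r < 2 * s / real d \<and> parabolic_exponent d (s + \<epsilon> / 4) - \<epsilon> \<le> s + r"
proof -
  define m where "m = min (2 * s / real d) 2"
  have m: "m > 0" using d s by (simp add: m_def)
  have "parabolic_exponent d (s + \<epsilon> / 4) \<le> s + m + \<epsilon> / 2"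
    using parabolic_exponent_add_le[OF d s, of "\<epsilon> / 4"] parabolic_exponent_eq_min[of d s] d s \<epsilon> by (simp add: m_def)
  moreover have "max (m / 2) (m - \<epsilon> / 2) < m" using m \<epsilon> by simp
  moreover have "m \<le> 2" "m \<le> 2 * s / real d" by (auto simp: m_def)
  ultimately show ?thesis using m by (intro exI[of _ "max (m / 2) (m - \<epsilon> / 2)"]) auto
qed

lemma nn_integral_lborel_pair:
  fixes f :: "'a::euclidean_space \<times> 'b::euclidean_space \<Rightarrow> ennreal"
  assumes "f \<in> borel_measurable borel"
  shows "(\<integral>\<^sup>+z. f z \<partial>lborel) = (\<integral>\<^sup>+t. (\<integral>\<^sup>+x. f (t, x) \<partial>lborel) \<partial>lborel)"
proof -
  have "f \<in> borel_measurable (lborel \<Otimes>\<^sub>M lborel)" unfolding lborel_prod using assms by simp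
  from lborel.nn_integral_fst[OF this] show ?thesis unfolding lborel_prod by simp
qed

lemma powr_le_1_add_powr:
  fixes y a b :: real
  assumes "y \<ge> 0" "a \<le> b" "0 \<le> a"
  shows "y powr a \<le> 1 + y powr b"
proof (cases "y \<le> 1")
  case True
  then have "y powr a \<le> 1" using assms by (intro powr_le1) auto
  then show ?thesis by (simp add: add_increasing2)
next
  case False
  then have "y powr a \<le> y powr b" using assms by (intro powr_mono) auto
  then show ?thesis by simp
qed

text \<open>What the integration in time uses about \<open>W = |u| / N\<close> and \<open>F = |\<epsilon>(u)| / N\<close>: modular of \<open>F\<close> at most one,
\<open>L\<^sup>2\<close> norm of almost every slice of \<open>W\<close> at most one, and the pointwise bound on almost every slice.\<close>

definition admissible_pair ::
  "real \<Rightarrow> real \<Rightarrow> real \<Rightarrow> (real \<times> (real^'d::finite)) set \<Rightarrow> (real \<times> (real^'d) \<Rightarrow> real) \<Rightarrow>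
    (real \<times> (real^'d) \<Rightarrow> real) \<Rightarrow> (real \<times> (real^'d) \<Rightarrow> real) \<Rightarrow> bool" where
  "admissible_pair \<delta> C0 T Q p W F \<longleftrightarrow>
     W \<in> borel_measurable borel \<and> F \<in> borel_measurable borel \<and>
     (\<forall>z. 0 \<le> W z) \<and> (\<forall>z. 0 \<le> F z) \<and> (\<forall>z. z \<notin> Q \<longrightarrow> F z = 0) \<and>
     (\<integral>\<^sup>+z. ennreal (F z powr p z) * indicator Q z \<partial>lborel) \<le> 1 \<and>
     (AE t in lborel. t \<in> {0<..<T} \<longrightarrow> (\<integral>\<^sup>+x. ennreal ((W (t, x))\<^sup>2) * indicator Q (t, x) \<partial>lborel) \<le> 1) \<and>
     (AE t in lborel. t \<in> {0<..<T} \<longrightarrow> (AE x in lborel. (t, x) \<in> Q \<longrightarrow> ennreal (W (t, x)) \<le> ennreal C0 *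
        ((\<integral>\<^sup>+y. ennreal (F (t, y) * norm (x - y) powr (1 - real CARD('d))) * indicator (ball x \<delta>) y \<partial>lborel) + 1)))"

text \<open>If \<open>p \<ge> s\<close> holds within distance \<open>\<delta>\<close> of \<open>A\<close>, then on the slices of \<open>A\<close> the pointwise bound only sees
the values of \<open>F\<close> where \<open>F powr s \<le> 1 + F powr p\<close>, and \<open>slice_integral_bound\<close> can be integrated in
time.\<close>

lemma level_set_integral_bound:
  fixes Q :: "(real \<times> (real^'d::finite)) set" and p :: "real \<times> (real^'d) \<Rightarrow> real"
  assumes s: "s > 1" and r: "0 < r" "r < 2" "r < 2 * s / real CARD('d)"
    and \<delta>: "\<delta> > 0" and C0: "C0 > 0" and V: "V \<ge> 0" and Q: "Q \<in> sets borel"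
    and pm: "p \<in> borel_measurable borel"
    and sec: "\<And>t. emeasure lborel {x. (t, x) \<in> Q} \<le> ennreal V"
    and Qfin: "emeasure lborel Q \<le> ennreal V'" "V' \<ge> 0"
    and Ifin: "T > 0" "\<And>t x. (t, x) \<in> Q \<Longrightarrow> t \<in> {0<..<T}"
    and A: "A \<in> sets borel" "A \<subseteq> Q"
    and near: "\<And>t x y. (t, x) \<in> A \<Longrightarrow> (t, y) \<in> Q \<Longrightarrow> dist x y < \<delta> \<Longrightarrow> s \<le> p (t, y)"
  shows "\<exists>C\<ge>0. \<forall>W F. admissible_pair \<delta> C0 T Q p W F \<longrightarrow>
     (\<integral>\<^sup>+z. ennreal (W z powr (s + r)) * indicator A z \<partial>lborel) \<le> ennreal C"
proof -
  obtain C where C: "C \<ge> 0" and bnd: "\<forall>(W::real^'d \<Rightarrow> real) F A.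
       W \<in> borel_measurable borel \<longrightarrow> F \<in> borel_measurable borel \<longrightarrow> A \<in> sets borel \<longrightarrow>
       (\<forall>x. W x \<ge> 0) \<longrightarrow> (\<forall>x. F x \<ge> 0) \<longrightarrow> emeasure lborel A \<le> ennreal V \<longrightarrow>
       (\<integral>\<^sup>+x. ennreal ((W x)\<^sup>2) * indicator A x \<partial>lborel) \<le> 1 \<longrightarrow>
       (AE x in lborel. x \<in> A \<longrightarrow> ennreal (W x) \<le> ennreal C0 *
          ((\<integral>\<^sup>+y. ennreal (F y * norm (x - y) powr (1 - real CARD('d))) * indicator (ball x \<delta>) y \<partial>lborel) + 1)) \<longrightarrow>
       (\<integral>\<^sup>+x. ennreal (W x powr (s + r)) * indicator A x \<partial>lborel)
          \<le> ennreal C * (1 + (\<integral>\<^sup>+y. ennreal (F y powr s) \<partial>lborel))"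
    using slice_integral_bound[where 'a="real^'d", OF s r(1,2) _ \<delta> C0 V] r(3) by auto
  define B where "B = C * (T + V' + 1)"
  show ?thesis
  proof (intro exI[of _ B] conjI allI impI)
    show "B \<ge> 0" using C Ifin(1) Qfin(2) by (simp add: B_def)
    fix W F :: "real \<times> (real^'d) \<Rightarrow> real"
    assume adm: "admissible_pair \<delta> C0 T Q p W F"
    then have [measurable]: "W \<in> borel_measurable borel" "F \<in> borel_measurable borel"
      and W0'': "\<forall>z. 0 \<le> W z" and F0'': "\<forall>z. 0 \<le> F z" and Fout': "\<forall>z. z \<notin> Q \<longrightarrow> F z = 0"
      and Fp: "(\<integral>\<^sup>+z. ennreal (F z powr p z) * indicator Q z \<partial>lborel) \<le> 1"
      and W2: "AE t in lborel. t \<in> {0<..<T} \<longrightarrow> (\<integral>\<^sup>+x. ennreal ((W (t, x))\<^sup>2) * indicator Q (t, x) \<partial>lborel) \<le> 1"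
      and pw: "AE t in lborel. t \<in> {0<..<T} \<longrightarrow> (AE x in lborel. (t, x) \<in> Q \<longrightarrow> ennreal (W (t, x)) \<le> ennreal C0 *
        ((\<integral>\<^sup>+y. ennreal (F (t, y) * norm (x - y) powr (1 - real CARD('d))) * indicator (ball x \<delta>) y \<partial>lborel) + 1))"
      unfolding admissible_pair_def by blast+
    note W0 = W0''[rule_format] and F0' = F0''[rule_format] and Fout = Fout'[rule_format]
    note [measurable] = pm Q A(1)
    have pairm: "Pair t \<in> borel \<rightarrow>\<^sub>M borel" for t :: real
      by (intro borel_measurable_continuous_onI continuous_intros)
    note [measurable] = measurable_compose[OF pairm]
    \<comment> \<open>the part of \<open>F\<close> that the pointwise bound sees from \<open>A\<close>\<close>
    define G where "G z = F z * indicator {z \<in> Q. s \<le> p z} z" for z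
    have [measurable]: "G \<in> borel_measurable borel" unfolding G_def by measurable
    have G0: "0 \<le> G z" for z using F0' by (simp add: G_def indicator_def)
    have Gs: "ennreal (G z powr s) \<le> indicator Q z + ennreal (F z powr p z) * indicator Q z" for z
    proof (cases "z \<in> Q \<and> s \<le> p z")
      case True
      then have "G z powr s \<le> 1 + F z powr p z"
        using powr_le_1_add_powr[of "F z" s "p z"] F0' s by (simp add: G_def)
      then have "ennreal (G z powr s) \<le> ennreal (1 + F z powr p z)" by (rule ennreal_leI)
      then show ?thesis using True by simp
    qed (auto simp: G_def)
    have sl: "AE t in lborel. (\<integral>\<^sup>+x. ennreal (W (t, x) powr (s + r)) * indicator A (t, x) \<partial>lborel) \<le>
        ennreal C * (indicator {0<..<T} t + (\<integral>\<^sup>+y. ennreal (G (t, y) powr s) \<partial>lborel))"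
      using W2 pw
    proof eventually_elim
      case (elim t)
      show ?case
      proof (cases "t \<in> {0<..<T}")
        case False
        then have "indicator A (t, x) = (0::ennreal)" for x
          using Ifin(2) A(2) by (auto simp: indicator_def)
        then show ?thesis by simp
      next
        case True
        let ?A = "{x. (t, x) \<in> A}"
        have Am: "?A \<in> sets borel"
          using measurable_sets[OF pairm A(1), of t] by (simp add: vimage_def)
        have ind: "indicator A (t, x) = indicator ?A x" for x by (simp add: indicator_def)
        have "(\<integral>\<^sup>+x. ennreal (W (t, x) powr (s + r)) * indicator ?A x \<partial>lborel)
          \<le> ennreal C * (1 + (\<integral>\<^sup>+y. ennreal (G (t, y) powr s) \<partial>lborel))"
        proof (rule bnd[rule_format])
          show "(\<lambda>x. W (t, x)) \<in> borel_measurable borel" "(\<lambda>x. G (t, x)) \<in> borel_measurable borel"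
            by (rule measurable_compose[OF pairm], measurable)+
          show "?A \<in> sets borel" by fact
          show "0 \<le> W (t, x)" "0 \<le> G (t, x)" for x using W0 G0 by auto
          have Qm: "{x. (t, x) \<in> Q} \<in> sets borel"
            using measurable_sets[OF pairm Q, of t] by (simp add: vimage_def)
          have "emeasure lborel ?A \<le> emeasure lborel {x. (t, x) \<in> Q}"
            using A(2) Qm by (intro emeasure_mono) auto
          then show "emeasure lborel ?A \<le> ennreal V" using sec[of t] by (rule order_trans)
          have "(\<integral>\<^sup>+x. ennreal ((W (t, x))\<^sup>2) * indicator ?A x \<partial>lborel) \<le> (\<integral>\<^sup>+x. ennreal ((W (t, x))\<^sup>2) * indicator Q (t, x) \<partial>lborel)"
            using A(2) by (intro nn_integral_mono) (auto simp: indicator_def)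
          then show "(\<integral>\<^sup>+x. ennreal ((W (t, x))\<^sup>2) * indicator ?A x \<partial>lborel) \<le> 1"
            using elim(1) True by (blast intro: order_trans)
          have "AE x in lborel. (t, x) \<in> Q \<longrightarrow> ennreal (W (t, x)) \<le> ennreal C0 *
            ((\<integral>\<^sup>+y. ennreal (F (t, y) * norm (x - y) powr (1 - real CARD('d))) * indicator (ball x \<delta>) y \<partial>lborel) + 1)"
            using elim(2) True by blast
          then show "AE x in lborel. x \<in> ?A \<longrightarrow> ennreal (W (t, x)) \<le> ennreal C0 *
            ((\<integral>\<^sup>+y. ennreal (G (t, y) * norm (x - y) powr (1 - real CARD('d))) * indicator (ball x \<delta>) y \<partial>lborel) + 1)"
          proof eventually_elim
            case (elim x)
            show ?case
            proof
              assume x: "x \<in> ?A"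
              have "F (t, y) = G (t, y)" if "dist x y < \<delta>" for y
                using near[of t x y] x that Fout by (cases "(t, y) \<in> Q") (auto simp: G_def)
              then have "ennreal (F (t, y) * norm (x - y) powr (1 - real CARD('d))) * indicator (ball x \<delta>) y =
                  ennreal (G (t, y) * norm (x - y) powr (1 - real CARD('d))) * indicator (ball x \<delta>) y" for y
                by (simp add: indicator_def)
              then show "ennreal (W (t, x)) \<le> ennreal C0 *
                ((\<integral>\<^sup>+y. ennreal (G (t, y) * norm (x - y) powr (1 - real CARD('d))) * indicator (ball x \<delta>) y \<partial>lborel) + 1)"
                using elim x A(2) by auto
            qed
          qed
        qed
        then show ?thesis using True by (simp add: ind)
      qed
    qed
    have "(\<integral>\<^sup>+z. ennreal (W z powr (s + r)) * indicator A z \<partial>lborel) =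
       (\<integral>\<^sup>+t. (\<integral>\<^sup>+x. ennreal (W (t, x) powr (s + r)) * indicator A (t, x) \<partial>lborel) \<partial>lborel)"
      by (rule nn_integral_lborel_pair) measurable
    also have "\<dots> \<le> (\<integral>\<^sup>+t. ennreal C * (indicator {0<..<T} t + (\<integral>\<^sup>+y. ennreal (G (t, y) powr s) \<partial>lborel)) \<partial>lborel)"
      using sl by (rule nn_integral_mono_AE)
    also have "\<dots> = ennreal C * (\<integral>\<^sup>+t. indicator {0<..<T} t + (\<integral>\<^sup>+y. ennreal (G (t, y) powr s) \<partial>lborel) \<partial>lborel)"
    proof (rule nn_integral_cmult)
      have "(\<lambda>z. ennreal (G z powr s)) \<in> borel_measurable (lborel \<Otimes>\<^sub>M lborel)"
        unfolding lborel_prod by measurable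
      from lborel.borel_measurable_nn_integral_fst[OF this]
      show "(\<lambda>t. indicator {0<..<T} t + (\<integral>\<^sup>+y. ennreal (G (t, y) powr s) \<partial>lborel)) \<in> borel_measurable lborel"
        by (intro borel_measurable_add) auto
    qed
    also have "(\<integral>\<^sup>+t. indicator {0<..<T} t + (\<integral>\<^sup>+y. ennreal (G (t, y) powr s) \<partial>lborel) \<partial>lborel) =
       ennreal T + (\<integral>\<^sup>+z. ennreal (G z powr s) \<partial>lborel)"
    proof -
      have m: "(\<lambda>z. ennreal (G z powr s)) \<in> borel_measurable (lborel \<Otimes>\<^sub>M lborel)"
        unfolding lborel_prod by measurable
      have "(\<integral>\<^sup>+t. indicator {0<..<T} t + (\<integral>\<^sup>+y. ennreal (G (t, y) powr s) \<partial>lborel) \<partial>lborel) =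
        (\<integral>\<^sup>+t. indicator {0<..<T} t \<partial>lborel) + (\<integral>\<^sup>+t. (\<integral>\<^sup>+y. ennreal (G (t, y) powr s) \<partial>lborel) \<partial>lborel)"
        using lborel.borel_measurable_nn_integral_fst[OF m] by (intro nn_integral_add) auto
      also have "(\<integral>\<^sup>+t. (\<integral>\<^sup>+y. ennreal (G (t, y) powr s) \<partial>lborel) \<partial>lborel) = (\<integral>\<^sup>+z. ennreal (G z powr s) \<partial>lborel)"
        by (rule nn_integral_lborel_pair[symmetric]) measurable
      also have "(\<integral>\<^sup>+t. indicator {0<..<T} t \<partial>lborel) = ennreal T" using Ifin(1) by simp
      finally show ?thesis .
    qed
    also have "(\<integral>\<^sup>+z. ennreal (G z powr s) \<partial>lborel) \<le> (\<integral>\<^sup>+z. indicator Q z + ennreal (F z powr p z) * indicator Q z \<partial>lborel)"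
      using Gs by (rule nn_integral_mono)
    also have "\<dots> = emeasure lborel Q + (\<integral>\<^sup>+z. ennreal (F z powr p z) * indicator Q z \<partial>lborel)"
      by (subst nn_integral_add) auto
    also have "\<dots> \<le> ennreal V' + 1" using Qfin(1) Fp by (rule add_mono)
    also have "ennreal C * (ennreal T + (ennreal V' + 1)) = ennreal B"
      using C Ifin(1) Qfin(2) by (simp add: B_def ennreal_mult add.assoc)
    finally show "(\<integral>\<^sup>+z. ennreal (W z powr (s + r)) * indicator A z \<partial>lborel) \<le> ennreal B"
      by (simp add: add_left_mono mult_left_mono)
  qed
qed

lemma parabolic_exponent_measurable [measurable]: "parabolic_exponent d \<in> borel_measurable borel"
  unfolding parabolic_exponent_def[abs_def] by measurable

text \<open>The cylinder is cut into the level sets \<open>A k\<close> of \<open>p\<close> of height \<open>\<eta> = \<epsilon> / 8\<close>.  Within distance \<open>\<delta>\<close> of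
\<open>A k\<close> the exponent drops by at most another \<open>\<eta>\<close>, so \<open>level_set_integral_bound\<close> applies with a
constant exponent that is at most \<open>\<epsilon> / 4\<close> below \<open>p\<close>.  Boundedness of \<open>p\<close> makes the number of level sets
finite.\<close>

lemma cylinder_modular_bound:
  fixes \<Omega> :: "(real^'d::finite) set" and p :: "real \<times> (real^'d) \<Rightarrow> real"
  assumes d: "CARD('d) \<ge> 2" and \<Omega>: "open \<Omega>" "bounded \<Omega>" and T: "T > 0" and \<epsilon>: "\<epsilon> > 0"
    and pc: "continuous_on (cylinder T \<Omega>) p" and P0: "P0 > 1"
    and pb: "\<And>z. z \<in> cylinder T \<Omega> \<Longrightarrow> P0 \<le> p z \<and> p z \<le> Pm"
    and \<delta>: "\<delta> > 0" and C0: "C0 > 0"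
    and osc: "\<And>t x y. (t, x) \<in> cylinder T \<Omega> \<Longrightarrow> (t, y) \<in> cylinder T \<Omega> \<Longrightarrow> dist x y < \<delta> \<Longrightarrow> \<bar>p (t, x) - p (t, y)\<bar> < \<epsilon> / 8"
    and \<epsilon>1: "\<epsilon> \<le> parabolic_exponent CARD('d) P0 - 1"
  shows "\<exists>C\<ge>0. \<forall>W F. admissible_pair \<delta> C0 T (cylinder T \<Omega>) p W F \<longrightarrow>
     (\<integral>\<^sup>+z. ennreal (W z powr (parabolic_exponent CARD('d) (p z) - \<epsilon>)) * indicator (cylinder T \<Omega>) z \<partial>lborel) \<le> ennreal C"
proof -
  let ?Q = "cylinder T \<Omega>"
  let ?P = "parabolic_exponent CARD('d)"
  define \<eta> where "\<eta> = \<epsilon> / 8"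
  have \<eta>: "\<eta> > 0" using \<epsilon> by (simp add: \<eta>_def)
  note Q = cylinder_lmeasurable[OF \<Omega>, of T]
  have Qb: "?Q \<in> sets borel" using Q(1) by simp
  define pB where "pB z = (if z \<in> ?Q then p z else 0)" for z
  have pBm [measurable]: "pB \<in> borel_measurable borel"
    unfolding pB_def[abs_def]
    by (intro borel_measurable_continuous_on_if Qb pc continuous_on_const)
  obtain V where V: "V \<ge> 0" "emeasure lborel \<Omega> = ennreal V"
    using emeasure_bounded_finite[OF \<Omega>(2)] by (cases "emeasure lborel \<Omega>") auto
  obtain V' where V': "V' \<ge> 0" "emeasure lborel ?Q = ennreal V'" "emeasure lborel ?Q \<le> ennreal V'"
    using emeasure_bounded_finite[OF Q(2)] by (cases "emeasure lborel ?Q") auto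
  have sec: "emeasure lborel {x. (t, x) \<in> ?Q} \<le> ennreal V" for t
  proof -
    have "emeasure lborel {x. (t, x) \<in> ?Q} \<le> emeasure lborel \<Omega>"
      using \<Omega>(1) by (intro emeasure_mono) (auto simp: cylinder_def)
    then show ?thesis by (simp add: V)
  qed
  define A where "A k = {z \<in> ?Q. P0 + real k * \<eta> \<le> pB z \<and> pB z < P0 + (real k + 1) * \<eta>}" for k
  have A: "A k \<in> sets borel" "A k \<subseteq> ?Q" for k
  proof -
    have m: "{z \<in> space borel. P0 + real k * \<eta> \<le> pB z} \<in> sets borel" "{z \<in> space borel. pB z < P0 + (real k + 1) * \<eta>} \<in> sets borel"
      by measurable
    have eq: "A k = ?Q \<inter> {z \<in> space borel. P0 + real k * \<eta> \<le> pB z} \<inter> {z \<in> space borel. pB z < P0 + (real k + 1) * \<eta>}"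
      by (auto simp: A_def)
    show "A k \<in> sets borel" unfolding eq by (intro sets.Int Qb m)
    show "A k \<subseteq> ?Q" by (auto simp: A_def)
  qed
  let ?f = "\<lambda>W z. ennreal (W z powr (?P (p z) - \<epsilon>))"
  have level: "\<exists>D\<ge>0. \<forall>W F. admissible_pair \<delta> C0 T (cylinder T \<Omega>) p W F \<longrightarrow> (\<integral>\<^sup>+z. ?f W z * indicator (A k) z \<partial>lborel) \<le> ennreal D" for k
  proof -
    \<comment> \<open>one level below \<open>A k\<close>; the truncated subtraction keeps \<open>s \<ge> P0 > 1\<close> for \<open>k = 0\<close>\<close>
    define s where "s = P0 + real (k - 1) * \<eta>"
    have "0 \<le> real (k - 1) * \<eta>" using \<eta> by simp
    then have s: "s > 1" using P0 unfolding s_def by linarith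
    obtain r where r: "0 < r" "r < 2" "r < 2 * s / real CARD('d)" "?P (s + \<epsilon> / 4) - \<epsilon> \<le> s + r"
      using interpolation_exponent_exists[OF d, of s \<epsilon>] s \<epsilon> by auto
    have near: "s \<le> pB (t, y)" if "(t, x) \<in> A k" "(t, y) \<in> ?Q" "dist x y < \<delta>" for t x y
    proof -
      have xQ: "(t, x) \<in> ?Q" using that(1) A(2) by blast
      have 1: "P0 + real k * \<eta> \<le> p (t, x)" using that(1) xQ by (simp add: A_def pB_def)
      have 2: "\<bar>p (t, x) - p (t, y)\<bar> < \<eta>" using osc[OF xQ that(2,3)] by (simp add: \<eta>_def)
      have 3: "P0 \<le> p (t, y)" using pb that(2) by blast
      have "s \<le> p (t, y)"
      proof (cases k)
        case 0 then show ?thesis using 3 by (simp add: s_def)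
      next
        case (Suc j) then show ?thesis using 1 2 by (simp add: s_def algebra_simps)
      qed
      then show ?thesis using that(2) by (simp add: pB_def)
    qed
    have IQ: "t \<in> {0<..<T}" if "(t, x) \<in> ?Q" for t x using that by (simp add: cylinder_def)
    have "\<exists>C\<ge>0. \<forall>W F. admissible_pair \<delta> C0 T ?Q pB W F \<longrightarrow> (\<integral>\<^sup>+z. ennreal (W z powr (s + r)) * indicator (A k) z \<partial>lborel) \<le> ennreal C"
    proof (rule level_set_integral_bound[where V=V and V'=V'])
      show "s > 1" "0 < r" "r < 2" "r < 2 * s / real CARD('d)" "\<delta> > 0" "C0 > 0" "V \<ge> 0" "?Q \<in> sets borel"
        "pB \<in> borel_measurable borel" "emeasure lborel ?Q \<le> ennreal V'" "V' \<ge> 0" "T > 0"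
        "A k \<in> sets borel" "A k \<subseteq> ?Q"
        by (fact s r \<delta> C0 V V' Qb pBm T A)+
      show "emeasure lborel {x. (t, x) \<in> ?Q} \<le> ennreal V" for t by (rule sec)
      show "t \<in> {0<..<T}" if "(t, x) \<in> ?Q" for t x using that by (rule IQ)
      show "s \<le> pB (t, y)" if "(t, x) \<in> A k" "(t, y) \<in> ?Q" "dist x y < \<delta>" for t x y
        using that by (rule near)
    qed
    then obtain C where "0 \<le> C \<and> (\<forall>W F. admissible_pair \<delta> C0 T ?Q pB W F \<longrightarrow> (\<integral>\<^sup>+z. ennreal (W z powr (s + r)) * indicator (A k) z \<partial>lborel) \<le> ennreal C)" ..
    then have C: "C \<ge> 0"
      and bnd: "\<And>W F. admissible_pair \<delta> C0 T ?Q pB W F \<Longrightarrow> (\<integral>\<^sup>+z. ennreal (W z powr (s + r)) * indicator (A k) z \<partial>lborel) \<le> ennreal C"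
      by blast+
    have expo: "?P (p z) - \<epsilon> \<le> s + r \<and> 0 \<le> ?P (p z) - \<epsilon>" if "z \<in> A k" for z
    proof -
      have zQ: "z \<in> ?Q" using that A(2) by blast
      have "p z < P0 + (real k + 1) * \<eta>" using that zQ by (simp add: A_def pB_def)
      also have "\<dots> \<le> s + \<epsilon> / 4"
        using \<eta> by (cases k) (auto simp: s_def \<eta>_def algebra_simps)
      finally have "?P (p z) \<le> ?P (s + \<epsilon> / 4)"
        using d P0 pb[OF zQ] by (intro parabolic_exponent_mono) auto
      moreover have "?P P0 \<le> ?P (p z)"
        using d P0 pb[OF zQ] by (intro parabolic_exponent_mono) auto
      ultimately show ?thesis using r(4) \<epsilon>1 by linarith
    qed
    show ?thesis
    proof (intro exI[of _ "V' + C"] conjI allI impI)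
      show "V' + C \<ge> 0" using V' C by simp
      fix W F assume adm: "admissible_pair \<delta> C0 T (cylinder T \<Omega>) p W F"
      have eq: "(\<integral>\<^sup>+z. ennreal (F z powr pB z) * indicator ?Q z \<partial>lborel) = (\<integral>\<^sup>+z. ennreal (F z powr p z) * indicator ?Q z \<partial>lborel)"
        by (intro nn_integral_cong) (auto simp: indicator_def pB_def)
      have "admissible_pair \<delta> C0 T ?Q pB W F" using adm unfolding admissible_pair_def eq .
      then have "(\<integral>\<^sup>+z. ennreal (W z powr (s + r)) * indicator (A k) z \<partial>lborel) \<le> ennreal C"
        by (rule bnd)
      note 1 = this
      have [measurable]: "W \<in> borel_measurable borel" and W0: "\<And>z. 0 \<le> W z"
        using adm unfolding admissible_pair_def by blast+
      have "(\<integral>\<^sup>+z. ?f W z * indicator (A k) z \<partial>lborel) \<le>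
         (\<integral>\<^sup>+z. indicator ?Q z + ennreal (W z powr (s + r)) * indicator (A k) z \<partial>lborel)"
      proof (rule nn_integral_mono)
        fix z
        show "?f W z * indicator (A k) z \<le> indicator ?Q z + ennreal (W z powr (s + r)) * indicator (A k) z"
        proof (cases "z \<in> A k")
          case True
          then have "z \<in> ?Q" using A(2) by blast
          have "ennreal (W z powr (?P (p z) - \<epsilon>)) \<le> ennreal (1 + W z powr (s + r))"
            using expo[OF True] W0[of z] by (intro ennreal_leI powr_le_1_add_powr) auto
          then show ?thesis using True \<open>z \<in> ?Q\<close> by simp
        qed simp
      qed
      also have "\<dots> = emeasure lborel ?Q + (\<integral>\<^sup>+z. ennreal (W z powr (s + r)) * indicator (A k) z \<partial>lborel)"
        using Qb A(1)[of k] by (subst nn_integral_add) auto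
      also have "\<dots> \<le> ennreal V' + ennreal C" using 1 V'(2) by (intro add_mono) auto
      finally show "(\<integral>\<^sup>+z. ?f W z * indicator (A k) z \<partial>lborel) \<le> ennreal (V' + C)"
        using V' C by simp
    qed
  qed
  have "\<exists>D. \<forall>k. 0 \<le> D k \<and> (\<forall>W F. admissible_pair \<delta> C0 T (cylinder T \<Omega>) p W F \<longrightarrow> (\<integral>\<^sup>+z. ?f W z * indicator (A k) z \<partial>lborel) \<le> ennreal (D k))"
    using level by (intro choice allI) blast
  then obtain D where D: "\<forall>k. 0 \<le> D k \<and> (\<forall>W F. admissible_pair \<delta> C0 T (cylinder T \<Omega>) p W F \<longrightarrow> (\<integral>\<^sup>+z. ?f W z * indicator (A k) z \<partial>lborel) \<le> ennreal (D k))" ..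
  define K where "K = Suc (nat \<lfloor>(Pm - P0) / \<eta>\<rfloor>)"
  show ?thesis
  proof (intro exI[of _ "\<Sum>k<K. D k"] conjI allI impI)
    show "(\<Sum>k<K. D k) \<ge> 0" using D by (intro sum_nonneg) blast
    fix W F assume adm: "admissible_pair \<delta> C0 T (cylinder T \<Omega>) p W F"
    have [measurable]: "W \<in> borel_measurable borel" using adm unfolding admissible_pair_def by blast
    have cover: "\<exists>k<K. z \<in> A k" if z: "z \<in> ?Q" for z
    proof -
      define k where "k = nat \<lfloor>(p z - P0) / \<eta>\<rfloor>"
      have ge: "0 \<le> (p z - P0) / \<eta>" using pb[OF z] \<eta> by simp
      have "real k \<le> (p z - P0) / \<eta>" "(p z - P0) / \<eta> < real k + 1"
        using ge unfolding k_def by linarith+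
      then have "P0 + real k * \<eta> \<le> p z" "p z < P0 + (real k + 1) * \<eta>"
        using \<eta> by (simp_all add: field_simps)
      then have "z \<in> A k" using z by (simp add: A_def pB_def)
      moreover have "(p z - P0) / \<eta> \<le> (Pm - P0) / \<eta>"
        using pb[OF z] \<eta> by (intro divide_right_mono) auto
      then have "k < K" unfolding k_def K_def by (simp add: less_Suc_eq_le nat_mono floor_mono)
      ultimately show ?thesis by blast
    qed
    define g where "g k z = ?f W z * indicator (A k) z" for k z
    have gm: "(\<lambda>z. g k z) \<in> borel_measurable lborel" for k
    proof -
      have eq: "g k = (\<lambda>z. ennreal (W z powr (?P (pB z) - \<epsilon>)) * indicator (A k) z)"
        using A(2)[of k] by (auto simp: g_def fun_eq_iff indicator_def pB_def)
      note [measurable] = A(1)[of k]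
      show ?thesis unfolding eq by measurable
    qed
    have "(\<integral>\<^sup>+z. ?f W z * indicator ?Q z \<partial>lborel) \<le> (\<integral>\<^sup>+z. (\<Sum>k<K. g k z) \<partial>lborel)"
    proof (rule nn_integral_mono)
      fix z
      show "?f W z * indicator ?Q z \<le> (\<Sum>k<K. g k z)"
      proof (cases "z \<in> ?Q")
        case True
        then obtain k where k: "k < K" "z \<in> A k" using cover by blast
        have "g k z \<le> (\<Sum>k<K. g k z)" using k(1) by (intro member_le_sum) auto
        then show ?thesis using True k(2) by (simp add: g_def)
      qed simp
    qed
    also have "\<dots> = (\<Sum>k<K. \<integral>\<^sup>+z. g k z \<partial>lborel)" using gm by (intro nn_integral_sum) auto
    also have "\<dots> \<le> (\<Sum>k<K. ennreal (D k))"
      unfolding g_def using D adm by (intro sum_mono) blast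
    also have "\<dots> = ennreal (\<Sum>k<K. D k)" using D by (intro sum_ennreal) blast
    finally show "(\<integral>\<^sup>+z. ?f W z * indicator ?Q z \<partial>lborel) \<le> ennreal (\<Sum>k<K. D k)" .
  qed
qed

section \<open>The parabolic embedding\<close>

text \<open>A nonempty open set has positive measure, so for a continuous function an essential lower bound is a
pointwise one.  Positivity of the essential infimum excludes the value that the
conversion of an infinite number to a real number would give.\<close>

lemma ess_inf_le_continuous:
  fixes p :: "'a::euclidean_space \<Rightarrow> real"
  assumes G: "open G" and p: "continuous_on G p" and pos: "ess_inf G p > 0" and z: "z \<in> G"
  shows "ess_inf G p \<le> p z"
proof (rule ccontr)
  assume neg: "\<not> ess_inf G p \<le> p z"
  let ?S = "G \<inter> p -` {..<ess_inf G p}"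
  define e where "e = esssup (lebesgue_on G) (\<lambda>x. - ereal (p x))"
  have E: "ess_inf G p = real_of_ereal (- e)" by (simp add: ess_inf_def e_def)
  then obtain m where m: "e = ereal m" using pos by (cases e) auto
  have "AE x in lebesgue_on G. - ereal (p x) \<le> e" unfolding e_def by (rule esssup_AE)
  then have "AE x in lebesgue_on G. ess_inf G p \<le> p x"
    by eventually_elim (simp add: E m)
  then have "AE x in lebesgue. x \<in> G \<longrightarrow> ess_inf G p \<le> p x"
    using G by (simp add: AE_restrict_space_iff)
  then have ae: "AE x in lebesgue. x \<notin> ?S" by eventually_elim auto
  have op: "open ?S" using continuous_open_preimage[OF p G open_lessThan] .
  then have "?S \<in> sets lebesgue" by simp
  then have "negligible ?S" using ae unfolding negligible_iff_null_sets by (simp only: AE_iff_null_sets)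
  moreover have "?S \<noteq> {}" using neg z by auto
  ultimately show False using op open_not_negligible by blast
qed

lemma modular_finite_of_scaled:
  assumes l: "l > 0" and fin: "modular G q (\<lambda>x. (1 / l) *\<^sub>R f x) < \<infinity>" and q: "\<And>x. x \<in> G \<Longrightarrow> 0 \<le> q x \<and> q x \<le> Qm"
    and [measurable]: "q \<in> borel_measurable (lebesgue_on G)" "f \<in> borel_measurable (lebesgue_on G)"
  shows "modular G q f < \<infinity>"
proof -
  have "modular G q f \<le> (\<integral>\<^sup>+x. ennreal (max 1 l powr Qm) * ennreal (norm ((1 / l) *\<^sub>R f x) powr q x) \<partial>lebesgue_on G)"
    unfolding modular_def
  proof (rule nn_integral_mono)
    fix x assume "x \<in> space (lebesgue_on G)"
    then have qx: "0 \<le> q x" "q x \<le> Qm" using q by auto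
    have "norm (f x) powr q x = (l * norm ((1 / l) *\<^sub>R f x)) powr q x" using l by simp
    also have "\<dots> = l powr q x * norm ((1 / l) *\<^sub>R f x) powr q x" using l by (intro powr_mult)
    also have "l powr q x \<le> max 1 l powr Qm"
      using l qx powr_mono2[of "q x" l "max 1 l"] powr_mono[of "q x" Qm "max 1 l"] by linarith
    finally have "norm (f x) powr q x \<le> max 1 l powr Qm * norm ((1 / l) *\<^sub>R f x) powr q x"
      by (simp add: mult_right_mono)
    then show "ennreal (norm (f x) powr q x) \<le> ennreal (max 1 l powr Qm) * ennreal (norm ((1 / l) *\<^sub>R f x) powr q x)"
      by (subst ennreal_mult[symmetric]) (auto intro: ennreal_leI)
  qed
  also have "\<dots> = ennreal (max 1 l powr Qm) * modular G q (\<lambda>x. (1 / l) *\<^sub>R f x)"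
    unfolding modular_def by (rule nn_integral_cmult) measurable
  also have "\<dots> < \<infinity>" using fin by (simp add: ennreal_mult_less_top)
  finally show ?thesis .
qed

lemma Lp_var_integrable:
  assumes E: "E \<in> Lp_var G q" and q: "\<And>x. x \<in> G \<Longrightarrow> q x \<ge> 1" and qm: "q \<in> borel_measurable (lebesgue_on G)"
    and G: "G \<in> lmeasurable"
  shows "integrable (lebesgue_on G) E"
proof -
  obtain l where l: "l > 0" "modular G q (\<lambda>x. (1 / l) *\<^sub>R E x) \<le> 1"
    using Lp_var_modular_unit_scale[OF E q qm] by blast
  have Em: "E \<in> borel_measurable (lebesgue_on G)" using E by (simp add: Lp_var_def)
  obtain V where V: "V \<ge> 0" "emeasure lebesgue G \<le> ennreal V"
    using G by (cases "emeasure lebesgue G") (auto simp: fmeasurable_def)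
  have "(\<integral>\<^sup>+x. ennreal (norm (E x)) \<partial>lebesgue_on G) \<le> ennreal (l * (V + 1))"
    by (rule L1_le_of_scaled_modular[OF Em qm q l V]) (use G in auto)
  also have "\<dots> < \<infinity>" by simp
  finally show ?thesis using Em by (simp add: integrable_iff_bounded)
qed

lemma L2_integrable:
  assumes f: "f \<in> L2 G" and G: "G \<in> lmeasurable"
  shows "integrable (lebesgue_on G) f"
proof -
  have fm: "f \<in> borel_measurable (lebesgue_on G)" using f by (simp add: L2_def)
  have "f \<in> Lp_var G (\<lambda>_. 2)"
  proof -
    have "integrable (lebesgue_on G) (\<lambda>x. (norm (f x))\<^sup>2)" using f by (simp add: L2_def)
    then have "(\<integral>\<^sup>+x. ennreal ((norm (f x))\<^sup>2) \<partial>lebesgue_on G) < \<infinity>"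
      by (simp add: integrable_iff_bounded)
    then show ?thesis using fm by (simp add: Lp_var_def modular_def)
  qed
  then show ?thesis by (rule Lp_var_integrable) (use G in auto)
qed

text \<open>The essential supremum is finite by assumption and nonnegative because the time interval is not a null
set, so its real value is a genuine upper bound.\<close>

lemma Y_inf_norm_bound:
  assumes T: "T > 0" and u: "u \<in> Y_inf T \<Omega>"
  shows "0 \<le> Y_inf_norm T \<Omega> u" "AE t in lebesgue_on {0<..<T}. L2_norm \<Omega> (\<lambda>x. u (t, x)) \<le> Y_inf_norm T \<Omega> u"
proof -
  let ?e = "Y_inf_ess_norm T \<Omega> u"
  have ae: "AE t in lebesgue_on {0<..<T}. ereal (L2_norm \<Omega> (\<lambda>x. u (t, x))) \<le> ?e"
    unfolding Y_inf_ess_norm_def by (rule esssup_AE)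
  have nt: "ae_filter (lebesgue_on {0<..<T}) \<noteq> bot"
    using T by (simp add: ae_filter_eq_bot_iff emeasure_restrict_space)
  obtain t where "ereal (L2_norm \<Omega> (\<lambda>x. u (t, x))) \<le> ?e"
    using eventually_happens'[OF nt ae] by blast
  moreover have "0 \<le> L2_norm \<Omega> (\<lambda>x. u (t, x))"
    unfolding L2_norm_def by (intro real_sqrt_ge_zero integral_nonneg) auto
  ultimately have "0 \<le> ?e" by (metis ereal_less_eq(5) order_trans)
  moreover have "?e < \<infinity>" using u by (simp add: Y_inf_def)
  ultimately obtain y where y: "?e = ereal y" "0 \<le> y" by (cases ?e) auto
  show "0 \<le> Y_inf_norm T \<Omega> u" by (simp add: Y_inf_norm_def y)
  show "AE t in lebesgue_on {0<..<T}. L2_norm \<Omega> (\<lambda>x. u (t, x)) \<le> Y_inf_norm T \<Omega> u"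
    using ae by eventually_elim (simp add: y Y_inf_norm_def)
qed

lemma Lp_var_norm_le:
  assumes "l > 0" "modular G q (\<lambda>x. (1 / l) *\<^sub>R f x) \<le> 1"
  shows "Lp_var_norm G q f \<le> l"
  unfolding Lp_var_norm_def using assms by (intro cInf_lower bdd_belowI[of _ 0]) auto

lemma nn_integral_lebesgue_on_rep:
  fixes g :: "'a::euclidean_space \<Rightarrow> real"
  assumes G: "G \<in> sets lebesgue" and rep: "AE x in lborel. x \<in> G \<longrightarrow> h x = k x"
  shows "(\<integral>\<^sup>+x. h x \<partial>lebesgue_on G) = (\<integral>\<^sup>+x. k x * indicator G x \<partial>lborel)"
proof -
  have "(\<integral>\<^sup>+x. h x \<partial>lebesgue_on G) = (\<integral>\<^sup>+x. h x * indicator G x \<partial>lebesgue)"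
    using G by (subst nn_integral_restrict_space) auto
  also have "\<dots> = (\<integral>\<^sup>+x. h x * indicator G x \<partial>lborel)" by (rule nn_integral_completion)
  also have "\<dots> = (\<integral>\<^sup>+x. k x * indicator G x \<partial>lborel)"
  proof (rule nn_integral_cong_AE)
    show "AE x in lborel. h x * indicator G x = k x * indicator G x"
      using rep by eventually_elim (simp add: indicator_def)
  qed
  finally show ?thesis .
qed

text \<open>Collects what membership in the energy space of the cylinder gives for the chosen gradient and for
almost every slice.\<close>

lemma energy_slices:
  fixes \<Omega> :: "(real^'d::finite) set"
  assumes \<Omega>: "open \<Omega>" "bounded \<Omega>"
    and pm: "p \<in> borel_measurable (lebesgue_on (cylinder T \<Omega>))" and p1': "\<forall>z\<in>cylinder T \<Omega>. 1 \<le> p z"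
    and u: "u \<in> X_cyl T \<Omega> p"
  defines "E \<equiv> sym_grad cyl_dir (cylinder T \<Omega>) u"
  shows "E \<in> Lp_var (cylinder T \<Omega>) p" "integrable (lebesgue_on (cylinder T \<Omega>)) E" "integrable (lebesgue_on (cylinder T \<Omega>)) u"
    "AE t in lebesgue_on {0<..<T}. (\<lambda>x. u (t, x)) \<in> X_space \<Omega> (\<lambda>x. p (t, x)) \<and>
       is_sym_grad space_dir \<Omega> (\<lambda>x. u (t, x)) (\<lambda>x. E (t, x))"
proof -
  let ?Q = "cylinder T \<Omega>"
  note p1 = p1'[rule_format]
  note Q = cylinder_lmeasurable[OF \<Omega>, of T]
  have uL2: "u \<in> L2 ?Q" and ex: "\<exists>E'\<in>Lp_var_sym ?Q p. is_sym_grad cyl_dir ?Q u E'"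
    and sl: "AE t in lebesgue_on {0<..<T}. (\<lambda>x. u (t, x)) \<in> X_space \<Omega> (\<lambda>x. p (t, x))"
    using u unfolding X_cyl_def sym_energy_def by blast+
  from ex obtain E' where E': "E' \<in> Lp_var_sym ?Q p" "is_sym_grad cyl_dir ?Q u E'" by blast
  have Eg: "is_sym_grad cyl_dir ?Q u E" unfolding E_def using E'(2) by (rule is_sym_grad_sym_grad)
  have "E' \<in> Lp_var ?Q p" using E'(1) unfolding Lp_var_sym_def by blast
  then show ELp: "E \<in> Lp_var ?Q p"
    using sym_grad_unique[OF Q(1) E'(2) Eg] Q(4) by (rule Lp_var_cong_AE)
  show iE: "integrable (lebesgue_on ?Q) E" using ELp p1 pm Q(3) by (rule Lp_var_integrable)
  show iu: "integrable (lebesgue_on ?Q) u" using uL2 Q(3) by (rule L2_integrable)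
  have cE: "integrable (lebesgue_on ?Q) (\<lambda>z. E z $ i $ j)" for i j
    using integrable_inner_left[of "axis i (axis j 1)" "lebesgue_on ?Q" E] iE by (simp add: inner_axis)
  have cu: "integrable (lebesgue_on ?Q) (\<lambda>z. u z $ i)" for i
    using integrable_inner_left[of "axis i 1" "lebesgue_on ?Q" u] iu by (simp add: inner_axis)
  have "AE t in lebesgue_on {0<..<T}. \<exists>F. is_sym_grad space_dir \<Omega> (\<lambda>x. u (t, x)) F"
    using sl by eventually_elim (unfold X_space_def sym_energy_def, blast)
  then have "AE t in lebesgue_on {0<..<T}. is_sym_grad space_dir \<Omega> (\<lambda>x. u (t, x)) (\<lambda>x. E (t, x))"
    by (rule sym_grad_slices[OF \<Omega> Eg cE cu])
  with sl show "AE t in lebesgue_on {0<..<T}. (\<lambda>x. u (t, x)) \<in> X_space \<Omega> (\<lambda>x. p (t, x)) \<and>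
       is_sym_grad space_dir \<Omega> (\<lambda>x. u (t, x)) (\<lambda>x. E (t, x))"
    by eventually_elim (rule conjI)
qed

text \<open>The pointwise bound of a slice is homogeneous, so it may be divided by \<open>N\<close>; its second term is at most
\<open>C (V + 1)\<close> because \<open>\<integral> |u(t)| \<le> N (V + 1)\<close> on a domain of volume at most \<open>V\<close>.\<close>

lemma scaled_pair_admissible:
  fixes \<Omega> :: "(real^'d::finite) set" and p :: "real \<times> (real^'d) \<Rightarrow> real"
  assumes \<delta>: "\<delta> > 0" and T: "T > 0" and \<Omega>: "open \<Omega>" "bounded \<Omega>"
  shows "\<exists>C0>0. \<forall>p Pm u N. continuous_on (cylinder T \<Omega>) p \<longrightarrow> (\<forall>z\<in>cylinder T \<Omega>. 1 \<le> p z \<and> p z \<le> Pm) \<longrightarrow>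
    u \<in> X_cyl T \<Omega> p \<longrightarrow> u \<in> Y_inf T \<Omega> \<longrightarrow>
    Lp_var_norm (cylinder T \<Omega>) p (sym_grad cyl_dir (cylinder T \<Omega>) u) < N \<longrightarrow> Y_inf_norm T \<Omega> u < N \<longrightarrow>
    (\<exists>W F. admissible_pair \<delta> C0 T (cylinder T \<Omega>) p W F \<and>
       (AE z in lborel. z \<in> cylinder T \<Omega> \<longrightarrow> norm (u z) / N = W z))"
proof -
  let ?Q = "cylinder T \<Omega>"
  let ?d = "real CARD('d)"
  let ?I = "{0<..<T}"
  note Q = cylinder_lmeasurable[OF \<Omega>, of T]
  have \<Omega>l: "\<Omega> \<in> lmeasurable" using \<Omega> lmeasurable_open by blast
  then have \<Omega>s: "\<Omega> \<in> sets lebesgue" by auto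
  obtain V where V: "V \<ge> 0" "emeasure lebesgue \<Omega> \<le> ennreal V"
    using \<Omega>l by (cases "emeasure lebesgue \<Omega>") (auto simp: fmeasurable_def)
  from slice_pointwise_bound[OF \<delta>, where 'd='d]
  obtain C where "C > 0 \<and> (\<forall>\<Omega> q (f :: real^'d \<Rightarrow> real^'d) E Q. open \<Omega> \<longrightarrow> bounded \<Omega> \<longrightarrow> q \<in> borel_measurable (lebesgue_on \<Omega>) \<longrightarrow>
       (\<forall>x\<in>\<Omega>. 1 \<le> q x \<and> q x \<le> Q) \<longrightarrow> f \<in> X_space \<Omega> q \<longrightarrow> is_sym_grad space_dir \<Omega> f E \<longrightarrow>
     (AE x in lebesgue_on \<Omega>. ennreal (norm (f x)) \<le> ennreal C *
       ((\<integral>\<^sup>+y. ennreal (norm (E y) * norm (x - y) powr (1 - real CARD('d))) * indicator (ball x \<delta>) y \<partial>lebesgue_on \<Omega>)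
        + (\<integral>\<^sup>+y. ennreal (norm (f y)) \<partial>lebesgue_on \<Omega>))))" ..
  note C0' = conjunct1[OF this] and C' = conjunct2[OF this, rule_format]
  show ?thesis
  proof (intro exI[of _ "C * (V + 1)"] conjI allI impI)
    show "C * (V + 1) > 0" using C0' V(1) by simp
    fix p :: "real \<times> (real^'d) \<Rightarrow> real" and Pm u N
    assume pc: "continuous_on ?Q p" and pb: "\<forall>z\<in>?Q. 1 \<le> p z \<and> p z \<le> Pm"
      and uX: "u \<in> X_cyl T \<Omega> p" and uY: "u \<in> Y_inf T \<Omega>"
      and NE: "Lp_var_norm ?Q p (sym_grad cyl_dir ?Q u) < N" and NY: "Y_inf_norm T \<Omega> u < N"
    define E where "E = sym_grad cyl_dir ?Q u"
    have pm: "p \<in> borel_measurable (lebesgue_on ?Q)"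
      using pc Q(4) by (rule continuous_imp_measurable_on_sets_lebesgue)
    have p1: "\<forall>z\<in>?Q. 1 \<le> p z" using pb by blast
    note es = energy_slices[OF \<Omega> pm p1 uX, folded E_def]
    have N: "N > 0" using Y_inf_norm_bound(1)[OF T uY] NY by linarith
    obtain nu where nu: "nu \<in> borel_measurable borel" "AE z in lborel. indicator ?Q z * norm (u z) = nu z"
      using lebesgue_on_borel_rep[OF Q(4) integrable_norm[OF es(3)]] by blast
    obtain ne where ne: "ne \<in> borel_measurable borel" "AE z in lborel. indicator ?Q z * norm (E z) = ne z"
      using lebesgue_on_borel_rep[OF Q(4) integrable_norm[OF es(2)]] by blast
    define W where "W z = \<bar>nu z\<bar> / N" for z
    define F where "F z = indicator ?Q z * (\<bar>ne z\<bar> / N)" for z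
    have Qb: "?Q \<in> sets borel" using Q(1) by simp
    note [measurable] = nu(1) ne(1) Qb
    have Wm: "W \<in> borel_measurable borel" and Fm: "F \<in> borel_measurable borel"
      unfolding W_def[abs_def] F_def[abs_def] by measurable
    have W0: "\<forall>z. 0 \<le> W z" and F0: "\<forall>z. 0 \<le> F z" and Fout: "\<forall>z. z \<notin> ?Q \<longrightarrow> F z = 0"
      using N by (simp_all add: W_def F_def)
    have Wu: "AE z in lborel. z \<in> ?Q \<longrightarrow> norm (u z) / N = W z"
      using nu(2)
    proof (eventually_elim, intro impI)
      fix z assume "indicator ?Q z * norm (u z) = nu z" "z \<in> ?Q"
      then have "nu z = norm (u z)" by simp
      then show "norm (u z) / N = W z" by (simp add: W_def)
    qed
    have FE: "AE z in lborel. z \<in> ?Q \<longrightarrow> norm (E z) / N = F z"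
      using ne(2)
    proof (eventually_elim, intro impI)
      fix z assume z: "indicator ?Q z * norm (E z) = ne z" "z \<in> ?Q"
      then have "ne z = norm (E z)" by simp
      then show "norm (E z) / N = F z" using z(2) by (simp add: F_def)
    qed
    have Fp: "(\<integral>\<^sup>+z. ennreal (F z powr p z) * indicator ?Q z \<partial>lborel) \<le> 1"
    proof -
      have "AE z in lborel. z \<in> ?Q \<longrightarrow> ennreal (norm ((1 / N) *\<^sub>R E z) powr p z) = ennreal (F z powr p z)"
        using FE
      proof (eventually_elim, intro impI)
        fix z assume "z \<in> ?Q \<longrightarrow> norm (E z) / N = F z" "z \<in> ?Q"
        then have "norm ((1 / N) *\<^sub>R E z) = F z" using N by simp
        then show "ennreal (norm ((1 / N) *\<^sub>R E z) powr p z) = ennreal (F z powr p z)" by (simp only:)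
      qed
      from nn_integral_lebesgue_on_rep[OF Q(4) this]
      have "(\<integral>\<^sup>+z. ennreal (F z powr p z) * indicator ?Q z \<partial>lborel) = modular ?Q p (\<lambda>z. (1 / N) *\<^sub>R E z)"
        by (simp add: modular_def)
      also have "\<dots> \<le> 1"
        by (rule modular_le_1_of_norm_less[OF es(1) p1[rule_format] pm NE[folded E_def] Q(4)])
      finally show ?thesis .
    qed
    have Is: "?I \<in> sets lebesgue" by simp
    have sl: "AE t in lborel. t \<in> ?I \<longrightarrow>
       (\<integral>\<^sup>+x. ennreal ((W (t, x))\<^sup>2) * indicator ?Q (t, x) \<partial>lborel) \<le> 1 \<and>
       (AE x in lborel. (t, x) \<in> ?Q \<longrightarrow> ennreal (W (t, x)) \<le> ennreal (C * (V + 1)) *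
        ((\<integral>\<^sup>+y. ennreal (F (t, y) * norm (x - y) powr (1 - ?d)) * indicator (ball x \<delta>) y \<partial>lborel) + 1))"
      using AE_lebesgue_on_imp_lborel[OF es(4) Is] AE_lebesgue_on_imp_lborel[OF Y_inf_norm_bound(2)[OF T uY] Is]
        AE_lborel_slices[OF Wu] AE_lborel_slices[OF FE]
    proof (eventually_elim, intro impI)
      fix t assume "t \<in> ?I \<longrightarrow> (\<lambda>x. u (t, x)) \<in> X_space \<Omega> (\<lambda>x. p (t, x)) \<and> is_sym_grad space_dir \<Omega> (\<lambda>x. u (t, x)) (\<lambda>x. E (t, x))"
        and "t \<in> ?I \<longrightarrow> L2_norm \<Omega> (\<lambda>x. u (t, x)) \<le> Y_inf_norm T \<Omega> u"
        and Wt: "AE x in lborel. (t, x) \<in> ?Q \<longrightarrow> norm (u (t, x)) / N = W (t, x)"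
        and Ft: "AE x in lborel. (t, x) \<in> ?Q \<longrightarrow> norm (E (t, x)) / N = F (t, x)"
        and t: "t \<in> ?I"
      then have X: "(\<lambda>x. u (t, x)) \<in> X_space \<Omega> (\<lambda>x. p (t, x))" and S: "is_sym_grad space_dir \<Omega> (\<lambda>x. u (t, x)) (\<lambda>x. E (t, x))"
        and L: "L2_norm \<Omega> (\<lambda>x. u (t, x)) < N" using NY by auto
      have tQ: "(t, x) \<in> ?Q \<longleftrightarrow> x \<in> \<Omega>" for x using t by (simp add: cylinder_def)
      have L2t: "(\<lambda>x. u (t, x)) \<in> L2 \<Omega>" using X unfolding X_space_def sym_energy_def by blast
      have um: "(\<lambda>x. u (t, x)) \<in> borel_measurable (lebesgue_on \<Omega>)" using L2t unfolding L2_def by blast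
      have m2: "modular \<Omega> (\<lambda>_. 2) (\<lambda>x. (1 / N) *\<^sub>R u (t, x)) \<le> 1"
        using L2t L by (rule modular_2_le_1_of_L2_norm_less)
      have "AE x in lborel. x \<in> \<Omega> \<longrightarrow> ennreal (norm ((1 / N) *\<^sub>R u (t, x)) powr 2) = ennreal ((W (t, x))\<^sup>2)"
        using Wt
      proof (eventually_elim, intro impI)
        fix x assume "(t, x) \<in> ?Q \<longrightarrow> norm (u (t, x)) / N = W (t, x)" "x \<in> \<Omega>"
        then have "norm ((1 / N) *\<^sub>R u (t, x)) = W (t, x)" using N tQ by simp
        then show "ennreal (norm ((1 / N) *\<^sub>R u (t, x)) powr 2) = ennreal ((W (t, x))\<^sup>2)"
          using W0 by (simp only: powr_numeral)
      qed
      from nn_integral_lebesgue_on_rep[OF \<Omega>s this]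
      have "(\<integral>\<^sup>+x. ennreal ((W (t, x))\<^sup>2) * indicator \<Omega> x \<partial>lborel) \<le> 1"
        using m2 by (simp add: modular_def)
      moreover have "indicator ?Q (t, x) = (indicator \<Omega> x :: ennreal)" for x using tQ by (simp add: indicator_def)
      ultimately have H2: "(\<integral>\<^sup>+x. ennreal ((W (t, x))\<^sup>2) * indicator ?Q (t, x) \<partial>lborel) \<le> 1" by simp
      have L1: "(\<integral>\<^sup>+x. ennreal (norm (u (t, x))) \<partial>lebesgue_on \<Omega>) \<le> ennreal (N * (V + 1))"
        by (rule L1_le_of_scaled_modular[OF um _ _ N m2 V \<Omega>s]) auto
      have pt: "(\<lambda>x. p (t, x)) \<in> borel_measurable (lebesgue_on \<Omega>)"
        using \<Omega>s by (intro continuous_imp_measurable_on_sets_lebesgue continuous_on_compose2[OF pc] continuous_intros) (auto simp: tQ)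
      have "AE x in lebesgue_on \<Omega>. ennreal (norm (u (t, x))) \<le> ennreal C *
       ((\<integral>\<^sup>+y. ennreal (norm (E (t, y)) * norm (x - y) powr (1 - ?d)) * indicator (ball x \<delta>) y \<partial>lebesgue_on \<Omega>)
        + (\<integral>\<^sup>+y. ennreal (norm (u (t, y))) \<partial>lebesgue_on \<Omega>))"
        by (rule C'[OF \<Omega> pt _ X S, of Pm]) (use pb tQ in blast)
      from AE_lebesgue_on_imp_lborel[OF this \<Omega>s] Wt
      have H3: "AE x in lborel. (t, x) \<in> ?Q \<longrightarrow> ennreal (W (t, x)) \<le> ennreal (C * (V + 1)) *
        ((\<integral>\<^sup>+y. ennreal (F (t, y) * norm (x - y) powr (1 - ?d)) * indicator (ball x \<delta>) y \<partial>lborel) + 1)"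
      proof (eventually_elim, intro impI)
        fix x :: "real^'d"
        let ?K = "\<lambda>y. norm (x - y) powr (1 - ?d)"
        let ?X = "\<integral>\<^sup>+y. ennreal (F (t, y) * ?K y) * indicator (ball x \<delta>) y \<partial>lborel"
        assume 1: "x \<in> \<Omega> \<longrightarrow> ennreal (norm (u (t, x))) \<le> ennreal C *
          ((\<integral>\<^sup>+y. ennreal (norm (E (t, y)) * ?K y) * indicator (ball x \<delta>) y \<partial>lebesgue_on \<Omega>)
          + (\<integral>\<^sup>+y. ennreal (norm (u (t, y))) \<partial>lebesgue_on \<Omega>))"
          and 2: "(t, x) \<in> ?Q \<longrightarrow> norm (u (t, x)) / N = W (t, x)" and xQ: "(t, x) \<in> ?Q"
        have Fmt [measurable]: "(\<lambda>y. F (t, y)) \<in> borel_measurable borel"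
          by (rule measurable_compose[OF _ Fm]) (intro borel_measurable_continuous_onI continuous_intros)
        have "AE y in lborel. y \<in> \<Omega> \<longrightarrow> ennreal (norm (E (t, y)) * ?K y) * indicator (ball x \<delta>) y =
            ennreal N * (ennreal (F (t, y) * ?K y) * indicator (ball x \<delta>) y)"
          using Ft
        proof (eventually_elim, intro impI)
          fix y assume a: "(t, y) \<in> ?Q \<longrightarrow> norm (E (t, y)) / N = F (t, y)" and "y \<in> \<Omega>"
          then have "norm (E (t, y)) = N * F (t, y)" using N tQ by (auto simp: field_simps)
          then have "ennreal (norm (E (t, y)) * ?K y) = ennreal N * ennreal (F (t, y) * ?K y)"
            using N F0 by (simp add: ennreal_mult[symmetric] mult.assoc)
          then show "ennreal (norm (E (t, y)) * ?K y) * indicator (ball x \<delta>) y =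
            ennreal N * (ennreal (F (t, y) * ?K y) * indicator (ball x \<delta>) y)" by (simp only: mult.assoc)
        qed
        from nn_integral_lebesgue_on_rep[OF \<Omega>s this]
        have "(\<integral>\<^sup>+y. ennreal (norm (E (t, y)) * ?K y) * indicator (ball x \<delta>) y \<partial>lebesgue_on \<Omega>) =
           (\<integral>\<^sup>+y. ennreal N * (ennreal (F (t, y) * ?K y) * indicator (ball x \<delta>) y) * indicator \<Omega> y \<partial>lborel)" .
        also have "\<dots> \<le> (\<integral>\<^sup>+y. ennreal N * (ennreal (F (t, y) * ?K y) * indicator (ball x \<delta>) y) \<partial>lborel)"
          by (intro nn_integral_mono) (auto simp: indicator_def)
        also have "\<dots> = ennreal N * ?X"
          by (intro nn_integral_cmult) measurable
        finally have EX: "(\<integral>\<^sup>+y. ennreal (norm (E (t, y)) * ?K y) * indicator (ball x \<delta>) y \<partial>lebesgue_on \<Omega>) \<le> ennreal N * ?X" .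
        have "ennreal (norm (u (t, x))) \<le> ennreal C *
          ((\<integral>\<^sup>+y. ennreal (norm (E (t, y)) * ?K y) * indicator (ball x \<delta>) y \<partial>lebesgue_on \<Omega>)
          + (\<integral>\<^sup>+y. ennreal (norm (u (t, y))) \<partial>lebesgue_on \<Omega>))"
          using 1 xQ tQ by blast
        also have "\<dots> \<le> ennreal C * (ennreal N * ?X + ennreal (N * (V + 1)))"
          using EX L1 by (intro mult_left_mono add_mono) auto
        finally have "ennreal (1 / N) * ennreal (norm (u (t, x))) \<le> ennreal (1 / N) * (ennreal C * (ennreal N * ?X + ennreal (N * (V + 1))))"
          by (rule mult_left_mono) simp
        also have "\<dots> = ennreal C * ((ennreal (1 / N) * ennreal N) * ?X + ennreal (1 / N) * ennreal (N * (V + 1)))"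
          by (simp only: distrib_left mult_ac)
        also have "ennreal (1 / N) * ennreal N = 1" using N by (simp add: ennreal_mult[symmetric])
        also have "ennreal (1 / N) * ennreal (N * (V + 1)) = ennreal (V + 1)" using N V(1) by (simp add: ennreal_mult'[symmetric] del: ennreal_plus)
        also have "ennreal C * (1 * ?X + ennreal (V + 1)) \<le> ennreal C * (ennreal (V + 1) * ?X + ennreal (V + 1) * 1)"
        proof -
          have "1 \<le> ennreal (V + 1)" using V(1) by simp
          then show ?thesis by (intro mult_left_mono add_mono mult_right_mono) auto
        qed
        also have "\<dots> = ennreal (C * (V + 1)) * (?X + 1)"
        proof -
          have "ennreal (C * (V + 1)) = ennreal C * ennreal (V + 1)"
            using C0' V(1) by (intro ennreal_mult) auto
          then show ?thesis by (simp only: distrib_left mult.assoc)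
        qed
        also have "ennreal (1 / N) * ennreal (norm (u (t, x))) = ennreal (W (t, x))"
          using 2 xQ N by (simp add: ennreal_mult[symmetric] flip: 2[rule_format])
        finally show "ennreal (W (t, x)) \<le> ennreal (C * (V + 1)) * (?X + 1)" .
      qed
      from H2 H3 show "(\<integral>\<^sup>+x. ennreal ((W (t, x))\<^sup>2) * indicator ?Q (t, x) \<partial>lborel) \<le> 1 \<and>
       (AE x in lborel. (t, x) \<in> ?Q \<longrightarrow> ennreal (W (t, x)) \<le> ennreal (C * (V + 1)) *
        ((\<integral>\<^sup>+y. ennreal (F (t, y) * norm (x - y) powr (1 - ?d)) * indicator (ball x \<delta>) y \<partial>lborel) + 1))" by (rule conjI)
    qed
    have sl1: "AE t in lborel. t \<in> ?I \<longrightarrow> (\<integral>\<^sup>+x. ennreal ((W (t, x))\<^sup>2) * indicator ?Q (t, x) \<partial>lborel) \<le> 1"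
      using sl by eventually_elim blast
    have sl2: "AE t in lborel. t \<in> ?I \<longrightarrow> (AE x in lborel. (t, x) \<in> ?Q \<longrightarrow> ennreal (W (t, x)) \<le> ennreal (C * (V + 1)) *
        ((\<integral>\<^sup>+y. ennreal (F (t, y) * norm (x - y) powr (1 - ?d)) * indicator (ball x \<delta>) y \<partial>lborel) + 1))"
      using sl by eventually_elim blast
    have "admissible_pair \<delta> (C * (V + 1)) T ?Q p W F"
      unfolding admissible_pair_def by (intro conjI Wm Fm W0 F0 Fout Fp sl1 sl2)
    then show "\<exists>W F. admissible_pair \<delta> (C * (V + 1)) T ?Q p W F \<and> (AE z in lborel. z \<in> ?Q \<longrightarrow> norm (u z) / N = W z)"
      using Wu by (intro exI conjI)
  qed
qed

text \<open>The constant bounding the modular of \<open>u / N\<close> for all \<open>N\<close> above the sum of the two norms also bounds the Luxemburg norm of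
\<open>u / N\<close>, because all exponents are at least one; then \<open>N\<close> tends to that sum.  Working with strict upper bounds \<open>N\<close> covers
the case that the sum is zero.\<close>

lemma parabolic_estimate:
  fixes \<Omega> :: "(real^'d::finite) set" and p :: "real \<times> (real^'d) \<Rightarrow> real"
  assumes d: "CARD('d) \<ge> 2" and \<Omega>: "open \<Omega>" "bounded \<Omega>" and T: "T > 0"
    and pc: "continuous_on (closure (cylinder T \<Omega>)) p" and P0: "P0 > 1" and pP0: "\<forall>z\<in>cylinder T \<Omega>. P0 \<le> p z"
    and \<epsilon>: "\<epsilon> > 0" "\<epsilon> \<le> parabolic_exponent CARD('d) P0 - 1"
  shows "\<exists>c>0. \<forall>u \<in> X_cyl T \<Omega> p \<inter> Y_inf T \<Omega>.
        u \<in> Lp_var (cylinder T \<Omega>) (\<lambda>z. parabolic_exponent CARD('d) (p z) - \<epsilon>) \<and>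
        Lp_var_norm (cylinder T \<Omega>) (\<lambda>z. parabolic_exponent CARD('d) (p z) - \<epsilon>) u
          \<le> c * (Lp_var_norm (cylinder T \<Omega>) p (sym_grad cyl_dir (cylinder T \<Omega>) u)
                 + Y_inf_norm T \<Omega> u)"
proof -
  let ?Q = "cylinder T \<Omega>"
  let ?P = "parabolic_exponent CARD('d)"
  define q where "q z = ?P (p z) - \<epsilon>" for z
  note Q = cylinder_lmeasurable[OF \<Omega>, of T]
  have comp: "compact (closure ?Q)" using Q(2) by (simp add: compact_closure)
  have pcQ: "continuous_on ?Q p" using pc closure_subset by (rule continuous_on_subset)
  have pm: "p \<in> borel_measurable (lebesgue_on ?Q)"
    using pcQ Q(4) by (rule continuous_imp_measurable_on_sets_lebesgue)
  obtain Pm where "\<forall>z\<in>closure ?Q. p z \<le> Pm"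
    using compact_imp_bounded[OF compact_continuous_image[OF pc comp]] unfolding bounded_real by (metis abs_le_D1 imageI)
  then have pPm: "p z \<le> Pm" if "z \<in> ?Q" for z using that closure_subset by blast
  have pb: "P0 \<le> p z \<and> p z \<le> Pm" if "z \<in> ?Q" for z using pP0 pPm that by blast
  have p1: "\<forall>z\<in>?Q. 1 \<le> p z \<and> p z \<le> Pm"
  proof
    fix z assume "z \<in> ?Q"
    then show "1 \<le> p z \<and> p z \<le> Pm" using pb[of z] P0 by simp
  qed
  have qb: "1 \<le> q z \<and> q z \<le> ?P Pm" if "z \<in> ?Q" for z
  proof -
    have "?P P0 \<le> ?P (p z)" "?P (p z) \<le> ?P Pm"
      using d P0 pb[OF that] by (auto intro!: parabolic_exponent_mono)
    then show ?thesis using \<epsilon> by (simp add: q_def)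
  qed
  have qm: "q \<in> borel_measurable (lebesgue_on ?Q)"
    unfolding q_def[abs_def] using pm by measurable
  have "uniformly_continuous_on (closure ?Q) p" using pc comp by (rule compact_uniformly_continuous)
  then obtain \<delta> where \<delta>: "\<delta> > 0" and osc: "\<forall>z\<in>closure ?Q. \<forall>z'\<in>closure ?Q. dist z' z < \<delta> \<longrightarrow> dist (p z') (p z) < \<epsilon> / 8"
    unfolding uniformly_continuous_on_def using \<epsilon>(1) by (metis zero_less_divide_iff zero_less_numeral)
  have osc': "\<bar>p (t, x) - p (t, y)\<bar> < \<epsilon> / 8" if "(t, x) \<in> ?Q" "(t, y) \<in> ?Q" "dist x y < \<delta>" for t x y
  proof -
    have "(t, x) \<in> closure ?Q" "(t, y) \<in> closure ?Q" using that closure_subset by blast+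
    moreover have "dist (t, x) (t, y) < \<delta>" using that(3) by (simp add: dist_Pair_Pair)
    ultimately show ?thesis using osc by (simp add: dist_real_def)
  qed
  from scaled_pair_admissible[OF \<delta> T \<Omega>]
  obtain C0 where C0': "C0 > 0 \<and> (\<forall>p Pm u N. continuous_on ?Q p \<longrightarrow> (\<forall>z\<in>?Q. 1 \<le> p z \<and> p z \<le> Pm) \<longrightarrow>
    u \<in> X_cyl T \<Omega> p \<longrightarrow> u \<in> Y_inf T \<Omega> \<longrightarrow>
    Lp_var_norm ?Q p (sym_grad cyl_dir ?Q u) < N \<longrightarrow> Y_inf_norm T \<Omega> u < N \<longrightarrow>
    (\<exists>W F. admissible_pair \<delta> C0 T ?Q p W F \<and> (AE z in lborel. z \<in> ?Q \<longrightarrow> norm (u z) / N = W z)))" ..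
  note C0 = conjunct1[OF C0'] and adm = conjunct2[OF C0', rule_format]
  have "\<exists>C\<ge>0. \<forall>W F. admissible_pair \<delta> C0 T ?Q p W F \<longrightarrow>
     (\<integral>\<^sup>+z. ennreal (W z powr (?P (p z) - \<epsilon>)) * indicator ?Q z \<partial>lborel) \<le> ennreal C"
    by (rule cylinder_modular_bound[OF d \<Omega> T \<epsilon>(1) pcQ P0 pb \<delta> C0 osc' \<epsilon>(2)])
  then obtain C where "0 \<le> C \<and> (\<forall>W F. admissible_pair \<delta> C0 T ?Q p W F \<longrightarrow>
     (\<integral>\<^sup>+z. ennreal (W z powr (?P (p z) - \<epsilon>)) * indicator ?Q z \<partial>lborel) \<le> ennreal C)" ..
  then have C: "0 \<le> C" and bnd: "\<And>W F. admissible_pair \<delta> C0 T ?Q p W F \<Longrightarrow>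
     (\<integral>\<^sup>+z. ennreal (W z powr q z) * indicator ?Q z \<partial>lborel) \<le> ennreal C"
    unfolding q_def by blast+
  define c where "c = max 1 C"
  have c: "c \<ge> 1" by (simp add: c_def)
  have main: "modular ?Q q (\<lambda>z. (1 / N) *\<^sub>R u z) \<le> ennreal c"
    if u: "u \<in> X_cyl T \<Omega> p" "u \<in> Y_inf T \<Omega>"
      and N: "Lp_var_norm ?Q p (sym_grad cyl_dir ?Q u) < N" "Y_inf_norm T \<Omega> u < N" for u N
  proof -
    have N0: "N > 0" using Y_inf_norm_bound(1)[OF T u(2)] N(2) by linarith
    from adm[OF pcQ _ u N, of Pm]
    obtain W F where W: "admissible_pair \<delta> C0 T ?Q p W F" "AE z in lborel. z \<in> ?Q \<longrightarrow> norm (u z) / N = W z"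
      using p1 by blast
    have "AE z in lborel. z \<in> ?Q \<longrightarrow> ennreal (norm ((1 / N) *\<^sub>R u z) powr q z) = ennreal (W z powr q z)"
      using W(2)
    proof (eventually_elim, intro impI)
      fix z assume "z \<in> ?Q \<longrightarrow> norm (u z) / N = W z" "z \<in> ?Q"
      then have "norm ((1 / N) *\<^sub>R u z) = W z" using N0 by simp
      then show "ennreal (norm ((1 / N) *\<^sub>R u z) powr q z) = ennreal (W z powr q z)" by (simp only:)
    qed
    from nn_integral_lebesgue_on_rep[OF Q(4) this]
    have "modular ?Q q (\<lambda>z. (1 / N) *\<^sub>R u z) = (\<integral>\<^sup>+z. ennreal (W z powr q z) * indicator ?Q z \<partial>lborel)"
      by (simp add: modular_def)
    also have "\<dots> \<le> ennreal C" by (rule bnd[OF W(1)])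
    also have "\<dots> \<le> ennreal c" by (intro ennreal_leI) (simp add: c_def)
    finally show ?thesis .
  qed
  have "u \<in> Lp_var ?Q q \<and> Lp_var_norm ?Q q u \<le> c * (Lp_var_norm ?Q p (sym_grad cyl_dir ?Q u) + Y_inf_norm T \<Omega> u)"
    if u: "u \<in> X_cyl T \<Omega> p" "u \<in> Y_inf T \<Omega>" for u
  proof -
    let ?A = "Lp_var_norm ?Q p (sym_grad cyl_dir ?Q u)" and ?Y = "Y_inf_norm T \<Omega> u"
    have p1': "\<forall>z\<in>?Q. 1 \<le> p z" using p1 by blast
    have um: "u \<in> borel_measurable (lebesgue_on ?Q)"
      using energy_slices(3)[OF \<Omega> pm p1' u(1)] by (rule borel_measurable_integrable)
    have A0: "?A \<ge> 0" by (rule Lp_var_norm_nonneg[OF energy_slices(1)[OF \<Omega> pm p1' u(1)] p1'[rule_format] pm])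
    have Y0: "?Y \<ge> 0" by (rule Y_inf_norm_bound(1)[OF T u(2)])
    have step: "modular ?Q q (\<lambda>z. (1 / N) *\<^sub>R u z) \<le> ennreal c \<and> Lp_var_norm ?Q q u \<le> c * N" if N: "?A + ?Y < N" for N
    proof
      have N0: "N > 0" using N A0 Y0 by linarith
      show m: "modular ?Q q (\<lambda>z. (1 / N) *\<^sub>R u z) \<le> ennreal c" by (rule main[OF u]) (use N A0 Y0 in linarith)+
      have "modular ?Q q (\<lambda>z. (1 / c) *\<^sub>R ((1 / N) *\<^sub>R u z)) \<le> ennreal (1 / c) * modular ?Q q (\<lambda>z. (1 / N) *\<^sub>R u z)"
        using c qb qm um by (intro modular_scale_le) auto
      also have "\<dots> \<le> ennreal (1 / c) * ennreal c" using m by (intro mult_left_mono) auto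
      also have "\<dots> = 1" using c by (simp add: ennreal_mult[symmetric])
      finally have "modular ?Q q (\<lambda>z. (1 / (c * N)) *\<^sub>R u z) \<le> 1" by simp
      then show "Lp_var_norm ?Q q u \<le> c * N" using c N0 by (intro Lp_var_norm_le) auto
    qed
    have "modular ?Q q u < \<infinity>"
    proof (rule modular_finite_of_scaled[OF _ _ _ qm um])
      show "0 < ?A + ?Y + 1" using A0 Y0 by linarith
      show "modular ?Q q (\<lambda>z. (1 / (?A + ?Y + 1)) *\<^sub>R u z) < \<infinity>"
        using conjunct1[OF step[of "?A + ?Y + 1"]] by (auto intro: le_less_trans)
      show "0 \<le> q z \<and> q z \<le> ?P Pm" if "z \<in> ?Q" for z using qb[OF that] by linarith
    qed
    then have "u \<in> Lp_var ?Q q" using um by (simp add: Lp_var_def)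
    moreover have "Lp_var_norm ?Q q u \<le> c * (?A + ?Y)"
    proof (rule field_le_epsilon)
      fix e :: real assume e: "e > 0"
      have "Lp_var_norm ?Q q u \<le> c * (?A + ?Y + e / c)"
        using c e by (intro conjunct2[OF step]) simp
      also have "\<dots> = c * (?A + ?Y) + e" using c by (simp add: distrib_left)
      finally show "Lp_var_norm ?Q q u \<le> c * (?A + ?Y) + e" .
    qed
    ultimately show ?thesis by (rule conjI)
  qed
  then show ?thesis
    using c unfolding q_def[abs_def] by (intro exI[of _ c]) auto
qed

theorem proposition5p33:
  fixes \<Omega> :: "(real^'d::finite) set" and T :: real and p :: "real \<times> (real^'d) \<Rightarrow> real"
  assumes "CARD('d) \<ge> 2"
    and "open \<Omega>" and "connected \<Omega>" and "\<Omega> \<noteq> {}" and "bounded \<Omega>"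
    and "T > 0"
    and "continuous_on (closure (cylinder T \<Omega>)) p"
    and "ess_inf (cylinder T \<Omega>) p > 1"
  shows "\<forall>\<epsilon>\<in>{0<..parabolic_exponent CARD('d) (ess_inf (cylinder T \<Omega>) p) - 1}.
    (\<exists>c>0. \<forall>u \<in> X_cyl T \<Omega> p \<inter> Y_inf T \<Omega>.
        u \<in> Lp_var (cylinder T \<Omega>) (\<lambda>z. parabolic_exponent CARD('d) (p z) - \<epsilon>) \<and>
        Lp_var_norm (cylinder T \<Omega>) (\<lambda>z. parabolic_exponent CARD('d) (p z) - \<epsilon>) u
          \<le> c * (Lp_var_norm (cylinder T \<Omega>) p (sym_grad cyl_dir (cylinder T \<Omega>) u)
                 + Y_inf_norm T \<Omega> u)) \<and>
    continuously_embedded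
      (X_cyl T \<Omega> p \<inter> Y_inf T \<Omega>)
      (\<lambda>u. X_cyl_norm T \<Omega> p u + Y_inf_norm T \<Omega> u)
      (Lp_var (cylinder T \<Omega>) (\<lambda>z. parabolic_exponent CARD('d) (p z) - \<epsilon>))
      (Lp_var_norm (cylinder T \<Omega>) (\<lambda>z. parabolic_exponent CARD('d) (p z) - \<epsilon>))"
proof
  let ?Q = "cylinder T \<Omega>"
  let ?P = "parabolic_exponent CARD('d)"
  let ?A = "\<lambda>u. Lp_var_norm ?Q p (sym_grad cyl_dir ?Q u)"
  fix \<epsilon> assume \<epsilon>: "\<epsilon> \<in> {0<..?P (ess_inf ?Q p) - 1}"
  have opQ: "open ?Q" by (rule cylinder_lmeasurable(1)[OF assms(2,5)])
  have pc: "continuous_on ?Q p" using assms(7) closure_subset by (rule continuous_on_subset)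
  have "\<forall>z\<in>?Q. ess_inf ?Q p \<le> p z"
    using ess_inf_le_continuous[OF opQ pc] assms(8) by simp
  from parabolic_estimate[OF assms(1,2,5,6,7,8) this] \<epsilon>
  obtain c where c: "c > 0" and est: "\<forall>u \<in> X_cyl T \<Omega> p \<inter> Y_inf T \<Omega>.
        u \<in> Lp_var ?Q (\<lambda>z. ?P (p z) - \<epsilon>) \<and>
        Lp_var_norm ?Q (\<lambda>z. ?P (p z) - \<epsilon>) u \<le> c * (?A u + Y_inf_norm T \<Omega> u)" by auto
  have "Lp_var_norm ?Q (\<lambda>z. ?P (p z) - \<epsilon>) u \<le> c * (X_cyl_norm T \<Omega> p u + Y_inf_norm T \<Omega> u)"
    if "u \<in> X_cyl T \<Omega> p \<inter> Y_inf T \<Omega>" for u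
  proof -
    have "0 \<le> L2_norm ?Q u" unfolding L2_norm_def by (intro real_sqrt_ge_zero integral_nonneg) auto
    then have "c * (?A u + Y_inf_norm T \<Omega> u) \<le> c * (X_cyl_norm T \<Omega> p u + Y_inf_norm T \<Omega> u)"
      using c by (intro mult_left_mono) (auto simp: X_cyl_norm_def sym_energy_norm_def)
    with conjunct2[OF bspec[OF est that]] show ?thesis by (rule order_trans)
  qed
  then have "continuously_embedded (X_cyl T \<Omega> p \<inter> Y_inf T \<Omega>)
      (\<lambda>u. X_cyl_norm T \<Omega> p u + Y_inf_norm T \<Omega> u)
      (Lp_var ?Q (\<lambda>z. ?P (p z) - \<epsilon>)) (Lp_var_norm ?Q (\<lambda>z. ?P (p z) - \<epsilon>))"
    unfolding continuously_embedded_def using est by blast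
  with c est show "(\<exists>c>0. \<forall>u \<in> X_cyl T \<Omega> p \<inter> Y_inf T \<Omega>.
        u \<in> Lp_var ?Q (\<lambda>z. ?P (p z) - \<epsilon>) \<and>
        Lp_var_norm ?Q (\<lambda>z. ?P (p z) - \<epsilon>) u \<le> c * (?A u + Y_inf_norm T \<Omega> u)) \<and>
    continuously_embedded (X_cyl T \<Omega> p \<inter> Y_inf T \<Omega>)
      (\<lambda>u. X_cyl_norm T \<Omega> p u + Y_inf_norm T \<Omega> u)
      (Lp_var ?Q (\<lambda>z. ?P (p z) - \<epsilon>)) (Lp_var_norm ?Q (\<lambda>z. ?P (p z) - \<epsilon>))"
    by blast
qed

end
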